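(* Let $H_\pm$ and $H_e$ satisfy Assumptions 1 and 2 below (with respect to a set $\Omega\subset\mathbb{Z}^2$ and a spectral gap $\mathcal G$). If $\operatorname{Fr}(\Omega)=\operatorname{Fr}(\Omega^c)=\infty$, then $\mathcal G\subset\Sigma(H_e)$.
   Context: Fix $\nu\in(0,1]$ and $d\ge1$. On $\mathbb{Z}^2$ use $|\mathbf x|=|x_1|+|x_2|$ and $B_r(\mathbf x)=\{\mathbf y\in\mathbb{Z}^2:|\mathbf y-\mathbf x|\le r\}$. For an operator $H$ on $\ell^2(\mathbb{Z}^2,\mathbb{C}^d)$, $H(\mathbf x,\mathbf y)\in\mathbb{C}^{d\times d}$ denotes its kernel and $\Sigma(H)$ its spectrum. $H$ is called short-range if it is bounded, selfadjoint, and $|H(\mathbf x,\mathbf y)|\le\nu^{-1}e^{-2\nu|\mathbf x-\mathbf y|}$ for all $\mathbf x,\mathbf y$. For $\lambda\notin\Sigma(H)$ let $P_\lambda(H)=\mathbb 1_{(-\infty,\lambda)}(H)$, let $\Lambda_1,\Lambda_2$ be multiplication by the indicator functions of $\mathbb N\times\mathbb Z$ and $\mathbb Z\times\mathbb N$, and define the bulk conductance $\sigma(H,\lambda)=-2\pi i\operatorname{Tr}\big(P_\lambda(H)[[P_\lambda(H),\Lambda_1],[P_\lambda(H),\Lambda_2]]\big)$ (well defined, an integer, and constant in $\lambda$ on any interval $\mathcal G\subset\Sigma(H)^c$; write $\sigma(H,\mathcal G)$). Assumption 1: $H_\pm$ are short-range on $\ell^2(\mathbb Z^2,\mathbb C^d)$,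 $\mathcal G$ is an interval contained in $\Sigma(H_+)^c\cap\Sigma(H_-)^c$, and $\sigma(H_+,\mathcal G)\ne\sigma(H_-,\mathcal G)$. For $\Omega\subset\mathbb Z^2$ with $\Omega^c=\mathbb Z^2\setminus\Omega$, let $\partial\Omega=\{\mathbf x\in\Omega:B_1(\mathbf x)\not\subset\Omega\}\cup\{\mathbf x\in\Omega^c:B_1(\mathbf x)\not\subset\Omega^c\}$ and $d(\mathbf x,\partial\Omega)$ the distance to it. Assumption 2: $H_e$ is short-range and $E:=H_e-\mathbb 1_\Omega H_+\mathbb 1_\Omega-\mathbb 1_{\Omega^c}H_-\mathbb 1_{\Omega^c}$ satisfies $|E(\mathbf x,\mathbf y)|\le\nu^{-1}e^{-2\nu d(\mathbf x,\partial\Omega)}$ for all $\mathbf x,\mathbf y$. The filling radius is $\operatorname{Fr}(\Omega)=\sup\{r:\exists\mathbf x\in\mathbb Z^2,\ B_r(\mathbf x)\subset\Omega\}$. *)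

theory Defs
  imports "HOL-Analysis.Analysis"
begin

type_synonym site = "int \<times> int"
type_synonym 'd idx = "site \<times> 'd"   \<comment> \<open>basis index of l^2(Z^2, C^d), 'd finite with card d\<close>
type_synonym 'd kernel = "'d idx \<Rightarrow> 'd idx \<Rightarrow> complex"

definition l1 :: "site \<Rightarrow> site \<Rightarrow> int" where
  "l1 x y = \<bar>fst x - fst y\<bar> + \<bar>snd x - snd y\<bar>"

definition lball :: "site \<Rightarrow> real \<Rightarrow> site set" where
  "lball x r = {y. real_of_int (l1 y x) \<le> r}"

definition l2 :: "('i \<Rightarrow> complex) set" where
  "l2 = {f. (\<lambda>i. (cmod (f i))\<^sup>2) summable_on UNIV}"

definition l2norm :: "('i \<Rightarrow> complex) \<Rightarrow> real" where
  "l2norm f = sqrt (infsum (\<lambda>i. (cmod (f i))\<^sup>2) UNIV)"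

definition kapply :: "('i \<Rightarrow> 'i \<Rightarrow> complex) \<Rightarrow> ('i \<Rightarrow> complex) \<Rightarrow> ('i \<Rightarrow> complex)" where
  "kapply K f = (\<lambda>i. infsum (\<lambda>j. K i j * f j) UNIV)"

definition bounded_kernel :: "('i \<Rightarrow> 'i \<Rightarrow> complex) \<Rightarrow> bool" where
  "bounded_kernel K \<longleftrightarrow> (\<exists>C. \<forall>f\<in>l2. (\<forall>i. (\<lambda>j. K i j * f j) summable_on UNIV)
      \<and> kapply K f \<in> l2 \<and> l2norm (kapply K f) \<le> C * l2norm f)"

definition selfadjoint_kernel :: "('i \<Rightarrow> 'i \<Rightarrow> complex) \<Rightarrow> bool" where
  "selfadjoint_kernel K \<longleftrightarrow> bounded_kernel K \<and> (\<forall>i j. K j i = cnj (K i j))"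

definition kshift :: "('i \<Rightarrow> 'i \<Rightarrow> complex) \<Rightarrow> complex \<Rightarrow> ('i \<Rightarrow> 'i \<Rightarrow> complex)" where
  "kshift K z = (\<lambda>i j. K i j - (if i = j then z else 0))"

definition spec :: "('i \<Rightarrow> 'i \<Rightarrow> complex) \<Rightarrow> complex set" where
  "spec K = {z. \<not> (\<exists>R. bounded_kernel R \<and>
      (\<forall>f\<in>l2. kapply (kshift K z) (kapply R f) = f \<and> kapply R (kapply (kshift K z) f) = f))}"

text \<open>Continuous functional calculus: P = 1_(-inf,lam)(K), i.e. P is the operator-norm limit of
  p(K) for real polynomials p converging uniformly on the spectrum to the indicator
  (continuous on the spectrum since lam is not in it).\<close>
definition is_indicator_calc :: "('i \<Rightarrow> 'i \<Rightarrow> complex) \<Rightarrow> real \<Rightarrow> ('i \<Rightarrow> 'i \<Rightarrow> complex) \<Rightarrow> bool" where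
  "is_indicator_calc K lam P \<longleftrightarrow> bounded_kernel P \<and>
     (\<forall>\<epsilon>>0. \<exists>(n::nat) (c::nat \<Rightarrow> real).
        (\<forall>t. complex_of_real t \<in> spec K \<longrightarrow>
              \<bar>(\<Sum>k\<le>n. c k * t ^ k) - (if t < lam then 1 else 0)\<bar> \<le> \<epsilon>)
      \<and> (\<forall>f\<in>l2. l2norm (\<lambda>i. kapply P f i - (\<Sum>k\<le>n. complex_of_real (c k) * ((kapply K ^^ k) f) i))
                   \<le> \<epsilon> * l2norm f))"

definition spec_proj :: "('i \<Rightarrow> 'i \<Rightarrow> complex) \<Rightarrow> real \<Rightarrow> ('i \<Rightarrow> 'i \<Rightarrow> complex)" where
  "spec_proj K lam = (THE P. is_indicator_calc K lam P)"

definition kcomp :: "('i \<Rightarrow> 'i \<Rightarrow> complex) \<Rightarrow> ('i \<Rightarrow> 'i \<Rightarrow> complex) \<Rightarrow> ('i \<Rightarrow> 'i \<Rightarrow> complex)" where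
  "kcomp A B = (\<lambda>i j. infsum (\<lambda>k. A i k * B k j) UNIV)"

definition kcommut :: "('i \<Rightarrow> 'i \<Rightarrow> complex) \<Rightarrow> ('i \<Rightarrow> 'i \<Rightarrow> complex) \<Rightarrow> ('i \<Rightarrow> 'i \<Rightarrow> complex)" where
  "kcommut A B = (\<lambda>i j. kcomp A B i j - kcomp B A i j)"

definition ktrace :: "('i \<Rightarrow> 'i \<Rightarrow> complex) \<Rightarrow> complex" where
  "ktrace T = infsum (\<lambda>i. T i i) UNIV"

definition Lambda1 :: "'d kernel" where
  "Lambda1 = (\<lambda>i j. if i = j \<and> fst (fst i) \<ge> 0 then 1 else 0)"

definition Lambda2 :: "'d kernel" where
  "Lambda2 = (\<lambda>i j. if i = j \<and> snd (fst i) \<ge> 0 then 1 else 0)"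

definition conductance :: "'d kernel \<Rightarrow> real \<Rightarrow> complex" where
  "conductance H lam = (let P = spec_proj H lam in
     - 2 * pi * \<i> * ktrace (kcomp P (kcommut (kcommut P Lambda1) (kcommut P Lambda2))))"

definition conductance_on :: "'d kernel \<Rightarrow> real set \<Rightarrow> complex" where
  "conductance_on H G = conductance H (SOME lam. lam \<in> G)"

definition block :: "'d::finite kernel \<Rightarrow> site \<Rightarrow> site \<Rightarrow> complex^'d^'d" where
  "block K x y = (\<chi> a b. K (x, a) (y, b))"

definition mat_norm :: "complex^'d^'d::finite \<Rightarrow> real" where
  "mat_norm A = onorm (\<lambda>v::complex^'d. A *v v)"

definition short_range :: "real \<Rightarrow> 'd::finite kernel \<Rightarrow> bool" where
  "short_range \<nu> H \<longleftrightarrow> selfadjoint_kernel H \<and>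
     (\<forall>x y. mat_norm (block H x y) \<le> exp (- 2 * \<nu> * real_of_int (l1 x y)) / \<nu>)"

definition bdry :: "site set \<Rightarrow> site set" where
  "bdry \<Omega> = {x\<in>\<Omega>. \<not> lball x 1 \<subseteq> \<Omega>} \<union> {x\<in>-\<Omega>. \<not> lball x 1 \<subseteq> -\<Omega>}"

definition bdist :: "site set \<Rightarrow> site \<Rightarrow> real" where
  "bdist \<Omega> x = Inf ((\<lambda>y. real_of_int (l1 x y)) ` bdry \<Omega>)"

definition edge_pert :: "'d kernel \<Rightarrow> 'd kernel \<Rightarrow> 'd kernel \<Rightarrow> site set \<Rightarrow> 'd kernel" where
  "edge_pert He Hp Hm \<Omega> = (\<lambda>i j. He i j
      - (if fst i \<in> \<Omega> \<and> fst j \<in> \<Omega> then Hp i j else 0)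
      - (if fst i \<notin> \<Omega> \<and> fst j \<notin> \<Omega> then Hm i j else 0))"

definition filling_radius :: "site set \<Rightarrow> ereal" where
  "filling_radius \<Omega> = Sup {ereal r | r. \<exists>x. lball x r \<subseteq> \<Omega>}"

end

(*
  Suppose lam in G is not in the spectrum of H_e. The function t |-> 1_(t < lam) is
  approximated on the spectrum, with geometric rate, by the polynomials obtained from
  sgn x = x * sum_k a_k (1 - x^2)^k, the binomial series of (1 - (1 - x^2))^(-1/2). Since powers
  of a short-range kernel decay exponentially, at the cost of a constant to the power k, so does
  the kernel of the spectral projection P.

  The conductance is then the absolutely convergent sum over x, y, z of P(x,y) P(y,z) P(z,x)
  times the oriented area of the triangle (x,y,z) seen through the indicators of the two half
  planes. As P^2 = P, this sum does not change when the corner of the half planes is moved.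
  Moving the corner to the centres of larger and larger balls in Omega, where H_e and H_+
  agree up to exponentially small errors, dominated convergence identifies the conductances of
  H_e and H_+. The same argument in the complement gives that of H_-, contradicting
  Assumption 1.
*)

theory Submission
  imports Defs "HOL-Computational_Algebra.Fundamental_Theorem_Algebra"
begin

text \<open>All functions of \<open>H\<close> are limits of real polynomials, which is also the form
  in which \<open>is_indicator_calc\<close> asks for the projection. What makes this work is
  \<open>spectral_bound\<close>: the norm of p(H) is at most the supremum of |p| over the spectrum.
  On its own this bound sees no locality, while estimating powers of \<open>H\<close> entry by entry
  gives exponential decay with constants that grow geometrically in the degree. Every term of the
  series obeys both estimates, and a weighted geometric mean of the two keeps part of the smallness
  and part of the decay; the gap is what makes the first estimate geometric. The spectrum enters as
  the set of real t for which H - t is not bounded below. This notion passes through products of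
  linear factors without any inverse. A series for 1/x, built like the one for sgn x, shows
  afterwards that it agrees with \<open>spec\<close> on the real line. The comparison of two
  operators is qualitative: their projections are sums of the same polynomials, so entrywise
  convergence of the Hamiltonians around a moving centre is inherited term by term, and summable
  majorants do the rest.\<close>

section \<open>Dominated convergence and double series\<close>

lemma infsum_split_finite:
  fixes f :: "'a \<Rightarrow> 'b::banach"
  assumes "f summable_on UNIV" "finite F"
  shows "infsum f UNIV = sum f F + infsum f (- F)"
proof -
  have "infsum f (F \<union> - F) = infsum f F + infsum f (- F)"
    using assms by (intro infsum_Un_disjoint) (auto intro: summable_on_subset_banach)
  then show ?thesis using assms by simp
qed

text \<open>A finite \<open>F\<close> carries \<open>g\<close> up to r/8, so both tails are
  negligible uniformly in \<open>n\<close>, and on \<open>F\<close> only finitely many limits are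
  taken. The locality argument uses it for products, series and triangle sums.\<close>

lemma infsum_dominated_tendsto:
  fixes f :: "nat \<Rightarrow> 'a \<Rightarrow> 'b::banach"
  assumes g: "g summable_on UNIV"
    and le: "\<And>n x. norm (f n x) \<le> g x"
    and lim: "\<And>x. (\<lambda>n. f n x) \<longlonglongrightarrow> h x"
  shows "(\<lambda>n. infsum (f n) UNIV) \<longlonglongrightarrow> infsum h UNIV"
proof (rule LIMSEQ_I)
  fix r :: real assume r: "0 < r"
  have hle: "norm (h x) \<le> g x" for x
    by (rule tendsto_upperbound[OF tendsto_norm[OF lim]]) (auto simp: le)
  have g0: "g x \<ge> 0" for x using le[of 0 x] norm_ge_zero order_trans by blast
  have fs: "(\<lambda>x. norm (f n x)) summable_on A" for n A
    by (rule Infinite_Sum.abs_summable_on_comparison_test'[OF summable_on_subset_banach[OF g]]) (auto simp: le)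
  have hs: "(\<lambda>x. norm (h x)) summable_on A" for A
    by (rule Infinite_Sum.abs_summable_on_comparison_test'[OF summable_on_subset_banach[OF g]]) (auto simp: hle)
  obtain F where F: "finite F" "dist (sum g F) (infsum g UNIV) \<le> r/8"
    using infsum_finite_approximation[OF g, of "r/8"] r by auto
  have gc: "infsum g (- F) \<le> r/8"
    using infsum_split_finite[OF g F(1)] F(2) by (auto simp: dist_real_def)
  have tail: "norm (infsum k (- F)) \<le> r/8" if "\<And>x. norm (k x) \<le> g x" "\<And>A. (\<lambda>x. norm (k x)) summable_on A"
    for k :: "'a \<Rightarrow> 'b"
  proof -
    have "norm (infsum k (- F)) \<le> infsum (\<lambda>x. norm (k x)) (- F)" by (rule norm_infsum_bound[OF that(2)])
    also have "\<dots> \<le> infsum g (- F)"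
      by (rule infsum_mono) (use that summable_on_subset_banach[OF g] in auto)
    finally show ?thesis using gc by simp
  qed
  have "(\<lambda>n. sum (f n) F) \<longlonglongrightarrow> sum h F" by (intro tendsto_sum lim)
  then obtain N where N: "\<And>n. n \<ge> N \<Longrightarrow> norm (sum (f n) F - sum h F) < r/2"
    using LIMSEQ_D r by (metis half_gt_zero)
  show "\<exists>N. \<forall>n\<ge>N. norm (infsum (f n) UNIV - infsum h UNIV) < r"
  proof (intro exI allI impI)
    fix n assume n: "N \<le> n"
    have "infsum (f n) UNIV - infsum h UNIV
      = (sum (f n) F - sum h F) + infsum (f n) (- F) - infsum h (- F)"
      by (simp add: infsum_split_finite[OF abs_summable_summable[OF fs] F(1)]
          infsum_split_finite[OF abs_summable_summable[OF hs] F(1)])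
    also have "norm \<dots> \<le> norm (sum (f n) F - sum h F) + norm (infsum (f n) (- F)) + norm (infsum h (- F))"
      by (meson norm_triangle_ineq norm_triangle_ineq4 order_trans add_mono order_refl)
    also have "\<dots> < r/2 + r/8 + r/8 + r/8"
      using N[OF n] tail[of "f n"] tail[of h] le fs hle hs r by (auto intro!: add_strict_mono add_less_le_mono)
    finally show "norm (infsum (f n) UNIV - infsum h UNIV) < r" using r by simp
  qed
qed

corollary infsum_dominated_tendsto_0:
  fixes f :: "nat \<Rightarrow> 'a \<Rightarrow> 'b::banach"
  assumes "g summable_on UNIV" "\<And>n x. norm (f n x) \<le> g x" "\<And>x. (\<lambda>n. f n x) \<longlonglongrightarrow> 0"
  shows "(\<lambda>n. infsum (f n) UNIV) \<longlonglongrightarrow> 0"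
  using infsum_dominated_tendsto[OF assms] by simp

lemma nonneg_double_summable:
  fixes f :: "'a \<Rightarrow> 'b \<Rightarrow> real"
  assumes nn: "\<And>x y. f x y \<ge> 0" and s: "\<And>x. f x summable_on UNIV"
    and le: "\<And>x. infsum (f x) UNIV \<le> g x" and g: "g summable_on UNIV"
  shows "(\<lambda>(x,y). f x y) summable_on UNIV \<times> UNIV"
    and "(\<lambda>x. infsum (f x) UNIV) summable_on UNIV"
    and "infsum (\<lambda>x. infsum (f x) UNIV) UNIV \<le> infsum g UNIV"
proof -
  show 1: "(\<lambda>x. infsum (f x) UNIV) summable_on UNIV"
    by (rule summable_on_comparison_test[OF g le]) (auto intro: infsum_nonneg nn)
  show "(\<lambda>(x,y). f x y) summable_on UNIV \<times> UNIV"
    by (rule summable_on_SigmaI[OF _ 1]) (use s nn in auto)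
  show "infsum (\<lambda>x. infsum (f x) UNIV) UNIV \<le> infsum g UNIV"
    by (rule infsum_mono[OF 1 g le])
qed

text \<open>Fubini with the majorant controlled through its row sums, the quantity that a decaying
  kernel bounds.\<close>

lemma infsum_swap_dominated:
  fixes f :: "'a \<Rightarrow> 'b \<Rightarrow> 'c::banach"
  assumes "\<And>x y. norm (f x y) \<le> g x y" "\<And>x. g x summable_on UNIV"
    "\<And>x. infsum (g x) UNIV \<le> h x" "h summable_on UNIV"
  shows "infsum (\<lambda>x. infsum (f x) UNIV) UNIV = infsum (\<lambda>y. infsum (\<lambda>x. f x y) UNIV) UNIV"
proof (rule infsum_swap_banach)
  have g0: "g x y \<ge> 0" for x y using assms(1)[of x y] norm_ge_zero order_trans by blast
  have "(\<lambda>p. norm (case p of (x, y) \<Rightarrow> f x y)) summable_on UNIV \<times> UNIV"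
    by (rule Infinite_Sum.abs_summable_on_comparison_test'[OF nonneg_double_summable(1)[of g h]])
      (use assms g0 in auto)
  then show "(\<lambda>(x, y). f x y) summable_on UNIV \<times> UNIV"
    by (rule abs_summable_summable)
qed

section \<open>The Hilbert space of square summable functions\<close>

lemma l2_iff: "f \<in> l2 \<longleftrightarrow> (\<lambda>i. (cmod (f i))\<^sup>2) summable_on UNIV"
  by (simp add: l2_def)

lemma l2norm_ge_0 [simp]: "0 \<le> l2norm f"
  by (auto simp: l2norm_def intro!: infsum_nonneg)

lemma l2norm_sq: "(l2norm f)\<^sup>2 = infsum (\<lambda>i. (cmod (f i))\<^sup>2) UNIV"
  unfolding l2norm_def by (intro real_sqrt_pow2 infsum_nonneg) auto

lemma L2_set_le_l2norm:
  assumes "f \<in> l2" "finite F" shows "L2_set (\<lambda>i. cmod (f i)) F \<le> l2norm f"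
  unfolding L2_set_def l2norm_def
  using assms by (intro real_sqrt_le_mono finite_sum_le_infsum) (auto simp: l2_iff)

text \<open>Transfers estimates on finite sets, such as Minkowski's inequality and later Schur's
  test, to the infinite sums.\<close>

lemma l2_bounded_L2_set:
  assumes b: "\<And>F. finite F \<Longrightarrow> L2_set (\<lambda>i. cmod (f i)) F \<le> B"
  shows "f \<in> l2" "l2norm f \<le> B"
proof -
  have B0: "0 \<le> B" using b[of "{}"] by simp
  have le: "(\<Sum>i\<in>F. (cmod (f i))\<^sup>2) \<le> B\<^sup>2" if "finite F" for F
    using power_mono[OF b[OF that], of 2] by (simp add: L2_set_def sum_nonneg)
  show l: "f \<in> l2" unfolding l2_iff
    by (rule nonneg_bdd_above_summable_on) (use le in \<open>auto intro!: bdd_aboveI2\<close>)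
  have "infsum (\<lambda>i. (cmod (f i))\<^sup>2) UNIV \<le> B\<^sup>2"
    by (rule infsum_le_finite_sums) (use l le in \<open>auto simp: l2_iff\<close>)
  then show "l2norm f \<le> B"
    unfolding l2norm_def using B0 by (simp add: real_le_lsqrt infsum_nonneg)
qed

lemma
  assumes f: "f \<in> l2" and g: "g \<in> l2"
  shows l2_add: "(\<lambda>i. f i + g i) \<in> l2"
    and l2norm_triangle: "l2norm (\<lambda>i. f i + g i) \<le> l2norm f + l2norm g"
proof -
  have *: "L2_set (\<lambda>i. cmod (f i + g i)) F \<le> l2norm f + l2norm g" if F: "finite F" for F
  proof -
    have "L2_set (\<lambda>i. cmod (f i + g i)) F \<le> L2_set (\<lambda>i. cmod (f i) + cmod (g i)) F"
      by (intro L2_set_mono) (auto simp: norm_triangle_ineq)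
    also have "\<dots> \<le> L2_set (\<lambda>i. cmod (f i)) F + L2_set (\<lambda>i. cmod (g i)) F"
      by (rule L2_set_triangle_ineq)
    finally show ?thesis using L2_set_le_l2norm[OF f F] L2_set_le_l2norm[OF g F] by linarith
  qed
  show "(\<lambda>i. f i + g i) \<in> l2" "l2norm (\<lambda>i. f i + g i) \<le> l2norm f + l2norm g"
    using l2_bounded_L2_set[OF *] by auto
qed

lemma
  assumes f: "f \<in> l2"
  shows l2_scale: "(\<lambda>i. c * f i) \<in> l2"
    and l2norm_scale: "l2norm (\<lambda>i. c * f i) = cmod c * l2norm f"
proof -
  show "(\<lambda>i. c * f i) \<in> l2"
    using f by (auto simp: l2_iff norm_mult power_mult_distrib intro: summable_on_cmult_right)
  show "l2norm (\<lambda>i. c * f i) = cmod c * l2norm f"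
    by (simp add: l2norm_def norm_mult power_mult_distrib infsum_cmult_right' real_sqrt_mult)
qed

lemma l2_zero [simp]: "(\<lambda>i. 0) \<in> l2" by (simp add: l2_iff)
lemma l2norm_zero [simp]: "l2norm (\<lambda>i. 0) = 0" by (simp add: l2norm_def)

lemma l2_uminus: "f \<in> l2 \<Longrightarrow> (\<lambda>i. - f i) \<in> l2" by (simp add: l2_iff)
lemma l2norm_uminus: "l2norm (\<lambda>i. - f i) = l2norm f" by (simp add: l2norm_def)
lemma l2norm_minus_commute: "l2norm (\<lambda>i. f i - g i) = l2norm (\<lambda>i. g i - f i)"
  by (simp add: l2norm_def norm_minus_commute)

lemma l2_diff: "f \<in> l2 \<Longrightarrow> g \<in> l2 \<Longrightarrow> (\<lambda>i. f i - g i) \<in> l2"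
  using l2_add[OF _ l2_uminus, of f g] by simp

lemma l2norm_triangle_diff: "f \<in> l2 \<Longrightarrow> g \<in> l2 \<Longrightarrow> l2norm (\<lambda>i. f i - g i) \<le> l2norm f + l2norm g"
  using l2norm_triangle[OF _ l2_uminus, of f g] by (simp add: l2norm_uminus)

lemma l2norm_triangle_3:
  assumes "f \<in> l2" "g \<in> l2" "h \<in> l2"
  shows "l2norm (\<lambda>i. f i - h i) \<le> l2norm (\<lambda>i. f i - g i) + l2norm (\<lambda>i. g i - h i)"
  using l2norm_triangle[OF l2_diff[OF assms(1,2)] l2_diff[OF assms(2,3)]] by simp

lemma l2_sum: "(\<And>k. k \<in> A \<Longrightarrow> f k \<in> l2) \<Longrightarrow> (\<lambda>i. \<Sum>k\<in>A. f k i) \<in> l2"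
  by (induction A rule: infinite_finite_induct) (auto intro!: l2_add)

lemma cmod_le_l2norm: assumes "f \<in> l2" shows "cmod (f i) \<le> l2norm f"
  using L2_set_le_l2norm[OF assms, of "{i}"] by simp

lemma l2norm_eq_0D: assumes "f \<in> l2" "l2norm f = 0" shows "f = (\<lambda>i. 0)"
  using cmod_le_l2norm[OF assms(1)] assms(2) by auto

section \<open>Unit vectors and the inner product\<close>

definition unit_fn :: "'i \<Rightarrow> 'i \<Rightarrow> complex" where
  "unit_fn j = (\<lambda>i. if i = j then 1 else 0)"

lemma unit_fn_l2 [simp]: "unit_fn j \<in> l2"
  unfolding l2_iff by (rule finite_nonzero_values_imp_summable_on)
    (auto simp: unit_fn_def intro: finite_subset[of _ "{j}"])

lemma l2norm_unit_fn [simp]: "l2norm (unit_fn j) = 1"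
proof -
  have "infsum (\<lambda>i. (cmod (unit_fn j i))\<^sup>2) UNIV = infsum (\<lambda>i. (cmod (unit_fn j i))\<^sup>2) {j}"
    by (rule infsum_cong_neutral) (auto simp: unit_fn_def)
  then show ?thesis by (simp add: l2norm_def unit_fn_def)
qed

definition ip :: "('i \<Rightarrow> complex) \<Rightarrow> ('i \<Rightarrow> complex) \<Rightarrow> complex" where
  "ip f g = infsum (\<lambda>i. f i * cnj (g i)) UNIV"

lemma
  assumes f: "f \<in> l2" and g: "g \<in> l2"
  shows ip_abs_summable: "(\<lambda>i. cmod (f i) * cmod (g i)) summable_on UNIV"
    and ip_abs_le: "infsum (\<lambda>i. cmod (f i) * cmod (g i)) UNIV \<le> l2norm f * l2norm g"
proof -
  have *: "(\<Sum>i\<in>F. cmod (f i) * cmod (g i)) \<le> l2norm f * l2norm g" if F: "finite F" for F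
  proof -
    have "(\<Sum>i\<in>F. cmod (f i) * cmod (g i)) \<le> L2_set (\<lambda>i. cmod (f i)) F * L2_set (\<lambda>i. cmod (g i)) F"
      using L2_set_mult_ineq[of "\<lambda>i. cmod (f i)" "\<lambda>i. cmod (g i)" F] by simp
    also have "\<dots> \<le> l2norm f * l2norm g"
      by (intro mult_mono L2_set_le_l2norm f g F) auto
    finally show ?thesis .
  qed
  show s: "(\<lambda>i. cmod (f i) * cmod (g i)) summable_on UNIV"
    by (rule nonneg_bdd_above_summable_on) (use * in \<open>auto intro!: bdd_aboveI2\<close>)
  show "infsum (\<lambda>i. cmod (f i) * cmod (g i)) UNIV \<le> l2norm f * l2norm g"
    by (rule infsum_le_finite_sums[OF s]) (use * in auto)
qed

lemma ip_summable:
  assumes "f \<in> l2" "g \<in> l2" shows "(\<lambda>i. f i * cnj (g i)) summable_on UNIV"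
  by (rule abs_summable_summable) (use ip_abs_summable[OF assms] in \<open>simp add: norm_mult\<close>)

lemma ip_le: assumes "f \<in> l2" "g \<in> l2" shows "cmod (ip f g) \<le> l2norm f * l2norm g"
proof -
  have "cmod (ip f g) \<le> infsum (\<lambda>i. cmod (f i * cnj (g i))) UNIV"
    unfolding ip_def by (rule norm_infsum_bound) (use ip_abs_summable[OF assms] in \<open>simp add: norm_mult\<close>)
  also have "\<dots> \<le> l2norm f * l2norm g" using ip_abs_le[OF assms] by (simp add: norm_mult)
  finally show ?thesis .
qed

lemma ip_add_left: "f \<in> l2 \<Longrightarrow> g \<in> l2 \<Longrightarrow> h \<in> l2 \<Longrightarrow> ip (\<lambda>i. f i + g i) h = ip f h + ip g h"
  unfolding ip_def by (simp add: ring_distribs infsum_add ip_summable)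
lemma ip_add_right: "f \<in> l2 \<Longrightarrow> g \<in> l2 \<Longrightarrow> h \<in> l2 \<Longrightarrow> ip h (\<lambda>i. f i + g i) = ip h f + ip h g"
  unfolding ip_def by (simp add: ring_distribs infsum_add ip_summable)
lemma ip_scale_left: "ip (\<lambda>i. c * f i) h = c * ip f h"
  unfolding ip_def by (simp add: mult.assoc infsum_cmult_right')
lemma ip_scale_right: "ip h (\<lambda>i. c * f i) = cnj c * ip h f"
  unfolding ip_def by (simp add: mult.left_commute infsum_cmult_right')
lemma ip_cnj: "ip g f = cnj (ip f g)"
  unfolding ip_def by (simp add: mult.commute flip: infsum_cnj)
lemma ip_self: assumes "f \<in> l2" shows "ip f f = complex_of_real ((l2norm f)\<^sup>2)"
proof -
  have "ip f f = infsum (\<lambda>i. complex_of_real ((cmod (f i))\<^sup>2)) UNIV"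
    unfolding ip_def by (simp add: complex_norm_square[symmetric] del: of_real_power)
  also have "\<dots> = complex_of_real ((l2norm f)\<^sup>2)"
    unfolding l2norm_sq using assms
    by (intro infsumI has_sum_of_real) (auto simp: l2_iff)
  finally show ?thesis .
qed

lemma l2norm_diff_sq:
  assumes "f \<in> l2" "g \<in> l2"
  shows "(l2norm (\<lambda>i. f i - g i))\<^sup>2 = (l2norm f)\<^sup>2 + (l2norm g)\<^sup>2 - 2 * Re (ip f g)"
proof -
  have g': "(\<lambda>i. -1 * g i) \<in> l2" by (rule l2_scale[OF assms(2)])
  have "complex_of_real ((l2norm (\<lambda>i. f i + -1 * g i))\<^sup>2) = ip (\<lambda>i. f i + -1 * g i) (\<lambda>i. f i + -1 * g i)"
    by (rule ip_self[symmetric, OF l2_add[OF assms(1) g']])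
  also have "\<dots> = ip f f - ip f g - (ip g f - ip g g)"
    by (simp only: ip_add_left ip_add_right assms g' l2_add ip_scale_left ip_scale_right) simp
  also have "\<dots> = complex_of_real ((l2norm f)\<^sup>2 + (l2norm g)\<^sup>2) - (ip f g + cnj (ip f g))"
    by (simp add: ip_self assms ip_cnj[of g f])
  also have "ip f g + cnj (ip f g) = complex_of_real (2 * Re (ip f g))"
    by (simp add: complex_add_cnj)
  finally show ?thesis
    by (metis (no_types, lifting) ext mult_minus1 of_real_diff of_real_eq_iff uminus_add_conv_diff add.commute)
qed

section \<open>Polynomials of a bounded selfadjoint operator\<close>

text \<open>Stands in for invertibility: it composes along factors without an inverse at hand, and
  for selfadjoint \<open>H\<close> its failure at H - t turns out to characterise the spectrum
  (\<open>spec_iff\<close>).\<close>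

definition bounded_below :: "(('i \<Rightarrow> complex) \<Rightarrow> ('i \<Rightarrow> complex)) \<Rightarrow> bool" where
  "bounded_below S \<longleftrightarrow> (\<exists>c>0. \<forall>f\<in>l2. c * l2norm f \<le> l2norm (S f))"

text \<open>Polynomials are complex so that they split into linear factors; real coefficients are
  what keeps p(T) symmetric.\<close>

definition real_coeffs :: "complex poly \<Rightarrow> bool" where
  "real_coeffs p \<longleftrightarrow> (\<forall>k. coeff p k \<in> \<real>)"

lemma real_coeffs_simps [intro, simp]:
  "real_coeffs 0" "real_coeffs 1"
  "real_coeffs (pCons a p) \<longleftrightarrow> a \<in> \<real> \<and> real_coeffs p"
  unfolding real_coeffs_def by (auto simp: coeff_pCons split: nat.splits)

lemma real_coeffs_ops [intro]:
  "real_coeffs p \<Longrightarrow> real_coeffs q \<Longrightarrow> real_coeffs (p + q)"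
  "real_coeffs p \<Longrightarrow> real_coeffs q \<Longrightarrow> real_coeffs (p - q)"
  "real_coeffs p \<Longrightarrow> real_coeffs q \<Longrightarrow> real_coeffs (p * q)"
  "a \<in> \<real> \<Longrightarrow> real_coeffs p \<Longrightarrow> real_coeffs (smult a p)"
  unfolding real_coeffs_def by (auto simp: coeff_mult intro!: sum_in_Reals)

lemma real_coeffs_power [intro]: "real_coeffs p \<Longrightarrow> real_coeffs (p ^ n)"
  by (induction n) auto

lemma real_coeffs_sum [intro]: "(\<And>x. x \<in> A \<Longrightarrow> real_coeffs (p x)) \<Longrightarrow> real_coeffs (\<Sum>x\<in>A. p x)"
  by (induction A rule: infinite_finite_induct) auto

definition op_poly :: "(('i \<Rightarrow> complex) \<Rightarrow> ('i \<Rightarrow> complex)) \<Rightarrow> complex poly \<Rightarrow> ('i \<Rightarrow> complex) \<Rightarrow> ('i \<Rightarrow> complex)" where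
  "op_poly T p f = (\<lambda>i. \<Sum>k\<le>degree p. coeff p k * (T ^^ k) f i)"

lemma op_poly_eq_sum:
  assumes "degree p \<le> n"
  shows "op_poly T p f = (\<lambda>i. \<Sum>k\<le>n. coeff p k * (T ^^ k) f i)"
  unfolding op_poly_def
  by (rule ext, rule sum.mono_neutral_left) (use assms in \<open>auto simp: coeff_eq_0\<close>)

section \<open>Polynomial calculus of a bounded operator\<close>

locale l2_operator =
  fixes T :: "('i \<Rightarrow> complex) \<Rightarrow> ('i \<Rightarrow> complex)" and K :: real
  assumes T_l2: "f \<in> l2 \<Longrightarrow> T f \<in> l2"
    and T_add: "f \<in> l2 \<Longrightarrow> g \<in> l2 \<Longrightarrow> T (\<lambda>i. f i + g i) = (\<lambda>i. T f i + T g i)"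
    and T_scale: "f \<in> l2 \<Longrightarrow> T (\<lambda>i. c * f i) = (\<lambda>i. c * T f i)"
    and T_bound: "f \<in> l2 \<Longrightarrow> l2norm (T f) \<le> K * l2norm f"
begin

lemma T_pow_l2: "f \<in> l2 \<Longrightarrow> (T ^^ k) f \<in> l2"
  by (induction k) (auto intro: T_l2)

lemma T_zero: "T (\<lambda>i. 0) = (\<lambda>i. 0)"
  using T_scale[of "\<lambda>i. 0" 0] by simp

lemma T_sum: "(\<And>k. k \<in> A \<Longrightarrow> f k \<in> l2) \<Longrightarrow> T (\<lambda>i. \<Sum>k\<in>A. f k i) = (\<lambda>i. \<Sum>k\<in>A. T (f k) i)"
  by (induction A rule: infinite_finite_induct) (auto simp: T_zero T_add l2_sum)

lemma op_poly_l2: "f \<in> l2 \<Longrightarrow> op_poly T p f \<in> l2"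
  unfolding op_poly_def by (intro l2_sum l2_scale T_pow_l2)

lemma op_poly_0: "op_poly T 0 f = (\<lambda>i. 0)"
  by (simp add: op_poly_def)

lemma op_poly_pCons:
  assumes f: "f \<in> l2"
  shows "op_poly T (pCons a p) f = (\<lambda>i. a * f i + T (op_poly T p f) i)"
proof -
  have "op_poly T (pCons a p) f = (\<lambda>i. \<Sum>k\<le>Suc (degree p). coeff (pCons a p) k * (T ^^ k) f i)"
    by (rule op_poly_eq_sum) (simp add: degree_pCons_le)
  also have "\<dots> = (\<lambda>i. a * f i + (\<Sum>k\<le>degree p. coeff p k * T ((T ^^ k) f) i))"
    by (simp add: sum.atMost_Suc_shift del: sum.atMost_Suc)
  also have "\<dots> = (\<lambda>i. a * f i + T (op_poly T p f) i)"
    unfolding op_poly_def by (simp add: T_sum l2_scale T_pow_l2 f T_scale)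
  finally show ?thesis .
qed

lemma op_poly_add: "op_poly T (p + q) f = (\<lambda>i. op_poly T p f i + op_poly T q f i)"
proof -
  define n where "n = max (degree p) (degree q)"
  have "degree (p + q) \<le> n" "degree p \<le> n" "degree q \<le> n"
    by (auto simp: n_def degree_add_le_max)
  then show ?thesis
    by (simp add: op_poly_eq_sum[of _ n] ring_distribs sum.distrib)
qed

lemma op_poly_smult: "op_poly T (smult c p) f = (\<lambda>i. c * op_poly T p f i)"
  by (simp add: op_poly_eq_sum[of "smult c p" "degree p"] op_poly_def sum_distrib_left mult.assoc degree_smult_le)

lemma op_poly_diff: "op_poly T (p - q) f = (\<lambda>i. op_poly T p f i - op_poly T q f i)"
  using op_poly_add[of p "smult (-1) q" f] op_poly_smult[of "-1" q f] by simp

lemma op_poly_sum: "op_poly T (\<Sum>x\<in>A. p x) f = (\<lambda>i. \<Sum>x\<in>A. op_poly T (p x) f i)"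
  by (induction A rule: infinite_finite_induct) (auto simp: op_poly_0 op_poly_add)

lemma op_poly_const: "f \<in> l2 \<Longrightarrow> op_poly T [:c:] f = (\<lambda>i. c * f i)"
  by (simp add: op_poly_pCons op_poly_0 T_zero)

lemma op_poly_linear: "f \<in> l2 \<Longrightarrow> op_poly T [:c, d:] f = (\<lambda>i. c * f i + d * T f i)"
  by (simp add: op_poly_pCons[of f c] op_poly_const T_scale)

lemma op_poly_mult: "f \<in> l2 \<Longrightarrow> op_poly T (p * q) f = op_poly T p (op_poly T q f)"
proof (induction p)
  case 0
  then show ?case by (simp add: op_poly_0)
next
  case (pCons a p)
  have "op_poly T (pCons a p * q) f = (\<lambda>i. a * op_poly T q f i + op_poly T (pCons 0 (p * q)) f i)"
    by (simp add: op_poly_add op_poly_smult)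
  also have "\<dots> = (\<lambda>i. a * op_poly T q f i + T (op_poly T p (op_poly T q f)) i)"
    using pCons by (simp add: op_poly_pCons)
  also have "\<dots> = op_poly T (pCons a p) (op_poly T q f)"
    by (simp add: op_poly_pCons op_poly_l2 pCons.prems)
  finally show ?case .
qed

lemma op_poly_commute: assumes "f \<in> l2" shows "T (op_poly T p f) = op_poly T p (T f)"
proof -
  have X: "op_poly T [:0, 1:] g = T g" if "g \<in> l2" for g
    using op_poly_linear[OF that, of 0 1] by simp
  have "T (op_poly T p f) = op_poly T ([:0, 1:] * p) f"
    by (simp only: op_poly_mult[OF assms] X[OF op_poly_l2[OF assms]])
  also have "\<dots> = op_poly T (p * [:0, 1:]) f" by (simp only: mult.commute)
  also have "\<dots> = op_poly T p (T f)" by (simp only: op_poly_mult[OF assms] X[OF assms])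
  finally show ?thesis .
qed

lemma op_poly_bounded: "\<exists>C\<ge>0. \<forall>f\<in>l2. l2norm (op_poly T p f) \<le> C * l2norm f"
proof (induction p)
  case 0
  show ?case by (rule exI[of _ 0]) (simp add: op_poly_0)
next
  case (pCons a p)
  then obtain C where C: "C \<ge> 0" "\<And>f. f \<in> l2 \<Longrightarrow> l2norm (op_poly T p f) \<le> C * l2norm f" by blast
  have "l2norm (op_poly T (pCons a p) f) \<le> (cmod a + \<bar>K\<bar> * C) * l2norm f" if f: "f \<in> l2" for f
  proof -
    have "l2norm (op_poly T (pCons a p) f) \<le> l2norm (\<lambda>i. a * f i) + l2norm (T (op_poly T p f))"
      unfolding op_poly_pCons[OF f] by (intro l2norm_triangle l2_scale T_l2 op_poly_l2 f)
    also have "l2norm (T (op_poly T p f)) \<le> \<bar>K\<bar> * l2norm (op_poly T p f)"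
      using T_bound[OF op_poly_l2[OF f], of p]
      by (meson abs_ge_self l2norm_ge_0 mult_right_mono order_trans)
    also have "\<dots> \<le> \<bar>K\<bar> * (C * l2norm f)" by (intro mult_left_mono C f) auto
    finally show ?thesis by (simp add: l2norm_scale f algebra_simps)
  qed
  then show ?case using C by (intro exI[of _ "cmod a + \<bar>K\<bar> * C"]) auto
qed

text \<open>Splitting off one root at a time writes p(T) as a product of factors T - z, and lower
  bounds multiply along a composition.\<close>

lemma bounded_below_op_poly:
  assumes "p \<noteq> 0" "\<And>z. poly p z = 0 \<Longrightarrow> bounded_below (op_poly T [:- z, 1:])"
  shows "bounded_below (op_poly T p)"
  using assms
proof (induction "degree p" arbitrary: p)
  case 0
  then obtain c where p: "p = [:c:]" using degree_eq_zeroE by metis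
  with 0 have "c \<noteq> 0" by auto
  then show ?case unfolding bounded_below_def p
    by (intro exI[of _ "cmod c"]) (auto simp: op_poly_const l2norm_scale)
next
  case (Suc n)
  obtain z where z: "poly p z = 0"
    using fundamental_theorem_of_algebra[of p] Suc.hyps(2) constant_degree[of p] by auto
  then obtain q where q: "p = [:- z, 1:] * q" by (metis dvdE poly_eq_0_iff_dvd)
  have q0: "q \<noteq> 0" using q Suc.prems(1) by auto
  have "degree p = Suc (degree q)" using q0 degree_mult_eq[of "[:- z, 1:]" q] q by simp
  then have "n = degree q" using Suc.hyps(2) by simp
  then have "bounded_below (op_poly T q)"
    by (rule Suc.hyps(1)[OF _ q0 Suc.prems(2)]) (auto simp: q)
  moreover have "bounded_below (op_poly T [:- z, 1:])" by (rule Suc.prems(2)[OF z])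
  ultimately obtain c d where cd: "c > 0" "d > 0"
    "\<And>f. f \<in> l2 \<Longrightarrow> c * l2norm f \<le> l2norm (op_poly T q f)"
    "\<And>f. f \<in> l2 \<Longrightarrow> d * l2norm f \<le> l2norm (op_poly T [:- z, 1:] f)"
    unfolding bounded_below_def by blast
  have "d * c * l2norm f \<le> l2norm (op_poly T p f)" if f: "f \<in> l2" for f
  proof -
    have "d * (c * l2norm f) \<le> d * l2norm (op_poly T q f)" using cd f by (intro mult_left_mono) auto
    also have "\<dots> \<le> l2norm (op_poly T [:- z, 1:] (op_poly T q f))" by (rule cd(4)[OF op_poly_l2[OF f]])
    finally show ?thesis unfolding q op_poly_mult[OF f] by (simp add: mult.assoc)
  qed
  then show ?case unfolding bounded_below_def using cd by (intro exI[of _ "d * c"]) auto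
qed

end

section \<open>Selfadjoint operators: real spectrum and the norm of p(T)\<close>

locale l2_selfadjoint = l2_operator +
  assumes T_sym: "f \<in> l2 \<Longrightarrow> g \<in> l2 \<Longrightarrow> ip (T f) g = ip f (T g)"
begin

text \<open>The approximate point spectrum. Restricting to real t loses nothing by
  \<open>bounded_below_nonreal\<close>.\<close>

definition spectral_set :: "real set" where
  "spectral_set = {t. \<not> bounded_below (op_poly T [:- complex_of_real t, 1:])}"

lemma op_poly_sym:
  assumes "real_coeffs p" "f \<in> l2" "g \<in> l2"
  shows "ip (op_poly T p f) g = ip f (op_poly T p g)"
  using assms
proof (induction p arbitrary: g)
  case 0
  then show ?case by (simp add: op_poly_0 ip_def)
next
  case (pCons a p)
  then have a: "cnj a = a" by (simp add: Reals_cnj_iff)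
  have "ip (T (op_poly T p f)) g = ip f (T (op_poly T p g))"
    using pCons.IH[OF _ pCons.prems(2) T_l2[OF pCons.prems(3)]] pCons.prems(1)
      T_sym[OF op_poly_l2[OF pCons.prems(2)] pCons.prems(3), of p] op_poly_commute[OF pCons.prems(3), of p]
    by simp
  then show ?case using pCons
    by (simp add: op_poly_pCons ip_add_left ip_add_right l2_scale T_l2 op_poly_l2 ip_scale_left
        ip_scale_right a)
qed

text \<open>The number <T f, f> is real, so the imaginary part of <(T - z) f, f> is - Im z times the
  squared norm of \<open>f\<close>; Cauchy-Schwarz turns this into a lower bound.\<close>

lemma bounded_below_nonreal:
  assumes "Im z \<noteq> 0" shows "bounded_below (op_poly T [:- z, 1:])"
  unfolding bounded_below_def
proof (intro exI[of _ "\<bar>Im z\<bar>"] conjI ballI)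
  fix f :: "'a \<Rightarrow> complex" assume f: "f \<in> l2"
  define g where "g = op_poly T [:- z, 1:] f"
  have g: "g = (\<lambda>i. - z * f i + T f i)" "g \<in> l2"
    by (simp add: g_def op_poly_linear[OF f]) (simp only: g_def op_poly_l2[OF f])
  have "ip g f = - z * ip f f + ip (T f) f"
    unfolding g(1) by (simp only: ip_add_left l2_scale T_l2 f ip_scale_left)
  moreover have "Im (ip (T f) f) = 0"
    using ip_cnj[of "T f" f] T_sym[OF f f] by (simp add: complex_eq_iff)
  ultimately have "Im (ip g f) = - Im z * (l2norm f)\<^sup>2"
    by (simp add: ip_self[OF f] power2_eq_square)
  then have "\<bar>Im z\<bar> * (l2norm f)\<^sup>2 \<le> cmod (ip g f)"
    using abs_Im_le_cmod[of "ip g f"] by (simp add: abs_mult)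
  also have "\<dots> \<le> l2norm g * l2norm f" by (rule ip_le[OF g(2) f])
  finally have "\<bar>Im z\<bar> * l2norm f * l2norm f \<le> l2norm g * l2norm f"
    by (simp add: power2_eq_square)
  then show "\<bar>Im z\<bar> * l2norm f \<le> l2norm (op_poly T [:- z, 1:] f)"
    unfolding g_def[symmetric]
    using l2norm_ge_0[of f] l2norm_ge_0[of g] by (cases "l2norm f = 0") (simp_all add: mult_le_cancel_right)
qed (use assms in auto)

text \<open>If \<open>N = \<parallel>A\<parallel>\<close> exceeds \<open>\<epsilon>\<close> for \<open>A = p(T)\<close>, then no root of \<open>p\<^sup>2 - N\<^sup>2\<close> is spectral, so
  \<open>A\<^sup>2 - N\<^sup>2\<close> is bounded below. This is impossible on almost maximising vectors, because
  \<open>\<parallel>(A\<^sup>2 - N\<^sup>2) f\<parallel>\<^sup>2 \<le> 2 N\<^sup>2 (N\<^sup>2 \<parallel>f\<parallel>\<^sup>2 - \<parallel>A f\<parallel>\<^sup>2)\<close>.\<close>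

lemma spectral_bound_nonconst:
  assumes p: "real_coeffs p" "degree p \<noteq> 0" and eps: "0 \<le> \<epsilon>"
    and le: "\<And>t. t \<in> spectral_set \<Longrightarrow> cmod (poly p (complex_of_real t)) \<le> \<epsilon>"
    and f: "f \<in> l2"
  shows "l2norm (op_poly T p f) \<le> \<epsilon> * l2norm f"
proof -
  define A where "A = op_poly T p"
  define S where "S = {C. 0 \<le> C \<and> (\<forall>f\<in>l2. l2norm (A f) \<le> C * l2norm f)}"
  define N where "N = Inf S"
  have S: "S \<noteq> {}" using op_poly_bounded[of p] by (auto simp: S_def A_def)
  have bdd: "bdd_below S" by (auto simp: S_def intro: bdd_belowI[of _ 0])
  have N0: "0 \<le> N" unfolding N_def by (rule cInf_greatest[OF S]) (auto simp: S_def)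
  have N: "l2norm (A g) \<le> N * l2norm g" if g: "g \<in> l2" for g
  proof (cases "l2norm g = 0")
    case True
    then show ?thesis using S g by (auto simp: S_def)
  next
    case False
    then have pos: "0 < l2norm g" by (simp add: order.not_eq_order_implies_strict)
    have "l2norm (A g) / l2norm g \<le> N"
      unfolding N_def by (rule cInf_greatest[OF S]) (use g pos in \<open>auto simp: S_def divide_le_eq\<close>)
    then show ?thesis using pos by (simp add: divide_le_eq)
  qed
  have "N \<le> \<epsilon>"
  proof (rule ccontr)
    assume "\<not> N \<le> \<epsilon>"
    then have Neps: "\<epsilon> < N" by simp
    define q where "q = p * p - [:complex_of_real (N\<^sup>2):]"
    \<comment> \<open>For a constant \<open>p\<close> the polynomial \<open>q\<close> could vanish;
      constants are therefore left to \<open>spectral_bound\<close>.\<close>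
    have q0: "q \<noteq> 0"
    proof
      assume "q = 0"
      then have "p * p = [:complex_of_real (N\<^sup>2):]" unfolding q_def by simp
      then have "degree (p * p) = 0" by simp
      then show False using p(2) by (cases "p = 0") (auto simp: degree_mult_eq)
    qed
    have "bounded_below (op_poly T q)"
    proof (rule bounded_below_op_poly[OF q0])
      fix z assume z: "poly q z = 0"
      show "bounded_below (op_poly T [:- z, 1:])"
      proof (cases "Im z = 0")
        case False then show ?thesis by (rule bounded_below_nonreal)
      next
        case True
        then obtain r where zr: "z = complex_of_real r" using complex_is_Real_iff Reals_cases by metis
        have "poly p z * poly p z = complex_of_real (N\<^sup>2)" using z by (simp add: q_def)
        then have "cmod (poly p z) * cmod (poly p z) = N\<^sup>2"
          by (simp only: norm_of_real abs_power2 norm_mult[symmetric])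
        then have "cmod (poly p z) = N"
          by (subst (asm) power2_eq_square[symmetric]) (rule power2_eq_imp_eq[OF _ norm_ge_zero N0])
        then have "r \<notin> spectral_set" using le[of r] Neps zr by auto
        then show ?thesis using zr by (simp add: spectral_set_def)
      qed
    qed
    then obtain c where c: "c > 0" "\<And>g. g \<in> l2 \<Longrightarrow> c * l2norm g \<le> l2norm (op_poly T q g)"
      unfolding bounded_below_def by blast
    have Npos: "0 < N" using eps Neps by simp
    have key: "(l2norm (A g))\<^sup>2 \<le> (N\<^sup>2 - c\<^sup>2 / (2 * N\<^sup>2)) * (l2norm g)\<^sup>2" if g: "g \<in> l2" for g
    proof -
      have Ag: "A g \<in> l2" "A (A g) \<in> l2" by (auto simp: A_def op_poly_l2 g)
      have q': "op_poly T q g = (\<lambda>i. A (A g) i - complex_of_real (N\<^sup>2) * g i)"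
        unfolding q_def op_poly_diff op_poly_mult[OF g] op_poly_const[OF g] A_def ..
      have "(c * l2norm g)\<^sup>2 \<le> (l2norm (op_poly T q g))\<^sup>2"
        using c g by (intro power_mono) auto
      also have "\<dots> = (l2norm (A (A g)))\<^sup>2 + (l2norm (\<lambda>i. complex_of_real (N\<^sup>2) * g i))\<^sup>2
          - 2 * Re (ip (A (A g)) (\<lambda>i. complex_of_real (N\<^sup>2) * g i))"
        unfolding q' by (rule l2norm_diff_sq[OF Ag(2) l2_scale[OF g]])
      also have "ip (A (A g)) (\<lambda>i. complex_of_real (N\<^sup>2) * g i) = complex_of_real (N\<^sup>2 * (l2norm (A g))\<^sup>2)"
        using op_poly_sym[OF p(1) Ag(1) g] ip_self[OF Ag(1)]
        by (simp only: ip_scale_right A_def complex_cnj_complex_of_real of_real_mult)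
      also have "l2norm (\<lambda>i. complex_of_real (N\<^sup>2) * g i) = N\<^sup>2 * l2norm g"
        by (simp add: l2norm_scale[OF g] norm_power Npos less_imp_le del: of_real_power)
      also have "(l2norm (A (A g)))\<^sup>2 \<le> (N * (N * l2norm g))\<^sup>2"
        using N[OF Ag(1)] N[OF g] N0 by (intro power_mono) (auto intro: order_trans mult_left_mono)
      finally have "c\<^sup>2 * (l2norm g)\<^sup>2 \<le> 2 * N\<^sup>2 * (N\<^sup>2 * (l2norm g)\<^sup>2 - (l2norm (A g))\<^sup>2)"
        by (simp add: power_mult_distrib algebra_simps power2_eq_square power4_eq_xxxx)
      then show ?thesis using Npos by (simp add: field_simps)
    qed
    \<comment> \<open>The maximum with 0 guards the square root, since the improved constant comes
      with no sign.\<close>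
    define M2 where "M2 = max 0 (N\<^sup>2 - c\<^sup>2 / (2 * N\<^sup>2))"
    have "sqrt M2 \<in> S"
    proof -
      have "l2norm (A g) \<le> sqrt M2 * l2norm g" if g: "g \<in> l2" for g
      proof (rule power2_le_imp_le)
        show "(l2norm (A g))\<^sup>2 \<le> (sqrt M2 * l2norm g)\<^sup>2"
          using key[OF g] order_trans[OF _ mult_right_mono[of "N\<^sup>2 - c\<^sup>2 / (2 * N\<^sup>2)" M2 "(l2norm g)\<^sup>2"]]
          by (simp add: M2_def power_mult_distrib)
      qed (simp add: M2_def)
      then show ?thesis by (simp add: S_def M2_def)
    qed
    then have "N \<le> sqrt M2" unfolding N_def using bdd by (rule cInf_lower)
    then have "N\<^sup>2 \<le> (sqrt M2)\<^sup>2" using N0 by (rule power_mono)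
    then have "N\<^sup>2 \<le> M2" by (simp add: M2_def)
    moreover have "M2 < N\<^sup>2" using Npos c(1) by (simp add: M2_def)
    ultimately show False by simp
  qed
  then show ?thesis using N[OF f] mult_right_mono[of N \<epsilon> "l2norm f"] by (simp add: A_def)
qed

text \<open>With no spectral point the preceding bound would hold with \<epsilon> = 0 and annihilate
  a unit vector under both T and T + 1, hence the vector itself.\<close>

lemma spectral_set_nonempty: "spectral_set \<noteq> {}"
proof
  assume e: "spectral_set = {}"
  define f where "f = (unit_fn undefined :: 'a \<Rightarrow> complex)"
  have f: "f \<in> l2" by (simp add: f_def)
  have z: "op_poly T [:c, 1:] f = (\<lambda>i. 0)" if "c \<in> \<real>" for c
  proof -
    have "l2norm (op_poly T [:c, 1:] f) \<le> 0 * l2norm f"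
      by (rule spectral_bound_nonconst) (use e f that in auto)
    then show ?thesis using l2norm_eq_0D[OF op_poly_l2[OF f], of "[:c, 1:]"] l2norm_ge_0[of "op_poly T [:c, 1:] f"]
      by linarith
  qed
  have "f i = 0" for i
    using fun_cong[OF z[of 0], of i] fun_cong[OF z[of 1], of i] by (simp add: op_poly_linear[OF f])
  then have "f = (\<lambda>i. 0)" by auto
  then show False using l2norm_unit_fn[of "undefined :: 'a"] by (simp add: f_def)
qed

text \<open>The existence of a spectral point supplies \<open>0 \<le> \<epsilon>\<close> and settles
  constant \<open>p\<close>.\<close>

theorem spectral_bound:
  assumes p: "real_coeffs p"
    and le: "\<And>t. t \<in> spectral_set \<Longrightarrow> cmod (poly p (complex_of_real t)) \<le> \<epsilon>"
    and f: "f \<in> l2"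
  shows "l2norm (op_poly T p f) \<le> \<epsilon> * l2norm f"
proof -
  obtain t where t: "t \<in> spectral_set" using spectral_set_nonempty by blast
  have eps: "0 \<le> \<epsilon>" using le[OF t] norm_ge_zero order_trans by blast
  show ?thesis
  proof (cases "degree p = 0")
    case True
    then obtain c where c: "p = [:c:]" by (rule degree_eq_zeroE)
    then show ?thesis using le[OF t] by (simp add: op_poly_const[OF f] l2norm_scale[OF f] mult_right_mono)
  next
    case False
    show ?thesis by (rule spectral_bound_nonconst[OF p False eps le f])
  qed
qed

lemma spectral_set_le: assumes "t \<in> spectral_set" shows "\<bar>t\<bar> \<le> K"
proof (rule ccontr)
  assume "\<not> \<bar>t\<bar> \<le> K"
  then have K: "K < \<bar>t\<bar>" by simp
  have "(\<bar>t\<bar> - K) * l2norm f \<le> l2norm (op_poly T [:- complex_of_real t, 1:] f)" if f: "f \<in> l2" for f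
  proof -
    have "\<bar>t\<bar> * l2norm f = l2norm (\<lambda>i. complex_of_real t * f i)"
      by (simp add: l2norm_scale[OF f])
    also have "\<dots> = l2norm (\<lambda>i. T f i - op_poly T [:- complex_of_real t, 1:] f i)"
      by (simp add: op_poly_linear[OF f])
    also have "\<dots> \<le> l2norm (T f) + l2norm (op_poly T [:- complex_of_real t, 1:] f)"
      by (intro l2norm_triangle_diff T_l2 op_poly_l2 f)
    finally show ?thesis using T_bound[OF f] by (simp add: algebra_simps)
  qed
  then have "bounded_below (op_poly T [:- complex_of_real t, 1:])"
    unfolding bounded_below_def using K by (intro exI[of _ "\<bar>t\<bar> - K"]) auto
  then show False using assms by (simp add: spectral_set_def)
qed

text \<open>Replacing t by s costs at most |s - t| in the lower bound, so the lower constant at t is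
  itself a gap width.\<close>

lemma spectral_set_gap:
  assumes "t \<notin> spectral_set"
  shows "\<exists>\<delta>>0. \<forall>s\<in>spectral_set. \<delta> \<le> \<bar>s - t\<bar>"
proof -
  from assms obtain c where c: "c > 0"
    "\<And>f. f \<in> l2 \<Longrightarrow> c * l2norm f \<le> l2norm (op_poly T [:- complex_of_real t, 1:] f)"
    by (auto simp: spectral_set_def bounded_below_def)
  have "c \<le> \<bar>s - t\<bar>" if s: "s \<in> spectral_set" for s
  proof (rule ccontr)
    assume lt: "\<not> c \<le> \<bar>s - t\<bar>"
    have "(c - \<bar>s - t\<bar>) * l2norm f \<le> l2norm (op_poly T [:- complex_of_real s, 1:] f)" if f: "f \<in> l2" for f
    proof -
      have "op_poly T [:- complex_of_real t, 1:] f
          = (\<lambda>i. op_poly T [:- complex_of_real s, 1:] f i + complex_of_real (s - t) * f i)"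
        by (simp add: op_poly_linear[OF f] algebra_simps)
      then have "l2norm (op_poly T [:- complex_of_real t, 1:] f)
          \<le> l2norm (op_poly T [:- complex_of_real s, 1:] f) + l2norm (\<lambda>i. complex_of_real (s - t) * f i)"
        using l2norm_triangle[OF op_poly_l2[OF f] l2_scale[OF f]] by (simp only:)
      also have "l2norm (\<lambda>i. complex_of_real (s - t) * f i) = \<bar>s - t\<bar> * l2norm f"
        by (simp add: l2norm_scale[OF f] del: of_real_diff)
      finally show ?thesis using c(2)[OF f] by (simp add: algebra_simps)
    qed
    then have "bounded_below (op_poly T [:- complex_of_real s, 1:])"
      unfolding bounded_below_def using lt by (intro exI[of _ "c - \<bar>s - t\<bar>"]) auto
    then show False using s by (simp add: spectral_set_def)
  qed
  then show ?thesis using c(1) by blast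
qed

end

section \<open>Exponentially decaying kernels\<close>

text \<open>Sites and basis indices are nested pairs; quantifiers are to range over whole indices,
  not over their components.\<close>

declare split_paired_All [simp del] split_paired_Ex [simp del]

definition idist :: "'d idx \<Rightarrow> 'd idx \<Rightarrow> real" where
  "idist i j = real_of_int (l1 (fst i) (fst j))"

lemma idist_nonneg [simp]: "0 \<le> idist i j" by (simp add: idist_def l1_def)
lemma idist_self [simp]: "idist i i = 0" by (simp add: idist_def l1_def)
lemma idist_commute: "idist i j = idist j i" by (simp add: idist_def l1_def)
lemma idist_triangle: "idist i k \<le> idist i j + idist j k"
  unfolding idist_def l1_def by linarith

lemma infsum_sum:
  fixes f :: "'a \<Rightarrow> 'b \<Rightarrow> 'c::banach"
  assumes "\<And>i. i \<in> F \<Longrightarrow> f i summable_on A"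
  shows "infsum (\<lambda>j. \<Sum>i\<in>F. f i j) A = (\<Sum>i\<in>F. infsum (f i) A)"
    and "(\<lambda>j. \<Sum>i\<in>F. f i j) summable_on A"
  using assms
  by (induction F rule: infinite_finite_induct) (auto simp: infsum_add summable_on_add)

lemma summable_exp_abs_int:
  assumes "c > 0" shows "(\<lambda>n::int. exp (- c * \<bar>real_of_int n\<bar>)) summable_on UNIV"
proof -
  have "summable (\<lambda>n. exp (- c) ^ n)" by (rule summable_geometric) (use assms in auto)
  then have s: "(\<lambda>n::nat. exp (- c * real n)) summable_on UNIV"
    by (intro summable_nonneg_imp_summable_on) (auto simp: exp_of_nat_mult[symmetric] mult.commute)
  have "(\<lambda>n::int. exp (- c * \<bar>real_of_int n\<bar>)) summable_on range int"
    by (subst summable_on_reindex) (use s in \<open>auto simp: o_def\<close>)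
  moreover have "(\<lambda>n::int. exp (- c * \<bar>real_of_int n\<bar>)) summable_on range (\<lambda>n. - int n)"
    by (subst summable_on_reindex) (use s in \<open>auto simp: o_def inj_def\<close>)
  ultimately have "(\<lambda>n::int. exp (- c * \<bar>real_of_int n\<bar>)) summable_on (range int \<union> range (\<lambda>n. - int n))"
    by (rule summable_on_union)
  moreover have "range int \<union> range (\<lambda>n. - int n) = UNIV"
    by (auto simp: image_iff) (metis int_cases2)
  ultimately show ?thesis by simp
qed

text \<open>Translation invariance makes the value independent of \<open>i\<close>
  (\<open>exp_sum_eq\<close>); the index \<open>k\<close> or \<open>undefined\<close> in later
  bounds is an arbitrary base point.\<close>

definition exp_sum :: "real \<Rightarrow> 'd idx \<Rightarrow> real" where
  "exp_sum c i = infsum (\<lambda>j. exp (- c * idist i j)) UNIV"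

lemma summable_exp_idist0:
  fixes d :: "'d::finite"
  assumes "c > 0" shows "(\<lambda>j. exp (- c * idist ((0,0), d) j)) summable_on UNIV"
proof -
  define S where "S = infsum (\<lambda>n::int. exp (- c * \<bar>real_of_int n\<bar>)) UNIV"
  have "(\<lambda>(a::int, b::int). exp (- c * \<bar>real_of_int a\<bar>) * exp (- c * \<bar>real_of_int b\<bar>)) summable_on UNIV \<times> UNIV"
    by (rule nonneg_double_summable(1)[where g = "\<lambda>a. exp (- c * \<bar>real_of_int a\<bar>) * S"])
      (simp_all only: S_def infsum_cmult_right' summable_on_cmult_left summable_on_cmult_right
        summable_exp_abs_int assms mult_nonneg_nonneg exp_ge_zero order_refl)
  then have s: "(\<lambda>x::site. exp (- c * \<bar>real_of_int (fst x)\<bar>) * exp (- c * \<bar>real_of_int (snd x)\<bar>)) summable_on UNIV"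
    by (simp only: split_def UNIV_Times_UNIV)
  have "(\<lambda>(x::site, d::'d). exp (- c * \<bar>real_of_int (fst x)\<bar>) * exp (- c * \<bar>real_of_int (snd x)\<bar>)) summable_on UNIV \<times> UNIV"
    by (rule nonneg_double_summable(1)[where g = "\<lambda>x. exp (- c * \<bar>real_of_int (fst x)\<bar>) * exp (- c * \<bar>real_of_int (snd x)\<bar>) * CARD('d)"])
      (simp_all only: s summable_on_cmult_left mult_nonneg_nonneg exp_ge_zero infsum_finite finite
        summable_on_finite sum_constant order_refl mult.commute[of "of_nat _"])
  then show ?thesis
    by (simp add: split_def idist_def l1_def distrib_left exp_add[symmetric])
qed

lemma
  fixes i :: "'d::finite idx" and d :: 'd
  assumes "c > 0"
  shows summable_exp_idist: "(\<lambda>j. exp (- c * idist i j)) summable_on UNIV"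
    and exp_sum_eq0: "exp_sum c i = exp_sum c ((0,0), d)"
proof -
  let ?f = "\<lambda>j::'d idx. ((fst (fst j) - fst (fst i), snd (fst j) - snd (fst i)), snd j)"
  let ?g = "\<lambda>j::'d idx. ((fst (fst j) + fst (fst i), snd (fst j) + snd (fst i)), snd j)"
  have "(\<lambda>j. exp (- c * idist i j)) summable_on UNIV \<longleftrightarrow>
      (\<lambda>j. exp (- c * idist ((0,0), d) j)) summable_on UNIV"
    by (rule summable_on_reindex_bij_witness[where j = ?f and i = ?g])
      (simp_all add: idist_def l1_def)
  then show "(\<lambda>j. exp (- c * idist i j)) summable_on UNIV"
    using summable_exp_idist0[OF assms] by blast
  show "exp_sum c i = exp_sum c ((0,0), d)" unfolding exp_sum_def
    by (rule infsum_reindex_bij_witness[where j = ?f and i = ?g])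
      (simp_all add: idist_def l1_def)
qed

lemma exp_sum_eq: "c > 0 \<Longrightarrow> exp_sum c (i :: 'd::finite idx) = exp_sum c (j :: 'd idx)"
  by (simp only: exp_sum_eq0[of c i "snd i"] exp_sum_eq0[of c j "snd i"])

lemma infsum_exp_idist: "c > 0 \<Longrightarrow> infsum (\<lambda>j::'d::finite idx. exp (- c * idist i j)) UNIV = exp_sum c (k :: 'd idx)"
  using exp_sum_eq[of c i k] by (simp add: exp_sum_def)

lemma exp_sum_ge_1:
  assumes "c > 0" shows "1 \<le> exp_sum c (i :: 'd::finite idx)"
proof -
  have "sum (\<lambda>j. exp (- c * idist i j)) {i} \<le> exp_sum c i" unfolding exp_sum_def
    by (rule finite_sum_le_infsum[OF summable_exp_idist[OF assms]]) auto
  then show ?thesis by simp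
qed

lemma exp_sum_pos: "c > 0 \<Longrightarrow> 0 < exp_sum c (i :: 'd::finite idx)"
  using exp_sum_ge_1[of c i] by simp

definition decays :: "real \<Rightarrow> real \<Rightarrow> 'd kernel \<Rightarrow> bool" where
  "decays c C K \<longleftrightarrow> (\<forall>i j. cmod (K i j) \<le> C * exp (- c * idist i j))"

lemma decaysD: "decays c C K \<Longrightarrow> cmod (K i j) \<le> C * exp (- c * idist i j)"
  by (simp add: decays_def)

lemma decays_const_nonneg: assumes "decays c C K" shows "0 \<le> C"
proof -
  have "0 \<le> C * exp (- c * idist undefined (undefined :: 'a idx))"
    by (rule order_trans[OF norm_ge_zero decaysD[OF assms]])
  then show ?thesis by (simp add: zero_le_mult_iff)
qed

lemma decays_mono:
  assumes "decays c C K" "c' \<le> c" "C \<le> C'" shows "decays c' C' K"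
  unfolding decays_def
proof (intro allI)
  fix i j :: "'a idx"
  have "C * exp (- c * idist i j) \<le> C' * exp (- c' * idist i j)"
    using assms decays_const_nonneg[OF assms(1)] by (intro mult_mono) (auto intro: mult_right_mono)
  then show "cmod (K i j) \<le> C' * exp (- c' * idist i j)" using decaysD[OF assms(1), of i j] by linarith
qed

lemma decays_bounded: assumes "decays c C K" "0 \<le> c" shows "cmod (K i j) \<le> C"
  using decaysD[OF decays_mono[OF assms order_refl], of i j] by simp

lemma decays_swap: "decays c C K \<Longrightarrow> decays c C (\<lambda>i j. K j i)"
  unfolding decays_def by (metis complex_mod_cnj idist_commute)

lemma decays_row_summable:
  assumes "decays c C (K :: 'd::finite kernel)" "c > 0"
  shows "(\<lambda>j. cmod (K i j)) summable_on UNIV" "infsum (\<lambda>j. cmod (K i j)) UNIV \<le> C * exp_sum c (k :: 'd idx)"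
proof -
  have s: "(\<lambda>j. C * exp (- c * idist i j)) summable_on UNIV"
    by (intro summable_on_cmult_right summable_exp_idist assms)
  show 1: "(\<lambda>j. cmod (K i j)) summable_on UNIV"
    by (rule summable_on_comparison_test[OF s]) (simp_all only: decaysD[OF assms(1)] norm_ge_zero)
  have "infsum (\<lambda>j. cmod (K i j)) UNIV \<le> infsum (\<lambda>j. C * exp (- c * idist i j)) UNIV"
    by (rule infsum_mono[OF 1 s]) (simp_all only: decaysD[OF assms(1)] norm_ge_zero)
  also have "\<dots> = C * exp_sum c k" using infsum_exp_idist[OF assms(2), of i k] by (simp add: infsum_cmult_right')
  finally show "infsum (\<lambda>j. cmod (K i j)) UNIV \<le> C * exp_sum c k" .
qed

lemma decays_apply_summable:
  assumes "decays c C (K :: 'd::finite kernel)" "c > 0" "\<And>j. cmod (f j) \<le> B"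
  shows "(\<lambda>j. cmod (K i j * f j)) summable_on UNIV" "(\<lambda>j. K i j * f j) summable_on UNIV"
    "cmod (kapply K f i) \<le> C * exp_sum c (k :: 'd idx) * B"
proof -
  have B: "0 \<le> B" using order_trans[OF norm_ge_zero assms(3)] .
  have s: "(\<lambda>j. cmod (K i j) * B) summable_on UNIV"
    by (intro summable_on_cmult_left decays_row_summable(1)[OF assms(1,2)])
  show 1: "(\<lambda>j. cmod (K i j * f j)) summable_on UNIV"
    by (rule summable_on_comparison_test[OF s]) (auto simp: norm_mult intro!: mult_left_mono assms(3))
  show "(\<lambda>j. K i j * f j) summable_on UNIV" by (rule abs_summable_summable[OF 1])
  have "cmod (kapply K f i) \<le> infsum (\<lambda>j. cmod (K i j * f j)) UNIV"
    unfolding kapply_def by (rule norm_infsum_bound[OF 1])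
  also have "\<dots> \<le> infsum (\<lambda>j. cmod (K i j) * B) UNIV"
    by (rule infsum_mono[OF 1 s]) (auto simp: norm_mult intro!: mult_left_mono assms(3))
  also have "\<dots> = infsum (\<lambda>j. cmod (K i j)) UNIV * B" by (simp add: infsum_cmult_left')
  also have "\<dots> \<le> C * exp_sum c k * B" by (intro mult_right_mono decays_row_summable assms B)
  finally show "cmod (kapply K f i) \<le> C * exp_sum c k * B" .
qed

lemma decays_summable_l2:
  assumes "decays c C (K :: 'd::finite kernel)" "c > 0" "f \<in> l2"
  shows "(\<lambda>j. K i j * f j) summable_on UNIV"
  by (rule decays_apply_summable(2)[OF assms(1,2) cmod_le_l2norm[OF assms(3)]])

text \<open>Schur's test: by Cauchy-Schwarz, \<open>(\<Sum>\<^sub>j e\<^sub>i\<^sub>j |f\<^sub>j|)\<^sup>2 \<le> Z \<Sum>\<^sub>j e\<^sub>i\<^sub>j |f\<^sub>j|\<^sup>2\<close> with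
  \<open>e\<^sub>i\<^sub>j = exp (- c d(i,j))\<close> and \<open>Z = \<Sum>\<^sub>j e\<^sub>i\<^sub>j\<close>.\<close>

lemma
  assumes K: "decays c C (K :: 'd::finite kernel)" "c > 0" and f: "f \<in> l2"
  shows decays_l2: "kapply K f \<in> l2"
    and decays_l2norm: "l2norm (kapply K f) \<le> C * exp_sum c (k :: 'd idx) * l2norm f"
proof -
  define Z where "Z = exp_sum c (k :: 'd idx)"
  define e where "e i j = exp (- c * idist i j)" for i j :: "'d idx"
  have Z0: "0 < Z" unfolding Z_def by (rule exp_sum_pos[OF K(2)])
  have C0: "0 \<le> C" by (rule decays_const_nonneg[OF K(1)])
  have e0: "0 \<le> e i j" for i j by (simp add: e_def)
  have es: "e i summable_on UNIV" for i unfolding e_def by (rule summable_exp_idist[OF K(2)])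
  have eZ: "infsum (e i) UNIV = Z" for i unfolding e_def Z_def by (rule infsum_exp_idist[OF K(2)])
  have f2: "(\<lambda>j. (cmod (f j))\<^sup>2) summable_on UNIV" using f by (simp add: l2_iff)
  have e1: "e i j \<le> 1" for i j using K(2) by (simp add: e_def)
  have efs: "(\<lambda>j. e i j * (cmod (f j))\<^sup>2) summable_on UNIV" for i
    by (rule summable_on_comparison_test[OF f2]) (simp_all add: mult_left_le_one_le e0 e1)
  have row: "(cmod (kapply K f i))\<^sup>2 \<le> C\<^sup>2 * Z * infsum (\<lambda>j. e i j * (cmod (f j))\<^sup>2) UNIV" for i
  proof -
    define u v where "u = (\<lambda>j. complex_of_real (sqrt (e i j)))" and "v = (\<lambda>j. complex_of_real (sqrt (e i j) * cmod (f j)))"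
    have cu: "(cmod (u j))\<^sup>2 = e i j" for j by (simp add: u_def e0)
    have cv: "(cmod (v j))\<^sup>2 = e i j * (cmod (f j))\<^sup>2" for j by (simp add: v_def e0 norm_mult power_mult_distrib)
    have uv: "cmod (u j) * cmod (v j) = e i j * cmod (f j)" for j by (simp add: u_def v_def e0 norm_mult)
    have u: "u \<in> l2" "v \<in> l2" using es efs by (auto simp: l2_iff cu cv)
    have s1: "(\<lambda>j. C * (e i j * cmod (f j))) summable_on UNIV"
      using ip_abs_summable[OF u] by (intro summable_on_cmult_right) (simp add: uv)
    have le: "cmod (K i j * f j) \<le> C * (e i j * cmod (f j))" for j
      using mult_right_mono[OF decaysD[OF K(1), of i j], of "cmod (f j)"] by (simp add: norm_mult e_def)
    have s2: "(\<lambda>j. cmod (K i j * f j)) summable_on UNIV"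
      by (rule summable_on_comparison_test[OF s1 le]) auto
    have "cmod (kapply K f i) \<le> infsum (\<lambda>j. cmod (K i j * f j)) UNIV"
      unfolding kapply_def by (rule norm_infsum_bound[OF s2])
    also have "\<dots> \<le> infsum (\<lambda>j. C * (e i j * cmod (f j))) UNIV" by (rule infsum_mono[OF s2 s1 le])
    also have "\<dots> \<le> C * (l2norm u * l2norm v)"
      using ip_abs_le[OF u] C0 by (simp add: infsum_cmult_right' uv mult_left_mono)
    finally have "(cmod (kapply K f i))\<^sup>2 \<le> (C * (l2norm u * l2norm v))\<^sup>2" by (rule power_mono) simp
    also have "\<dots> = C\<^sup>2 * Z * infsum (\<lambda>j. e i j * (cmod (f j))\<^sup>2) UNIV"
      by (simp add: power_mult_distrib l2norm_sq cu cv eZ)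
    finally show ?thesis .
  qed
  have *: "L2_set (\<lambda>i. cmod (kapply K f i)) F \<le> C * Z * l2norm f" if F: "finite F" for F
  proof -
    have "(\<Sum>i\<in>F. (cmod (kapply K f i))\<^sup>2) \<le> (\<Sum>i\<in>F. C\<^sup>2 * Z * infsum (\<lambda>j. e i j * (cmod (f j))\<^sup>2) UNIV)"
      by (intro sum_mono row)
    also have "\<dots> = C\<^sup>2 * Z * infsum (\<lambda>j. \<Sum>i\<in>F. e i j * (cmod (f j))\<^sup>2) UNIV"
      by (simp add: sum_distrib_left[symmetric] infsum_sum(1)[OF efs])
    also have "\<dots> \<le> C\<^sup>2 * Z * infsum (\<lambda>j. Z * (cmod (f j))\<^sup>2) UNIV"
    proof (intro mult_left_mono infsum_mono)
      show "(\<lambda>j. \<Sum>i\<in>F. e i j * (cmod (f j))\<^sup>2) summable_on UNIV"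
        by (rule infsum_sum(2)) (rule efs)
      show "(\<lambda>j. Z * (cmod (f j))\<^sup>2) summable_on UNIV" by (rule summable_on_cmult_right[OF f2])
      fix j
      have "sum (e j) F \<le> infsum (e j) UNIV" by (rule finite_sum_le_infsum[OF es F]) (auto simp: e0)
      then have "(\<Sum>i\<in>F. e i j) \<le> Z" by (simp add: eZ) (simp add: e_def idist_commute)
      then show "(\<Sum>i\<in>F. e i j * (cmod (f j))\<^sup>2) \<le> Z * (cmod (f j))\<^sup>2"
        by (simp add: sum_distrib_right[symmetric] mult_right_mono)
    qed (use Z0 in simp)
    also have "\<dots> = (C * Z * l2norm f)\<^sup>2"
      by (simp add: infsum_cmult_right' l2norm_sq[symmetric] power_mult_distrib power2_eq_square[of Z])
    finally have "(\<Sum>i\<in>F. (cmod (kapply K f i))\<^sup>2) \<le> (C * Z * l2norm f)\<^sup>2" .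
    then show ?thesis unfolding L2_set_def using C0 Z0 by (intro real_le_lsqrt) (auto simp: sum_nonneg)
  qed
  show "kapply K f \<in> l2" "l2norm (kapply K f) \<le> C * exp_sum c k * l2norm f"
    using l2_bounded_L2_set[OF *] by (auto simp: Z_def)
qed

lemma decays_bounded_kernel:
  assumes "decays c C (K :: 'd::finite kernel)" "c > 0" shows "bounded_kernel K"
  unfolding bounded_kernel_def
  by (intro exI[of _ "C * exp_sum c undefined"] ballI conjI allI)
    (auto intro: decays_summable_l2 decays_l2 decays_l2norm assms)

lemma kapply_unit_fn: "kapply K (unit_fn j) i = K i j"
proof -
  have "infsum (\<lambda>k. K i k * unit_fn j k) UNIV = infsum (\<lambda>k. K i k * unit_fn j k) {j}"
    by (rule infsum_cong_neutral) (auto simp: unit_fn_def)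
  then show ?thesis by (simp add: kapply_def unit_fn_def)
qed

text \<open>The rate 2c of \<open>K\<close> is spent in halves: one half joins the decay of
  \<open>L\<close> through the triangle inequality to give exp(- c d(i,j)), the other half is summed
  over the middle index.\<close>

lemma decays_kcomp:
  assumes K: "decays (2 * c) A (K :: 'd::finite kernel)" and L: "decays c B L" and c: "c > 0"
  shows "decays c (A * B * exp_sum c (k :: 'd idx)) (kcomp K L)"
    and "(\<lambda>l. cmod (K i l * L l j)) summable_on UNIV"
proof -
  have A0: "0 \<le> A" "0 \<le> B" using decays_const_nonneg K L by auto
  have le: "cmod (K i l * L l j) \<le> A * B * exp (- c * idist i j) * exp (- c * idist i l)" for i l j
  proof -
    have "cmod (K i l * L l j) \<le> (A * exp (- (2 * c) * idist i l)) * (B * exp (- c * idist l j))"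
      unfolding norm_mult by (intro mult_mono decaysD[OF K] decaysD[OF L]) (auto simp: A0)
    also have "\<dots> = A * B * exp (- (2 * c) * idist i l - c * idist l j)"
      by (simp add: exp_diff exp_minus field_simps)
    also have "\<dots> \<le> A * B * exp (- c * idist i j - c * idist i l)"
    proof -
      have "c * idist i j \<le> c * (idist i l + idist l j)" using c by (intro mult_left_mono idist_triangle) simp
      then show ?thesis using A0 by (intro mult_left_mono) (auto simp: algebra_simps)
    qed
    finally show ?thesis by (simp add: exp_diff exp_minus field_simps)
  qed
  have s: "(\<lambda>l. A * B * exp (- c * idist i j) * exp (- c * idist i l)) summable_on UNIV" for i j :: "'d idx"
    by (intro summable_on_cmult_right summable_exp_idist[OF c])
  show s1: "(\<lambda>l. cmod (K i l * L l j)) summable_on UNIV" for i j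
    by (rule summable_on_comparison_test[OF s le]) auto
  show "decays c (A * B * exp_sum c k) (kcomp K L)" unfolding decays_def
  proof (intro allI)
    fix i j
    have "cmod (kcomp K L i j) \<le> infsum (\<lambda>l. cmod (K i l * L l j)) UNIV"
      unfolding kcomp_def by (rule norm_infsum_bound[OF s1])
    also have "\<dots> \<le> infsum (\<lambda>l. A * B * exp (- c * idist i j) * exp (- c * idist i l)) UNIV"
      by (rule infsum_mono[OF s1 s le])
    also have "\<dots> = A * B * exp_sum c k * exp (- c * idist i j)"
      using infsum_exp_idist[OF c, of i k] by (simp add: infsum_cmult_right')
    finally show "cmod (kcomp K L i j) \<le> A * B * exp_sum c k * exp (- c * idist i j)" .
  qed
qed

lemma kapply_kcomp:
  assumes K: "decays a A (K :: 'd::finite kernel)" "a > 0" and L: "decays b B L" "b > 0" and f: "f \<in> l2"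
  shows "kapply (kcomp K L) f = kapply K (kapply L f)"
proof
  fix i
  define M where "M = l2norm f"
  have M: "cmod (f j) \<le> M" for j unfolding M_def by (rule cmod_le_l2norm[OF f])
  have M0: "0 \<le> M" by (simp add: M_def)
  have "kapply K (kapply L f) i = infsum (\<lambda>k. infsum (\<lambda>j. K i k * (L k j * f j)) UNIV) UNIV"
    by (simp add: kapply_def infsum_cmult_right')
  also have "\<dots> = infsum (\<lambda>j. infsum (\<lambda>k. K i k * (L k j * f j)) UNIV) UNIV"
  proof (rule infsum_swap_dominated)
    show "norm (K i k * (L k j * f j)) \<le> cmod (K i k) * (cmod (L k j) * M)" for k j
      by (simp add: norm_mult mult_left_mono M)
    show "(\<lambda>j. cmod (K i k) * (cmod (L k j) * M)) summable_on UNIV" for k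
      by (intro summable_on_cmult_right summable_on_cmult_left decays_row_summable(1)[OF L])
    show "infsum (\<lambda>j. cmod (K i k) * (cmod (L k j) * M)) UNIV \<le> cmod (K i k) * (B * exp_sum b i * M)" for k
      unfolding infsum_cmult_right' infsum_cmult_left'
      by (intro mult_left_mono mult_right_mono decays_row_summable(2)[OF L] M0) auto
    show "(\<lambda>k. cmod (K i k) * (B * exp_sum b i * M)) summable_on UNIV"
      by (intro summable_on_cmult_left decays_row_summable(1)[OF K])
  qed
  also have "\<dots> = kapply (kcomp K L) f i"
    by (simp add: kapply_def kcomp_def mult.assoc[symmetric] infsum_cmult_left')
  finally show "kapply (kcomp K L) f i = kapply K (kapply L f) i" ..
qed

lemma kapply_add: 
  assumes K: "decays a A (K :: 'd::finite kernel)" "a > 0" and "f \<in> l2" "g \<in> l2"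
  shows "kapply K (\<lambda>i. f i + g i) = (\<lambda>i. kapply K f i + kapply K g i)"
  unfolding kapply_def by (rule ext) (simp add: ring_distribs infsum_add decays_summable_l2[OF K] assms)

lemma kapply_scale: "kapply K (\<lambda>i. c * f i) = (\<lambda>i. c * kapply K f i)"
  unfolding kapply_def by (simp add: mult.left_commute infsum_cmult_right')

text \<open>Exchanging the sums needs absolute convergence. The majorant \<open>e\<close> applied to
  |f| is again in \<open>l2\<close> by Schur's test, and it pairs with |g| by
  Cauchy-Schwarz.\<close>

lemma kapply_adjoint:
  assumes K: "decays c C (K :: 'd::finite kernel)" "c > 0" and f: "f \<in> l2" and g: "g \<in> l2"
  shows "ip (kapply K f) g = ip f (kapply (\<lambda>i j. cnj (K j i)) g)"
proof -
  define e where "e i j = C * exp (- c * idist i j)" for i j :: "'d idx"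
  have eK: "decays c C (\<lambda>i j. complex_of_real (e i j))"
    using decays_const_nonneg[OF K(1)] by (simp add: decays_def e_def norm_mult)
  define h where "h = (\<lambda>j. complex_of_real (cmod (f j)))"
  have h: "h \<in> l2" using f by (simp add: l2_iff h_def)
  define w where "w = kapply (\<lambda>i j. complex_of_real (e i j)) h"
  have w: "w \<in> l2" unfolding w_def by (rule decays_l2[OF eK K(2) h])
  have e0: "0 \<le> e i j" for i j using decays_const_nonneg[OF K(1)] by (simp add: e_def)
  have es: "(\<lambda>j. e i j * cmod (f j)) summable_on UNIV" for i
    using decays_apply_summable(1)[OF eK K(2) cmod_le_l2norm[OF h], of i] e0 by (simp add: norm_mult h_def)
  have wi: "infsum (\<lambda>j. e i j * cmod (f j)) UNIV = cmod (w i)" for i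
  proof -
    have "w i = complex_of_real (infsum (\<lambda>j. e i j * cmod (f j)) UNIV)"
      unfolding w_def kapply_def h_def
      using has_sum_of_real[OF has_sum_infsum[OF es[of i]]] by (intro infsumI) simp
    then show ?thesis by (simp add: infsum_nonneg e0)
  qed
  have "ip (kapply K f) g = infsum (\<lambda>i. infsum (\<lambda>j. K i j * f j * cnj (g i)) UNIV) UNIV"
    by (simp add: ip_def kapply_def infsum_cmult_left')
  also have "\<dots> = infsum (\<lambda>j. infsum (\<lambda>i. K i j * f j * cnj (g i)) UNIV) UNIV"
  proof (rule infsum_swap_dominated)
    show "norm (K i j * f j * cnj (g i)) \<le> e i j * cmod (f j) * cmod (g i)" for i j
      using decaysD[OF K(1), of i j] by (simp add: norm_mult e_def mult_right_mono)
    show "(\<lambda>j. e i j * cmod (f j) * cmod (g i)) summable_on UNIV" for i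
      by (intro summable_on_cmult_left es)
    show "infsum (\<lambda>j. e i j * cmod (f j) * cmod (g i)) UNIV \<le> cmod (w i) * cmod (g i)" for i
      by (simp add: infsum_cmult_left' wi)
    show "(\<lambda>i. cmod (w i) * cmod (g i)) summable_on UNIV" by (rule ip_abs_summable[OF w g])
  qed
  also have "\<dots> = infsum (\<lambda>j. f j * cnj (infsum (\<lambda>i. cnj (K i j) * g i) UNIV)) UNIV"
    by (simp add: infsum_cnj[symmetric] infsum_cmult_right'[symmetric] mult_ac del: infsum_cnj)
  finally show ?thesis by (simp add: ip_def kapply_def)
qed

section \<open>Polynomials and power series of a decaying kernel\<close>

primrec kpow :: "'d kernel \<Rightarrow> nat \<Rightarrow> 'd kernel" where
  "kpow H 0 = (\<lambda>i j. if i = j then 1 else 0)"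
| "kpow H (Suc n) = kcomp H (kpow H n)"

definition kpoly :: "'d kernel \<Rightarrow> complex poly \<Rightarrow> 'd kernel" where
  "kpoly H p = (\<lambda>i j. \<Sum>k\<le>degree p. coeff p k * kpow H k i j)"

text \<open>The norm of absolutely convergent power series on the disc of radius \<open>B\<close>.
  It is submultiplicative, and for \<open>B = growth\<close> it is the decay constant of
  \<open>kpoly H p\<close>.\<close>

definition pnorm :: "real \<Rightarrow> complex poly \<Rightarrow> real" where
  "pnorm B p = (\<Sum>k\<le>degree p. cmod (coeff p k) * B ^ k)"

lemma pnorm_eq_sum:
  assumes "degree p \<le> n" shows "pnorm B p = (\<Sum>k\<le>n. cmod (coeff p k) * B ^ k)"
  unfolding pnorm_def
  by (rule sum.mono_neutral_left) (use assms in \<open>auto simp: coeff_eq_0\<close>)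

lemma pnorm_nonneg: "0 \<le> B \<Longrightarrow> 0 \<le> pnorm B p"
  unfolding pnorm_def by (intro sum_nonneg) auto

lemma pnorm_0 [simp]: "pnorm B 0 = 0" by (simp add: pnorm_def)

lemma pnorm_pCons: "pnorm B (pCons a p) = cmod a + B * pnorm B p"
proof -
  have "pnorm B (pCons a p) = (\<Sum>k\<le>Suc (degree p). cmod (coeff (pCons a p) k) * B ^ k)"
    by (rule pnorm_eq_sum) (simp add: degree_pCons_le)
  also have "\<dots> = cmod a + B * pnorm B p"
    by (simp add: sum.atMost_Suc_shift pnorm_def sum_distrib_left mult.left_commute del: sum.atMost_Suc)
  finally show ?thesis .
qed

lemma pnorm_1 [simp]: "pnorm B 1 = 1"
  by (simp add: one_pCons pnorm_pCons)

lemma pnorm_smult: "pnorm B (smult c p) = cmod c * pnorm B p"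
  by (simp add: pnorm_eq_sum[of "smult c p" "degree p"] pnorm_def sum_distrib_left norm_mult mult.assoc degree_smult_le)

lemma pnorm_add: assumes "0 \<le> B" shows "pnorm B (p + q) \<le> pnorm B p + pnorm B q"
proof -
  define n where "n = max (degree p) (degree q)"
  have n: "degree (p + q) \<le> n" "degree p \<le> n" "degree q \<le> n"
    by (auto simp: n_def degree_add_le_max)
  have "(\<Sum>k\<le>n. cmod (coeff p k + coeff q k) * B ^ k) \<le> (\<Sum>k\<le>n. cmod (coeff p k) * B ^ k + cmod (coeff q k) * B ^ k)"
    by (intro sum_mono) (simp add: assms mult_right_mono norm_triangle_ineq flip: distrib_right)
  then show ?thesis by (simp add: pnorm_eq_sum[of _ n] n sum.distrib)
qed

lemma pnorm_diff: "0 \<le> B \<Longrightarrow> pnorm B (p - q) \<le> pnorm B p + pnorm B q"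
  using pnorm_add[of B p "smult (-1) q"] pnorm_smult[of B "-1" q] by simp

lemma pnorm_mult: assumes "0 \<le> B" shows "pnorm B (p * q) \<le> pnorm B p * pnorm B q"
proof (induction p)
  case (pCons a p)
  have "pnorm B (pCons a p * q) \<le> pnorm B (smult a q) + pnorm B (pCons 0 (p * q))"
    by (simp add: pnorm_add assms)
  also have "\<dots> \<le> cmod a * pnorm B q + B * (pnorm B p * pnorm B q)"
    using pCons.IH assms by (simp add: pnorm_smult pnorm_pCons mult_left_mono)
  finally show ?case by (simp add: pnorm_pCons algebra_simps)
qed simp

lemma pnorm_power: "0 \<le> B \<Longrightarrow> pnorm B (p ^ n) \<le> pnorm B p ^ n"
proof (induction n)
  case (Suc n)
  then show ?case using pnorm_mult[of B p "p ^ n"] pnorm_nonneg[of B p]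
    by (auto intro: order_trans mult_left_mono)
qed simp

lemma kapply_id: "kapply (\<lambda>i j. if i = j then 1 else 0) f = f"
proof
  fix i
  have "infsum (\<lambda>j. (if i = j then 1 else 0) * f j) UNIV = infsum (\<lambda>j. (if i = j then 1 else 0) * f j) {i}"
    by (rule infsum_cong_neutral) auto
  then show "kapply (\<lambda>i j. if i = j then 1 else 0) f i = f i" by (simp add: kapply_def)
qed

lemma decays_sum:
  assumes "\<And>k. k \<in> S \<Longrightarrow> decays c (C k) (K k)"
  shows "decays c (\<Sum>k\<in>S. C k) (\<lambda>i j. \<Sum>k\<in>S. K k i j)"
  unfolding decays_def
proof (intro allI)
  fix i j
  have "cmod (\<Sum>k\<in>S. K k i j) \<le> (\<Sum>k\<in>S. C k * exp (- c * idist i j))"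
    by (rule order_trans[OF norm_sum sum_mono]) (rule decaysD[OF assms])
  then show "cmod (\<Sum>k\<in>S. K k i j) \<le> (\<Sum>k\<in>S. C k) * exp (- c * idist i j)"
    by (simp add: sum_distrib_right)
qed

lemma decays_scale: "decays c C K \<Longrightarrow> decays c (cmod a * C) (\<lambda>i j. a * K i j)"
  unfolding decays_def by (simp add: norm_mult mult.assoc mult_left_mono)

lemma decays_id: "decays c 1 (\<lambda>i j. if i = j then 1 else 0)"
  by (simp add: decays_def)

lemma kapply_sum:
  fixes K :: "'k \<Rightarrow> 'd::finite kernel"
  assumes "\<And>k. k \<in> S \<Longrightarrow> decays c (C k) (K k)" "c > 0" "f \<in> l2"
  shows "kapply (\<lambda>i j. \<Sum>k\<in>S. a k * K k i j) f = (\<lambda>i. \<Sum>k\<in>S. a k * kapply (K k) f i)"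
proof
  fix i
  have "infsum (\<lambda>j. \<Sum>k\<in>S. a k * (K k i j * f j)) UNIV = (\<Sum>k\<in>S. infsum (\<lambda>j. a k * (K k i j * f j)) UNIV)"
    by (rule infsum_sum) (intro summable_on_cmult_right decays_summable_l2[OF assms(1) assms(2,3)])
  then show "kapply (\<lambda>i j. \<Sum>k\<in>S. a k * K k i j) f i = (\<Sum>k\<in>S. a k * kapply (K k) f i)"
    by (simp add: kapply_def sum_distrib_right mult.assoc infsum_cmult_right')
qed

text \<open>The decay rate is \<open>2 c\<close> so that all powers of \<open>H\<close> decay at the common rate \<open>c\<close>.\<close>

locale decaying_selfadjoint =
  fixes H :: "'d::finite kernel" and c A :: real
  assumes H_decays: "decays (2 * c) A H" and c_pos: "0 < c"
    and H_sym: "H j i = cnj (H i j)"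
begin

text \<open>One number in two roles: the operator norm bound from Schur's test and the factor by
  which each multiplication by \<open>H\<close> worsens the decay constant. It depends only on
  \<open>c\<close> and \<open>A\<close>, not on \<open>H\<close> itself.\<close>

definition growth :: real where "growth = A * exp_sum c (undefined :: 'd idx)"

lemma A_nonneg: "0 \<le> A" by (rule decays_const_nonneg[OF H_decays])

lemma growth_nonneg: "0 \<le> growth"
  unfolding growth_def by (intro mult_nonneg_nonneg A_nonneg less_imp_le exp_sum_pos[OF c_pos])

lemma H_decays': "decays c A H"
  by (rule decays_mono[OF H_decays]) (use c_pos in auto)

sublocale l2_selfadjoint "kapply H" growth
proof
  show "kapply H f \<in> l2" if "f \<in> l2" for f by (rule decays_l2[OF H_decays' c_pos that])
  show "kapply H (\<lambda>i. f i + g i) = (\<lambda>i. kapply H f i + kapply H g i)" if "f \<in> l2" "g \<in> l2" for f g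
    by (rule kapply_add[OF H_decays' c_pos that])
  show "kapply H (\<lambda>i. a * f i) = (\<lambda>i. a * kapply H f i)" for f a by (rule kapply_scale)
  show "l2norm (kapply H f) \<le> growth * l2norm f" if "f \<in> l2" for f
    unfolding growth_def by (rule decays_l2norm[OF H_decays' c_pos that])
  show "ip (kapply H f) g = ip f (kapply H g)" if "f \<in> l2" "g \<in> l2" for f g
  proof -
    have "(\<lambda>i j. cnj (H j i)) = H" using H_sym by (intro ext) metis
    then show ?thesis using kapply_adjoint[OF H_decays' c_pos that] by simp
  qed
qed

lemma kpow_decays: "decays c (growth ^ k) (kpow H k)"
proof (induction k)
  case 0
  show ?case by (simp add: decays_id)
next
  case (Suc k)
  show ?case using decays_kcomp(1)[OF H_decays Suc c_pos, of undefined]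
    by (simp add: growth_def mult_ac)
qed

lemma kapply_kpow: "f \<in> l2 \<Longrightarrow> kapply (kpow H k) f = (kapply H ^^ k) f"
proof (induction k)
  case 0
  then show ?case by (simp add: kapply_id)
next
  case (Suc k)
  then show ?case using kapply_kcomp[OF H_decays' c_pos kpow_decays c_pos] by simp
qed

lemma kpoly_decays: "decays c (pnorm growth p) (kpoly H p)"
  unfolding pnorm_def kpoly_def by (intro decays_sum decays_scale kpow_decays)

lemma kapply_kpoly: "f \<in> l2 \<Longrightarrow> kapply (kpoly H p) f = op_poly (kapply H) p f"
  unfolding kpoly_def op_poly_def
  using kapply_sum[of "{..degree p}" c "\<lambda>k. growth ^ k" "kpow H" f "coeff p"]
  by (simp add: kpow_decays c_pos kapply_kpow)

lemma kpoly_eq_op_poly: "kpoly H p i j = op_poly (kapply H) p (unit_fn j) i"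
  by (metis kapply_kpoly kapply_unit_fn unit_fn_l2)

text \<open>An entry is a coordinate of p(H) applied to a unit vector, so the norm bound controls
  it, uniformly but without decay; \<open>kpoly_decays\<close> is its counterpart.\<close>

lemma kpoly_spectral_bound:
  assumes "real_coeffs p"
    and "\<And>t. t \<in> spectral_set \<Longrightarrow> cmod (poly p (complex_of_real t)) \<le> \<epsilon>"
  shows "cmod (kpoly H p i j) \<le> \<epsilon>"
proof -
  have "cmod (kpoly H p i j) \<le> l2norm (op_poly (kapply H) p (unit_fn j))"
    unfolding kpoly_eq_op_poly by (intro cmod_le_l2norm op_poly_l2) simp
  also have "\<dots> \<le> \<epsilon> * l2norm (unit_fn j :: 'd idx \<Rightarrow> complex)"
    by (rule spectral_bound[OF assms]) auto
  finally show ?thesis by simp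
qed

lemma kapply_kshift:
  assumes "f \<in> l2" shows "kapply (kshift H z) f = op_poly (kapply H) [:- z, 1:] f"
proof -
  have "kshift H z = kpoly H [:- z, 1:]"
  proof (intro ext)
    fix i j
    show "kshift H z i j = kpoly H [:- z, 1:] i j"
      unfolding kpoly_eq_op_poly op_poly_linear[OF unit_fn_l2] kshift_def kapply_unit_fn
      by (simp add: unit_fn_def)
  qed
  then show ?thesis by (simp add: kapply_kpoly[OF assms])
qed

end

text \<open>Interpolating between the two bounds \<open>D q\<^sup>k\<close> and \<open>D b\<^sup>k e\<^sup>-\<^sup>c\<^sup>d\<close> for the terms of a series gives
  summable bounds with exponential decay.\<close>

definition interp_rate :: "real \<Rightarrow> real \<Rightarrow> real \<Rightarrow> real" where
  "interp_rate c q b = c * (- ln q / (2 * (ln b - ln q)))"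

lemma interp_rate_pos: "0 < c \<Longrightarrow> 0 < q \<Longrightarrow> q < 1 \<Longrightarrow> 1 \<le> b \<Longrightarrow> 0 < interp_rate c q b"
  unfolding interp_rate_def
  by (intro mult_pos_pos divide_pos_pos)
    (auto simp: ln_less_zero intro!: order.strict_trans2[OF ln_less_zero[of q] ln_ge_zero[of b]])

lemma interpolate:
  fixes x :: real
  assumes q: "0 < q" "q < 1" and b: "1 \<le> b" and D: "0 \<le> D"
    and x: "x \<le> D * q ^ k" "x \<le> D * b ^ k * exp (- c * d)"
  shows "x \<le> D * sqrt q ^ k * exp (- interp_rate c q b * d)"
proof -
  \<comment> \<open>The weight for which (1 - \<theta>) ln q + \<theta> ln b equals half of ln q:
    half of the geometric smallness survives as a power of sqrt q, the other half buys
    decay.\<close>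
  define \<theta> where "\<theta> = - ln q / (2 * (ln b - ln q))"
  have lq: "ln q < 0" using q by simp
  have lb: "0 \<le> ln b" using b by simp
  have th: "0 \<le> \<theta>" "\<theta> \<le> 1" using lq lb by (auto simp: \<theta>_def field_simps)
  have th2: "(1 - \<theta>) * ln q + \<theta> * ln b = ln q / 2"
  proof -
    have "\<theta> * (2 * (ln b - ln q)) = - ln q" using lq lb by (simp add: \<theta>_def)
    then show ?thesis by (simp add: algebra_simps)
  qed
  define u v where "u = real k * ln q" and "v = real k * ln b - c * d"
  have qk: "q ^ k = exp u" using q by (simp add: u_def exp_of_nat_mult)
  have bk: "b ^ k * exp (- c * d) = exp v" using b by (simp add: v_def exp_of_nat_mult exp_diff exp_minus divide_inverse)
  have "x \<le> D * exp (min u v)"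
    using x by (simp only: min_def qk bk mult.assoc split: if_split) simp
  also have "\<dots> \<le> D * exp ((1 - \<theta>) * u + \<theta> * v)"
  proof -
    have "(1 - \<theta>) * min u v + \<theta> * min u v \<le> (1 - \<theta>) * u + \<theta> * v"
      using th by (intro add_mono mult_left_mono) auto
    then have "min u v \<le> (1 - \<theta>) * u + \<theta> * v" by (simp add: algebra_simps)
    then show ?thesis using D by (intro mult_left_mono) auto
  qed
  also have "(1 - \<theta>) * u + \<theta> * v = real k * ((1 - \<theta>) * ln q + \<theta> * ln b) - c * \<theta> * d"
    by (simp add: u_def v_def algebra_simps)
  also have "\<dots> = real k * (ln q / 2) - interp_rate c q b * d"
    unfolding th2 by (simp add: interp_rate_def \<theta>_def)
  also have "exp \<dots> = sqrt q ^ k * exp (- interp_rate c q b * d)"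
  proof -
    have "sqrt q = exp (ln q / 2)" using q exp_ln[of "sqrt q"] by (simp add: ln_sqrt)
    then have "sqrt q ^ k = exp (real k * (ln q / 2))" by (simp only: exp_of_nat_mult)
    then show ?thesis by (simp only: diff_conv_add_uminus exp_add mult_minus_left)
  qed
  finally show ?thesis by (simp add: mult.assoc)
qed

definition kseries :: "'d kernel \<Rightarrow> (nat \<Rightarrow> complex poly) \<Rightarrow> 'd kernel" where
  "kseries H u = (\<lambda>i j. infsum (\<lambda>k. kpoly H (u k) i j) UNIV)"

text \<open>Here \<open>b\<close> measures how fast the decay constants grow and \<open>q\<close>
  how small the terms are on the spectrum. The two instances are the series for the resolvent and
  the one for the sign.\<close>

locale spectral_series = decaying_selfadjoint H c A
  for H :: "'d::finite kernel" and c A +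
  fixes u :: "nat \<Rightarrow> complex poly" and D q b :: real
  assumes u_real: "real_coeffs (u k)"
    and u_pnorm: "pnorm growth (u k) \<le> D * b ^ k"
    and u_spec: "t \<in> spectral_set \<Longrightarrow> cmod (poly (u k) (complex_of_real t)) \<le> D * q ^ k"
    and q: "0 < q" "q < 1" and b: "1 \<le> b"
begin

definition rate :: real where "rate = interp_rate c q b"

lemma rate_pos: "0 < rate" unfolding rate_def by (rule interp_rate_pos[OF c_pos q b])

lemma D_nonneg: "0 \<le> D"
proof -
  have "0 \<le> D * b ^ 0" by (rule order_trans[OF pnorm_nonneg[OF growth_nonneg] u_pnorm])
  then show ?thesis by simp
qed

lemma term_decays: "decays rate (D * sqrt q ^ k) (kpoly H (u k))"
  unfolding decays_def
proof (intro allI)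
  fix i j
  show "cmod (kpoly H (u k) i j) \<le> D * sqrt q ^ k * exp (- rate * idist i j)"
    unfolding rate_def
  proof (rule interpolate[OF q b D_nonneg])
    show "cmod (kpoly H (u k) i j) \<le> D * q ^ k" by (rule kpoly_spectral_bound[OF u_real u_spec])
    show "cmod (kpoly H (u k) i j) \<le> D * b ^ k * exp (- c * idist i j)"
      by (rule order_trans[OF decaysD[OF kpoly_decays] mult_right_mono[OF u_pnorm]]) simp
  qed
qed

lemma sqrt_q: "0 < sqrt q" "sqrt q < 1" using q by auto

lemma geometric_tail: "((\<lambda>k. sqrt q ^ k) has_sum (sqrt q ^ n / (1 - sqrt q))) {n..}"
proof -
  have "((\<lambda>k. sqrt q ^ k * sqrt q ^ n) has_sum (1 / (1 - sqrt q) * sqrt q ^ n)) UNIV"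
  proof (rule has_sum_cmult_left)
    have "(\<lambda>k. sqrt q ^ k) sums (1 / (1 - sqrt q))" by (rule geometric_sums) (use sqrt_q in auto)
    then show "((\<lambda>k. sqrt q ^ k) has_sum (1 / (1 - sqrt q))) UNIV"
      by (rule sums_nonneg_imp_has_sum) (use sqrt_q in auto)
  qed
  also have "?this \<longleftrightarrow> ((\<lambda>k. sqrt q ^ k) has_sum (1 / (1 - sqrt q) * sqrt q ^ n)) {n..}"
    by (rule has_sum_reindex_bij_witness[where j = "\<lambda>k. k + n" and i = "\<lambda>k. k - n"]) (auto simp: power_add)
  finally show ?thesis by simp
qed

definition tail_const :: real where "tail_const = D / (1 - sqrt q)"

lemma tail_const_nonneg: "0 \<le> tail_const"
  using D_nonneg sqrt_q by (simp add: tail_const_def)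

lemma term_summable: "(\<lambda>k. cmod (kpoly H (u k) i j)) summable_on S"
proof -
  have "{0::nat..} = UNIV" by auto
  then have "(\<lambda>k. sqrt q ^ k) summable_on S"
    using has_sum_imp_summable[OF geometric_tail[of 0]] by (intro summable_on_subset_banach[of _ UNIV S]) auto
  then have s: "(\<lambda>k. D * sqrt q ^ k) summable_on S" by (rule summable_on_cmult_right)
  show ?thesis
    by (rule Infinite_Sum.abs_summable_on_comparison_test'[OF s])
      (rule decays_bounded[OF term_decays less_imp_le[OF rate_pos]])
qed

definition partial :: "nat \<Rightarrow> complex poly" where "partial n = (\<Sum>k<n. u k)"

lemma partial_real: "real_coeffs (partial n)"
  unfolding partial_def by (intro real_coeffs_sum u_real)

lemma kpoly_partial: "kpoly H (partial n) i j = (\<Sum>k<n. kpoly H (u k) i j)"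
  unfolding partial_def kpoly_eq_op_poly op_poly_sum ..

text \<open>One estimate with two uses: n = 0 gives the decay of the whole sum, and Schur's test
  turns the factor in \<open>n\<close> into operator norm convergence of the partial sums.\<close>

lemma tail_decays: "decays rate (tail_const * sqrt q ^ n) (\<lambda>i j. kseries H u i j - kpoly H (partial n) i j)"
  unfolding decays_def
proof (intro allI)
  fix i j
  have "infsum (\<lambda>k. kpoly H (u k) i j) ({..<n} \<union> {n..}) =
      infsum (\<lambda>k. kpoly H (u k) i j) {..<n} + infsum (\<lambda>k. kpoly H (u k) i j) {n..}"
    by (rule infsum_Un_disjoint[OF abs_summable_summable[OF term_summable] abs_summable_summable[OF term_summable]]) auto
  moreover have "{..<n} \<union> {n..} = UNIV" by auto
  ultimately have "kseries H u i j - kpoly H (partial n) i j = infsum (\<lambda>k. kpoly H (u k) i j) {n..}"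
    by (simp add: kseries_def kpoly_partial)
  also have "cmod \<dots> \<le> infsum (\<lambda>k. cmod (kpoly H (u k) i j)) {n..}"
    by (rule norm_infsum_bound[OF term_summable])
  also have "\<dots> \<le> infsum (\<lambda>k. D * exp (- rate * idist i j) * sqrt q ^ k) {n..}"
  proof (rule infsum_mono[OF term_summable])
    show "(\<lambda>k. D * exp (- rate * idist i j) * sqrt q ^ k) summable_on {n..}"
      by (intro summable_on_cmult_right has_sum_imp_summable[OF geometric_tail])
    show "cmod (kpoly H (u k) i j) \<le> D * exp (- rate * idist i j) * sqrt q ^ k" for k
      using decaysD[OF term_decays, of k i j] by (simp add: mult_ac)
  qed
  also have "\<dots> = tail_const * sqrt q ^ n * exp (- rate * idist i j)"
    using infsumI[OF geometric_tail[of n]] by (simp add: infsum_cmult_right' tail_const_def)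
  finally show "cmod (kseries H u i j - kpoly H (partial n) i j) \<le> tail_const * sqrt q ^ n * exp (- rate * idist i j)" .
qed

lemma kseries_decays: "decays rate tail_const (kseries H u)"
proof -
  have "(\<lambda>i j. kseries H u i j - kpoly H (partial 0) i j) = kseries H u"
    by (simp add: kpoly_partial)
  then show ?thesis using tail_decays[of 0] by simp
qed

lemma kseries_l2: "f \<in> l2 \<Longrightarrow> kapply (kseries H u) f \<in> l2"
  by (rule decays_l2[OF kseries_decays rate_pos])

lemma kseries_approx:
  assumes f: "f \<in> l2"
  shows "l2norm (\<lambda>i. kapply (kseries H u) f i - op_poly (kapply H) (partial n) f i)
    \<le> tail_const * exp_sum rate (undefined :: 'd idx) * l2norm f * sqrt q ^ n"
proof -
  have "kapply (\<lambda>i j. kseries H u i j - kpoly H (partial n) i j) f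
      = (\<lambda>i. kapply (kseries H u) f i - op_poly (kapply H) (partial n) f i)"
  proof
    fix i
    have "infsum (\<lambda>j. kseries H u i j * f j + - (kpoly H (partial n) i j * f j)) UNIV
        = infsum (\<lambda>j. kseries H u i j * f j) UNIV + infsum (\<lambda>j. - (kpoly H (partial n) i j * f j)) UNIV"
      by (intro infsum_add summable_on_uminus[THEN iffD2] decays_summable_l2[OF kseries_decays rate_pos f]
          decays_summable_l2[OF kpoly_decays c_pos f])
    then show "kapply (\<lambda>i j. kseries H u i j - kpoly H (partial n) i j) f i
      = kapply (kseries H u) f i - op_poly (kapply H) (partial n) f i"
      by (simp add: kapply_kpoly[OF f, symmetric] kapply_def left_diff_distrib infsum_uminus)
  qed
  then show ?thesis using decays_l2norm[OF tail_decays rate_pos f, of n undefined] by (simp add: mult_ac)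
qed

lemma kseries_approx_tendsto:
  assumes f: "f \<in> l2"
  shows "(\<lambda>n. l2norm (\<lambda>i. kapply (kseries H u) f i - op_poly (kapply H) (partial n) f i)) \<longlonglongrightarrow> 0"
proof (rule tendsto_sandwich[OF _ _ tendsto_const])
  have "(\<lambda>n. sqrt q ^ n) \<longlonglongrightarrow> 0" using sqrt_q by (intro LIMSEQ_realpow_zero) auto
  then show "(\<lambda>n. tail_const * exp_sum rate (undefined :: 'd idx) * l2norm f * sqrt q ^ n) \<longlonglongrightarrow> 0"
    by (rule tendsto_mult_right_zero)
qed (use kseries_approx[OF f] in simp_all)

end

section \<open>Resolvents and spectral projections\<close>

text \<open>The device behind the operator identities below: both sides are approximated by one
  sequence of polynomials in \<open>H\<close>.\<close>

lemma l2norm_limit_unique: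
  assumes f: "f \<in> l2" and g: "g \<in> l2" and h: "\<And>n. h n \<in> l2"
    and 1: "(\<lambda>n. l2norm (\<lambda>i. f i - h n i)) \<longlonglongrightarrow> 0"
    and 2: "(\<lambda>n. l2norm (\<lambda>i. g i - h n i)) \<longlonglongrightarrow> 0"
  shows "f = g"
proof -
  have "l2norm (\<lambda>i. f i - g i) \<le> 0"
  proof (rule tendsto_lowerbound[OF tendsto_add_zero[OF 1 2]])
    show "\<forall>\<^sub>F n in sequentially. l2norm (\<lambda>i. f i - g i) \<le> l2norm (\<lambda>i. f i - h n i) + l2norm (\<lambda>i. g i - h n i)"
      using l2norm_triangle_3[OF f h g] l2norm_minus_commute[of g] by simp
  qed simp
  then have "l2norm (\<lambda>i. f i - g i) = 0" using l2norm_ge_0 order_antisym by blast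
  then have "(\<lambda>i. f i - g i) = (\<lambda>i. 0)" by (rule l2norm_eq_0D[OF l2_diff[OF f g]])
  then show ?thesis by (auto simp: fun_eq_iff)
qed

context l2_operator begin

lemma op_poly_vec_diff:
  assumes f: "f \<in> l2" and g: "g \<in> l2"
  shows "op_poly T p (\<lambda>i. f i - g i) = (\<lambda>i. op_poly T p f i - op_poly T p g i)"
proof -
  have "op_poly T p (\<lambda>i. f i + -1 * g i) = (\<lambda>i. op_poly T p f i + -1 * op_poly T p g i)"
  proof (induction p)
    case 0 show ?case by (simp add: op_poly_0)
  next
    case (pCons a p)
    have l: "(\<lambda>i. f i + -1 * g i) \<in> l2" by (rule l2_add[OF f l2_scale[OF g]])
    have "T (\<lambda>i. op_poly T p f i + -1 * op_poly T p g i)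
        = (\<lambda>i. T (op_poly T p f) i + -1 * T (op_poly T p g) i)"
      by (simp only: T_add[OF op_poly_l2[OF f] l2_scale[OF op_poly_l2[OF g]]] T_scale[OF op_poly_l2[OF g]])
    then show ?case
      by (simp only: op_poly_pCons[OF l] op_poly_pCons[OF f] op_poly_pCons[OF g] pCons.IH)
        (simp add: algebra_simps)
  qed
  then show ?thesis by simp
qed

lemma op_poly_tendsto:
  assumes f: "f \<in> l2" and h: "\<And>n. h n \<in> l2"
    and lim: "(\<lambda>n. l2norm (\<lambda>i. f i - h n i)) \<longlonglongrightarrow> 0"
  shows "(\<lambda>n. l2norm (\<lambda>i. op_poly T p f i - op_poly T p (h n) i)) \<longlonglongrightarrow> 0"
proof -
  obtain C where C: "C \<ge> 0" "\<And>f. f \<in> l2 \<Longrightarrow> l2norm (op_poly T p f) \<le> C * l2norm f"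
    using op_poly_bounded by blast
  show ?thesis
  proof (rule tendsto_sandwich[OF _ _ tendsto_const tendsto_mult_right_zero[OF lim, of C]])
    show "\<forall>\<^sub>F n in sequentially. l2norm (\<lambda>i. op_poly T p f i - op_poly T p (h n) i) \<le> C * l2norm (\<lambda>i. f i - h n i)"
      unfolding op_poly_vec_diff[OF f h, symmetric] by (intro always_eventually allI C(2) l2_diff f h)
  qed simp
qed

end

section \<open>Polynomial series for 1/x and sgn x on a spectrum with a gap\<close>

definition affine_poly :: "real \<Rightarrow> real \<Rightarrow> complex poly" where
  "affine_poly lam M = [:complex_of_real (- lam / M), complex_of_real (1 / M):]"

text \<open>For \<open>M\<close> large enough, x = \<open>affine_poly lam M\<close> sends the
  spectrum into [-1, 1] and the gap point to 0. The terms are a_k x (1 - x^2)^k; coefficients 1 sum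
  to 1/x, and \<open>sgn_coeff\<close> to sgn x.\<close>

definition gap_series :: "(nat \<Rightarrow> real) \<Rightarrow> real \<Rightarrow> real \<Rightarrow> nat \<Rightarrow> complex poly" where
  "gap_series a lam M k = smult (complex_of_real (a k))
    (affine_poly lam M * (1 - affine_poly lam M * affine_poly lam M) ^ k)"

lemma poly_affine_poly [simp]:
  "poly (affine_poly lam M) (complex_of_real t) = complex_of_real ((t - lam) / M)"
  by (simp add: affine_poly_def diff_divide_distrib)

lemma poly_gap_series:
  "poly (gap_series a lam M k) (complex_of_real t)
    = complex_of_real (a k * ((t - lam) / M * (1 - ((t - lam) / M)\<^sup>2) ^ k))"
  by (simp add: gap_series_def power2_eq_square)

lemma gap_series_real: "real_coeffs (gap_series a lam M k)"
proof -
  have "real_coeffs (affine_poly lam M)" by (simp add: affine_poly_def)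
  then show ?thesis unfolding gap_series_def by (intro real_coeffs_ops real_coeffs_power) auto
qed

text \<open>The constant is \<open>max 1 x\<close> because it must also dominate the values on the
  spectrum, which are bounded with constant 1.\<close>

lemma pnorm_gap_series:
  fixes lam M :: real
  assumes "0 \<le> B" "\<bar>a k\<bar> \<le> 1"
  defines "x \<equiv> pnorm B (affine_poly lam M)"
  shows "pnorm B (gap_series a lam M k) \<le> max 1 x * (1 + x\<^sup>2) ^ k"
proof -
  define X where "X = affine_poly lam M"
  have x0: "0 \<le> x" unfolding x_def by (rule pnorm_nonneg[OF assms(1)])
  have nn: "0 \<le> pnorm B p" for p by (rule pnorm_nonneg[OF assms(1)])
  have "pnorm B (1 - X * X) \<le> 1 + x\<^sup>2"
    using pnorm_diff[OF assms(1), of 1 "X * X"] pnorm_mult[OF assms(1), of X X]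
    by (simp add: x_def X_def power2_eq_square)
  then have p: "pnorm B ((1 - X * X) ^ k) \<le> (1 + x\<^sup>2) ^ k"
    by (rule order_trans[OF pnorm_power[OF assms(1)] power_mono[OF _ nn]])
  have "pnorm B (gap_series a lam M k) = \<bar>a k\<bar> * pnorm B (X * (1 - X * X) ^ k)"
    by (simp add: gap_series_def X_def pnorm_smult)
  also have "\<dots> \<le> 1 * pnorm B (X * (1 - X * X) ^ k)" by (intro mult_right_mono assms(2) nn)
  also have "\<dots> \<le> pnorm B X * pnorm B ((1 - X * X) ^ k)" using pnorm_mult[OF assms(1)] by simp
  also have "\<dots> \<le> max 1 x * (1 + x\<^sup>2) ^ k"
    using p x0 by (intro mult_mono) (auto simp: x_def X_def nn)
  finally show ?thesis .
qed

text \<open>The coefficients of \<open>(1 - z)\<^bsup>-1/2\<^esup>\<close>; then \<open>x \<Sum>\<^sub>k a\<^sub>k (1 - x\<^sup>2)\<^sup>k = x / |x|\<close>.\<close>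

definition sgn_coeff :: "nat \<Rightarrow> real" where
  "sgn_coeff k = ((-1/2) gchoose k) * (-1) ^ k"

text \<open>Consecutive coefficients have ratio (k + 1/2) / (k + 1), which is below 1.\<close>

lemma sgn_coeff_le: "\<bar>sgn_coeff k\<bar> \<le> 1"
proof (induction k)
  case 0
  show ?case by (simp add: sgn_coeff_def)
next
  case (Suc k)
  have "((-1/2) gchoose Suc k) * (real k + 1) = (-1/2 - real k) * ((-1/2::real) gchoose k)"
    using gbinomial_mult_1[of "-1/2::real" k] by (simp add: algebra_simps)
  then have "\<bar>((-1/2) gchoose Suc k) * (real k + 1)\<bar> = \<bar>(-1/2 - real k) * ((-1/2::real) gchoose k)\<bar>"
    by (simp only:)
  then have "\<bar>(-1/2::real) gchoose Suc k\<bar> * (real k + 1) = (1/2 + real k) * \<bar>(-1/2::real) gchoose k\<bar>"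
    unfolding abs_mult by simp
  also have "\<dots> \<le> (real k + 1) * 1"
    using Suc by (intro mult_mono) (auto simp: sgn_coeff_def abs_mult)
  finally show ?case by (simp add: sgn_coeff_def abs_mult)
qed

text \<open>The binomial series is evaluated at 1 - x^2, which x nonzero keeps strictly inside the
  disc of convergence.\<close>

lemma sgn_series:
  assumes x: "x \<noteq> 0" "\<bar>x\<bar> \<le> (1::real)"
  shows "(\<lambda>k. sgn_coeff k * (x * (1 - x\<^sup>2) ^ k)) sums sgn x"
proof -
  have x2: "0 < x\<^sup>2" "x\<^sup>2 \<le> 1" using x by (auto simp: abs_square_le_1)
  have "(\<lambda>k. ((-1/2) gchoose k) * (- (1 - x\<^sup>2)) ^ k) sums (1 + - (1 - x\<^sup>2)) powr (-1/2)"
    by (rule gen_binomial_real) (use x2 in auto)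
  moreover have "(1 + - (1 - x\<^sup>2)) powr (-1/2) = 1 / \<bar>x\<bar>"
  proof -
    have 1: "1 + - (1 - x\<^sup>2) = x\<^sup>2" "-1/2 = - (1/2 :: real)" by auto
    have "x\<^sup>2 powr (1/2) = \<bar>x\<bar>" using powr_half_sqrt[of "x\<^sup>2"] by (simp only: real_sqrt_abs zero_le_power2)
    then show ?thesis unfolding 1 powr_minus by (simp only: divide_inverse mult_1)
  qed
  ultimately have "(\<lambda>k. sgn_coeff k * (1 - x\<^sup>2) ^ k) sums (1 / \<bar>x\<bar>)"
    by (simp only: sgn_coeff_def power_minus[of "1 - x\<^sup>2"] mult.assoc)
  then have "(\<lambda>k. x * (sgn_coeff k * (1 - x\<^sup>2) ^ k)) sums (x * (1 / \<bar>x\<bar>))" by (rule sums_mult)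
  moreover have "x * (1 / \<bar>x\<bar>) = sgn x" using x(1) by (simp add: sgn_if)
  ultimately show ?thesis by (simp add: mult.left_commute)
qed

text \<open>The scale \<open>M\<close> is a parameter rather than a function of \<open>H\<close>, so
  that two operators can share it and with it the very same polynomials.\<close>

locale spectral_gap = decaying_selfadjoint H c A for H :: "'d::finite kernel" and c A +
  fixes lam M :: real
  assumes gap: "lam \<notin> spectral_set" and M_pos: "0 < M"
    and M_bound: "t \<in> spectral_set \<Longrightarrow> \<bar>t - lam\<bar> \<le> M"
begin

lemma ex_gap_ratio: "\<exists>q. 0 < q \<and> q < 1 \<and> (\<forall>t\<in>spectral_set. 1 - ((t - lam) / M)\<^sup>2 \<le> q)"
proof -
  obtain \<delta> where d: "\<delta> > 0" "\<And>s. s \<in> spectral_set \<Longrightarrow> \<delta> \<le> \<bar>s - lam\<bar>"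
    using spectral_set_gap[OF gap] by blast
  have "1 - ((t - lam) / M)\<^sup>2 \<le> 1 - (\<delta> / M)\<^sup>2" if t: "t \<in> spectral_set" for t
  proof -
    have "\<delta> / M \<le> \<bar>(t - lam) / M\<bar>" using d(2)[OF t] M_pos by (simp add: divide_right_mono)
    then have "(\<delta> / M)\<^sup>2 \<le> \<bar>(t - lam) / M\<bar>\<^sup>2" using d(1) M_pos by (intro power_mono) auto
    then show ?thesis by (simp only: power2_abs diff_left_mono)
  qed
  \<comment> \<open>The 1/2 keeps the ratio positive, since 1 - (\<delta> / M)^2 need not
    be.\<close>
  then show ?thesis using d(1) M_pos
    by (intro exI[of _ "max (1/2) (1 - (\<delta> / M)\<^sup>2)"]) (auto simp: le_max_iff_disj)
qed

definition gap_ratio :: real where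
  "gap_ratio = (SOME q. 0 < q \<and> q < 1 \<and> (\<forall>t\<in>spectral_set. 1 - ((t - lam) / M)\<^sup>2 \<le> q))"

lemma gap_ratio: "0 < gap_ratio" "gap_ratio < 1"
    "t \<in> spectral_set \<Longrightarrow> 1 - ((t - lam) / M)\<^sup>2 \<le> gap_ratio"
  using someI_ex[OF ex_gap_ratio] unfolding gap_ratio_def by auto

lemma scaled:
  assumes "t \<in> spectral_set"
  shows "\<bar>(t - lam) / M\<bar> \<le> 1" "(t - lam) / M \<noteq> 0" "0 \<le> 1 - ((t - lam) / M)\<^sup>2"
proof -
  show 1: "\<bar>(t - lam) / M\<bar> \<le> 1" using M_bound[OF assms] M_pos by simp
  show "(t - lam) / M \<noteq> 0" using gap assms M_pos by auto
  show "0 \<le> 1 - ((t - lam) / M)\<^sup>2" using 1 abs_square_le_1[of "(t - lam) / M"] by simp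
qed

definition pn :: real where "pn = pnorm growth (affine_poly lam M)"

lemma series_locale:
  assumes a: "\<And>k. \<bar>a k\<bar> \<le> 1"
  shows "spectral_series H c A (gap_series a lam M) (max 1 pn) gap_ratio (1 + pn\<^sup>2)"
proof
  show "real_coeffs (gap_series a lam M k)" for k by (rule gap_series_real)
  show "pnorm growth (gap_series a lam M k) \<le> max 1 pn * (1 + pn\<^sup>2) ^ k" for k
    unfolding pn_def by (rule pnorm_gap_series[OF growth_nonneg a])
  show "cmod (poly (gap_series a lam M k) (complex_of_real t)) \<le> max 1 pn * gap_ratio ^ k"
    if t: "t \<in> spectral_set" for t k
  proof -
    define x where "x = (t - lam) / M"
    have "\<bar>a k * (x * (1 - x\<^sup>2) ^ k)\<bar> \<le> 1 * (1 * gap_ratio ^ k)"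
      unfolding abs_mult power_abs
      using scaled[OF t] gap_ratio(3)[OF t] by (intro mult_mono power_mono a) (auto simp: x_def)
    also have "\<dots> \<le> max 1 pn * gap_ratio ^ k" using gap_ratio by (simp add: mult_le_cancel_right1)
    finally show ?thesis unfolding poly_gap_series norm_of_real x_def .
  qed
qed (use gap_ratio in auto)

sublocale neumann: spectral_series H c A "gap_series (\<lambda>_. 1) lam M" "max 1 pn" gap_ratio "1 + pn\<^sup>2"
  by (rule series_locale) simp

sublocale sign: spectral_series H c A "gap_series sgn_coeff lam M" "max 1 pn" gap_ratio "1 + pn\<^sup>2"
  by (rule series_locale) (rule sgn_coeff_le)

text \<open>Multiplying the sum of x (1 - x^2)^k over k < n by x telescopes to 1 - (1 -
  x^2)^n.\<close>

lemma neumann_error: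
  assumes t: "t \<in> spectral_set"
  shows "cmod (poly (affine_poly lam M * neumann.partial n - 1) (complex_of_real t)) \<le> gap_ratio ^ n"
proof -
  define x where "x = (t - lam) / M"
  have "x * (\<Sum>k<n. x * (1 - x\<^sup>2) ^ k) = x\<^sup>2 * (\<Sum>k<n. (1 - x\<^sup>2) ^ k)"
    by (simp add: sum_distrib_left power2_eq_square mult.assoc)
  also have "\<dots> = 1 - (1 - x\<^sup>2) ^ n" using one_diff_power_eq[of "1 - x\<^sup>2" n] by simp
  finally have "poly (affine_poly lam M * neumann.partial n - 1) (complex_of_real t) = complex_of_real (- ((1 - x\<^sup>2) ^ n))"
    by (simp add: neumann.partial_def poly_sum poly_gap_series flip: x_def of_real_sum of_real_mult of_real_power)
  then have "cmod (poly (affine_poly lam M * neumann.partial n - 1) (complex_of_real t)) = \<bar>(1 - x\<^sup>2) ^ n\<bar>"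
    by (simp only: norm_of_real abs_minus_cancel)
  also have "\<dots> \<le> gap_ratio ^ n"
    unfolding power_abs using scaled[OF t] gap_ratio(3)[OF t] by (intro power_mono) (auto simp: x_def)
  finally show ?thesis .
qed

lemma sign_error:
  assumes t: "t \<in> spectral_set"
  shows "cmod (poly (sign.partial n) (complex_of_real t) - complex_of_real (sgn (t - lam))) \<le> gap_ratio ^ n / (1 - gap_ratio)"
proof -
  define x where "x = (t - lam) / M"
  define f where "f k = sgn_coeff k * (x * (1 - x\<^sup>2) ^ k)" for k
  have fs: "f sums sgn x" unfolding f_def x_def by (rule sgn_series) (use scaled[OF t] in auto)
  have sx: "sgn x = sgn (t - lam)" using M_pos by (simp add: x_def sgn_divide)
  have le: "\<bar>f k\<bar> \<le> gap_ratio ^ k" for k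
  proof -
    have "\<bar>f k\<bar> \<le> 1 * (1 * gap_ratio ^ k)"
      unfolding f_def abs_mult power_abs
      using scaled[OF t] gap_ratio(3)[OF t] by (intro mult_mono power_mono sgn_coeff_le) (auto simp: x_def)
    then show ?thesis by simp
  qed
  have gs: "(\<lambda>k. gap_ratio ^ (k + n)) sums (gap_ratio ^ n / (1 - gap_ratio))"
    using sums_mult[OF geometric_sums[of gap_ratio], of "gap_ratio ^ n"] gap_ratio by (simp add: power_add mult.commute)
  have s: "summable (\<lambda>k. \<bar>f (k + n)\<bar>)"
    by (rule summable_comparison_test'[OF sums_summable[OF gs], of 0]) (simp add: le)
  have "sgn x - (\<Sum>k<n. f k) = (\<Sum>k. f (k + n))"
    using suminf_split_initial_segment[OF sums_summable[OF fs], of n] sums_unique[OF fs] by simp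
  then have "\<bar>(\<Sum>k<n. f k) - sgn x\<bar> = \<bar>\<Sum>k. f (k + n)\<bar>" by linarith
  also have "\<dots> \<le> (\<Sum>k. \<bar>f (k + n)\<bar>)" by (rule summable_rabs[OF s])
  also have "\<dots> \<le> (\<Sum>k. gap_ratio ^ (k + n))" by (intro suminf_le s sums_summable[OF gs] le)
  also have "\<dots> = gap_ratio ^ n / (1 - gap_ratio)" using sums_unique[OF gs] by simp
  finally have *: "\<bar>(\<Sum>k<n. f k) - sgn x\<bar> \<le> gap_ratio ^ n / (1 - gap_ratio)" .
  have "poly (sign.partial n) (complex_of_real t) - complex_of_real (sgn (t - lam)) = complex_of_real ((\<Sum>k<n. f k) - sgn x)"
    by (simp only: sign.partial_def poly_sum poly_gap_series f_def x_def[symmetric] of_real_sum of_real_diff sx)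
  then show ?thesis using * by (simp only: norm_of_real)
qed

lemma gap_ratio_power_tendsto: "(\<lambda>n. gap_ratio ^ n) \<longlonglongrightarrow> 0"
  using gap_ratio by (intro LIMSEQ_realpow_zero) auto

lemma shift_eq_affine:
  assumes "f \<in> l2" shows "kapply (kshift H (complex_of_real lam)) f = (\<lambda>i. complex_of_real M * op_poly (kapply H) (affine_poly lam M) f i)"
  using M_pos
  by (intro ext) (simp add: kapply_kshift[OF assms] op_poly_linear[OF assms] affine_poly_def field_simps)

text \<open>The series with unit coefficients sums to 1/x = M / (t - lam), hence the prefactor 1 /
  M.\<close>

definition resolvent :: "'d kernel" where
  "resolvent = (\<lambda>i j. complex_of_real (1 / M) * kseries H (gap_series (\<lambda>_. 1) lam M) i j)"

lemma kapply_resolvent: "kapply resolvent f = (\<lambda>i. complex_of_real (1 / M) * kapply (kseries H (gap_series (\<lambda>_. 1) lam M)) f i)"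
  by (simp only: resolvent_def kapply_def mult.assoc infsum_cmult_right')

lemma neumann_tendsto:
  assumes f: "f \<in> l2"
  shows "(\<lambda>n. l2norm (\<lambda>i. f i - op_poly (kapply H) (affine_poly lam M * neumann.partial n) f i)) \<longlonglongrightarrow> 0"
proof (rule tendsto_sandwich[OF _ _ tendsto_const])
  show "(\<lambda>n. gap_ratio ^ n * l2norm f) \<longlonglongrightarrow> 0"
    by (rule tendsto_mult_left_zero[OF gap_ratio_power_tendsto])
  have "l2norm (\<lambda>i. f i - op_poly (kapply H) (affine_poly lam M * neumann.partial n) f i) \<le> gap_ratio ^ n * l2norm f" for n
  proof -
    have one: "op_poly (kapply H) 1 f = f" using op_poly_const[OF f, of 1] by (simp add: one_pCons)
    have "real_coeffs (affine_poly lam M)" by (simp add: affine_poly_def)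
    then have "real_coeffs (affine_poly lam M * neumann.partial n - 1)"
      using neumann.partial_real by auto
    then have "l2norm (op_poly (kapply H) (affine_poly lam M * neumann.partial n - 1) f) \<le> gap_ratio ^ n * l2norm f"
      by (rule spectral_bound[OF _ neumann_error f])
    then show ?thesis by (simp only: op_poly_diff one l2norm_minus_commute[of f])
  qed
  then show "\<forall>\<^sub>F n in sequentially. l2norm (\<lambda>i. f i - op_poly (kapply H) (affine_poly lam M * neumann.partial n) f i) \<le> gap_ratio ^ n * l2norm f"
    by simp
qed simp

text \<open>Two limits of one sequence: \<open>X * neumann.partial n\<close> applied to
  \<open>f\<close> tends to \<open>f\<close> by the Neumann error, and to X(H) applied to
  \<open>S f\<close> because X(H) is bounded.\<close>

lemma resolvent_right:
  assumes f: "f \<in> l2"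
  shows "kapply (kshift H (complex_of_real lam)) (kapply resolvent f) = f"
proof -
  define S where "S = kapply (kseries H (gap_series (\<lambda>_. 1) lam M))"
  define X where "X = affine_poly lam M"
  have Sf: "S f \<in> l2" unfolding S_def by (rule neumann.kseries_l2[OF f])
  have "op_poly (kapply H) X (S f) = f"
  proof (rule l2norm_limit_unique[OF op_poly_l2[OF Sf] f])
    show "op_poly (kapply H) (X * neumann.partial n) f \<in> l2" for n by (rule op_poly_l2[OF f])
    show "(\<lambda>n. l2norm (\<lambda>i. f i - op_poly (kapply H) (X * neumann.partial n) f i)) \<longlonglongrightarrow> 0"
      unfolding X_def by (rule neumann_tendsto[OF f])
    show "(\<lambda>n. l2norm (\<lambda>i. op_poly (kapply H) X (S f) i - op_poly (kapply H) (X * neumann.partial n) f i)) \<longlonglongrightarrow> 0"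
      unfolding op_poly_mult[OF f] S_def
      by (rule op_poly_tendsto[OF neumann.kseries_l2[OF f] op_poly_l2[OF f] neumann.kseries_approx_tendsto[OF f]])
  qed
  then have "op_poly (kapply H) X (\<lambda>i. complex_of_real (1 / M) * S f i) = (\<lambda>i. complex_of_real (1 / M) * f i)"
    using op_poly_mult[OF Sf, of "X" "[:complex_of_real (1 / M):]"] op_poly_smult[of "complex_of_real (1/M)" X "S f"]
      op_poly_const[OF Sf] by (simp add: mult.commute)
  then show ?thesis using M_pos
    by (simp only: kapply_resolvent S_def[symmetric] shift_eq_affine[OF l2_scale[OF Sf]] X_def[symmetric]) simp
qed

lemma resolvent_left:
  assumes f: "f \<in> l2"
  shows "kapply resolvent (kapply (kshift H (complex_of_real lam)) f) = f"
proof -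
  define S where "S = kapply (kseries H (gap_series (\<lambda>_. 1) lam M))"
  define X where "X = affine_poly lam M"
  define g where "g = op_poly (kapply H) X f"
  have g: "g \<in> l2" unfolding g_def by (rule op_poly_l2[OF f])
  have "S g = f"
  proof (rule l2norm_limit_unique[OF _ f])
    show "S g \<in> l2" unfolding S_def by (rule neumann.kseries_l2[OF g])
    show "op_poly (kapply H) (X * neumann.partial n) f \<in> l2" for n by (rule op_poly_l2[OF f])
    show "(\<lambda>n. l2norm (\<lambda>i. f i - op_poly (kapply H) (X * neumann.partial n) f i)) \<longlonglongrightarrow> 0"
      unfolding X_def by (rule neumann_tendsto[OF f])
    \<comment> \<open>Polynomials in \<open>H\<close> commute, so the same sequence is also the
      partial series applied to \<open>g\<close>.\<close>
    have "op_poly (kapply H) (X * neumann.partial n) f = op_poly (kapply H) (neumann.partial n) g" for n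
      unfolding g_def by (simp only: op_poly_mult[OF f, symmetric] mult.commute)
    then show "(\<lambda>n. l2norm (\<lambda>i. S g i - op_poly (kapply H) (X * neumann.partial n) f i)) \<longlonglongrightarrow> 0"
      using neumann.kseries_approx_tendsto[OF g] by (simp only: S_def)
  qed
  moreover have "kapply resolvent (\<lambda>i. complex_of_real M * g i) = (\<lambda>i. complex_of_real (1/M) * (complex_of_real M * S g i))"
    unfolding kapply_resolvent S_def by (simp only: kapply_scale)
  ultimately show ?thesis using M_pos by (simp add: shift_eq_affine[OF f] X_def g_def)
qed

lemma not_in_spec: "complex_of_real lam \<notin> spec H"
proof -
  have "bounded_kernel resolvent" unfolding resolvent_def
    by (rule decays_bounded_kernel[OF decays_scale[OF neumann.kseries_decays] neumann.rate_pos])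
  then show ?thesis unfolding spec_def using resolvent_left resolvent_right by blast
qed

end

section \<open>Agreement of the two spectra, uniqueness of the indicator calculus\<close>

context decaying_selfadjoint begin

lemma not_in_spectral_set:
  assumes "complex_of_real t \<notin> spec H" shows "t \<notin> spectral_set"
proof -
  from assms obtain R where R: "bounded_kernel R"
    "\<And>f. f \<in> l2 \<Longrightarrow> kapply R (kapply (kshift H (complex_of_real t)) f) = f"
    unfolding spec_def by blast
  then obtain C where C: "\<And>f. f \<in> l2 \<Longrightarrow> l2norm (kapply R f) \<le> C * l2norm f"
    unfolding bounded_kernel_def by blast
  \<comment> \<open>The constant \<open>C\<close> comes without a sign;
    \<open>\<bar>C\<bar> + 1\<close> makes the reciprocal a positive lower constant.\<close>
  have "1 / (\<bar>C\<bar> + 1) * l2norm f \<le> l2norm (op_poly (kapply H) [:- complex_of_real t, 1:] f)" if f: "f \<in> l2" for f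
  proof -
    define g where "g = op_poly (kapply H) [:- complex_of_real t, 1:] f"
    have g: "g \<in> l2" unfolding g_def by (rule op_poly_l2[OF f])
    have "l2norm f \<le> C * l2norm g" using C[OF g] R(2)[OF f] by (simp add: g_def kapply_kshift[OF f])
    also have "\<dots> \<le> (\<bar>C\<bar> + 1) * l2norm g" by (intro mult_right_mono) auto
    finally show ?thesis by (simp add: g_def[symmetric] divide_le_eq mult.commute)
  qed
  then have "bounded_below (op_poly (kapply H) [:- complex_of_real t, 1:])"
    unfolding bounded_below_def by (intro exI[of _ "1 / (\<bar>C\<bar> + 1)"]) auto
  then show ?thesis by (simp add: spectral_set_def)
qed

lemma spectral_gapI:
  assumes "lam \<notin> spectral_set" "growth + \<bar>lam\<bar> \<le> M" "0 < M"
  shows "spectral_gap H c A lam M"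
proof
  show "\<bar>t - lam\<bar> \<le> M" if "t \<in> spectral_set" for t using spectral_set_le[OF that] assms(2) by linarith
qed (use assms in auto)

text \<open>A bounded inverse forces a lower bound. Conversely a lower bound at t leaves a
  neighbourhood of t free of \<open>spectral_set\<close>, and there the Neumann series builds a
  decaying inverse kernel.\<close>

lemma spec_iff: "complex_of_real t \<in> spec H \<longleftrightarrow> t \<in> spectral_set"
proof
  show "t \<in> spectral_set" if "complex_of_real t \<in> spec H"
  proof (rule ccontr)
    assume "t \<notin> spectral_set"
    then interpret spectral_gap H c A t "growth + \<bar>t\<bar> + 1"
      by (rule spectral_gapI) (use growth_nonneg in auto)
    show False using not_in_spec that by simp
  qed
qed (use not_in_spectral_set in blast)

definition real_poly :: "nat \<Rightarrow> (nat \<Rightarrow> real) \<Rightarrow> complex poly" where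
  "real_poly n a = (\<Sum>k\<le>n. monom (complex_of_real (a k)) k)"

lemma coeff_real_poly: "coeff (real_poly n a) k = (if k \<le> n then complex_of_real (a k) else 0)"
  unfolding real_poly_def by (simp add: coeff_sum)

lemma real_poly:
  "real_coeffs (real_poly n a)"
  "poly (real_poly n a) (complex_of_real t) = complex_of_real (\<Sum>k\<le>n. a k * t ^ k)"
  "op_poly (kapply H) (real_poly n a) f = (\<lambda>i. \<Sum>k\<le>n. complex_of_real (a k) * (kapply H ^^ k) f i)"
proof -
  show "real_coeffs (real_poly n a)" by (simp add: real_coeffs_def coeff_real_poly)
  show "poly (real_poly n a) (complex_of_real t) = complex_of_real (\<Sum>k\<le>n. a k * t ^ k)"
    by (simp add: real_poly_def poly_sum poly_monom)
  have "degree (real_poly n a) \<le> n" by (rule degree_le) (simp add: coeff_real_poly)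
  then show "op_poly (kapply H) (real_poly n a) f = (\<lambda>i. \<Sum>k\<le>n. complex_of_real (a k) * (kapply H ^^ k) f i)"
    by (simp add: op_poly_eq_sum coeff_real_poly)
qed

lemma is_indicator_calcD:
  assumes "is_indicator_calc H lam P" "\<epsilon> > 0"
  obtains p where "real_coeffs p"
    "\<And>t. t \<in> spectral_set \<Longrightarrow> cmod (poly p (complex_of_real t) - (if t < lam then 1 else 0)) \<le> \<epsilon>"
    "\<And>f. f \<in> l2 \<Longrightarrow> l2norm (\<lambda>i. kapply P f i - op_poly (kapply H) p f i) \<le> \<epsilon> * l2norm f"
proof -
  from assms obtain n a where a:
    "\<And>t. t \<in> spectral_set \<Longrightarrow> \<bar>(\<Sum>k\<le>n. a k * t ^ k) - (if t < lam then 1 else 0)\<bar> \<le> \<epsilon>"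
    "\<And>f. f \<in> l2 \<Longrightarrow> l2norm (\<lambda>i. kapply P f i - (\<Sum>k\<le>n. complex_of_real (a k) * ((kapply H ^^ k) f) i)) \<le> \<epsilon> * l2norm f"
    unfolding is_indicator_calc_def spec_iff by meson
  show ?thesis
  proof (rule that[of "real_poly n a"])
    fix t assume t: "t \<in> spectral_set"
    have "poly (real_poly n a) (complex_of_real t) - (if t < lam then 1 else 0)
        = complex_of_real ((\<Sum>k\<le>n. a k * t ^ k) - (if t < lam then 1 else 0))"
      unfolding real_poly(2) by simp
    then show "cmod (poly (real_poly n a) (complex_of_real t) - (if t < lam then 1 else 0)) \<le> \<epsilon>"
      using a(1)[OF t] by (simp only: norm_of_real)
  qed (use a(2) in \<open>simp_all add: real_poly\<close>)
qed

text \<open>Justifies \<open>THE\<close> in \<open>spec_proj\<close>. The polynomials approximating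
  \<open>P\<close> and \<open>Q\<close> are within e/2 of each other on the spectrum, hence as
  operators by \<open>spectral_bound\<close>; e/4 is left for each of the two
  approximations.\<close>

lemma is_indicator_calc_unique:
  assumes P: "is_indicator_calc H lam P" and Q: "is_indicator_calc H lam Q"
  shows "P = Q"
proof (intro ext)
  fix i j
  have "cmod (P i j - Q i j) \<le> 0"
  proof (rule field_le_epsilon)
    fix e :: real assume e: "0 < e"
    obtain p where p: "real_coeffs p"
      "\<And>t. t \<in> spectral_set \<Longrightarrow> cmod (poly p (complex_of_real t) - (if t < lam then 1 else 0)) \<le> e / 4"
      "\<And>f. f \<in> l2 \<Longrightarrow> l2norm (\<lambda>i. kapply P f i - op_poly (kapply H) p f i) \<le> e / 4 * l2norm f"
      using is_indicator_calcD[OF P, of "e / 4"] e by auto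
    obtain q where q: "real_coeffs q"
      "\<And>t. t \<in> spectral_set \<Longrightarrow> cmod (poly q (complex_of_real t) - (if t < lam then 1 else 0)) \<le> e / 4"
      "\<And>f. f \<in> l2 \<Longrightarrow> l2norm (\<lambda>i. kapply Q f i - op_poly (kapply H) q f i) \<le> e / 4 * l2norm f"
      using is_indicator_calcD[OF Q, of "e / 4"] e by auto
    define f where "f = (unit_fn j :: 'd idx \<Rightarrow> complex)"
    have f: "f \<in> l2" by (simp add: f_def)
    have Pf: "kapply P f \<in> l2" "kapply Q f \<in> l2"
      using P Q f unfolding is_indicator_calc_def bounded_kernel_def by blast+
    have "l2norm (op_poly (kapply H) (p - q) f) \<le> e / 2 * l2norm f"
    proof (rule spectral_bound[OF _ _ f])
      show "real_coeffs (p - q)" using p q by auto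
      fix t assume t: "t \<in> spectral_set"
      show "cmod (poly (p - q) (complex_of_real t)) \<le> e / 2"
        using norm_triangle_ineq4[of "poly p (complex_of_real t) - (if t < lam then 1 else 0)"
            "poly q (complex_of_real t) - (if t < lam then 1 else 0)"] p(2)[OF t] q(2)[OF t] by simp
    qed
    then have 1: "l2norm (\<lambda>i. op_poly (kapply H) p f i - op_poly (kapply H) q f i) \<le> e / 2"
      by (simp add: op_poly_diff f_def)
    have 2: "l2norm (\<lambda>i. kapply P f i - op_poly (kapply H) p f i) \<le> e / 4"
      "l2norm (\<lambda>i. op_poly (kapply H) q f i - kapply Q f i) \<le> e / 4"
      using p(3)[OF f] q(3)[OF f] by (simp_all add: f_def l2norm_minus_commute[of "op_poly (kapply H) q _"])
    have "cmod (P i j - Q i j) \<le> l2norm (\<lambda>i. kapply P f i - kapply Q f i)"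
      using cmod_le_l2norm[OF l2_diff[OF Pf], of i] by (simp add: f_def kapply_unit_fn)
    also have "\<dots> \<le> l2norm (\<lambda>i. kapply P f i - op_poly (kapply H) p f i)
        + l2norm (\<lambda>i. op_poly (kapply H) p f i - kapply Q f i)"
      by (rule l2norm_triangle_3[OF Pf(1) op_poly_l2[OF f] Pf(2)])
    also have "l2norm (\<lambda>i. op_poly (kapply H) p f i - kapply Q f i)
      \<le> l2norm (\<lambda>i. op_poly (kapply H) p f i - op_poly (kapply H) q f i)
        + l2norm (\<lambda>i. op_poly (kapply H) q f i - kapply Q f i)"
      by (rule l2norm_triangle_3[OF op_poly_l2[OF f] op_poly_l2[OF f] Pf(2)])
    finally show "cmod (P i j - Q i j) \<le> 0 + e" using 1 2 by linarith
  qed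
  then show "P i j = Q i j" by simp
qed

end

section \<open>The spectral projection as a decaying idempotent kernel\<close>

context spectral_gap begin

text \<open>This is (1 - sgn(H - lam)) / 2; the value of sgn at 0 never matters, because
  \<open>lam\<close> is not spectral.\<close>

definition proj :: "'d kernel" where
  "proj = (\<lambda>i j. 1/2 * ((if i = j then 1 else 0) - kseries H (gap_series sgn_coeff lam M) i j))"

definition proj_poly :: "nat \<Rightarrow> complex poly" where
  "proj_poly n = [:1/2:] - smult (1/2) (sign.partial n)"

definition proj_error :: "nat \<Rightarrow> real" where
  "proj_error n = gap_ratio ^ n / (1 - gap_ratio) / 2"

lemma proj_decays: "decays sign.rate (1 + sign.tail_const) proj"
  unfolding decays_def
proof (intro allI)
  fix i j
  have "cmod (proj i j) \<le> 1/2 * (cmod (if i = j then 1 else 0) + cmod (kseries H (gap_series sgn_coeff lam M) i j))"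
    unfolding proj_def norm_mult by (intro mult_mono norm_triangle_ineq4) auto
  also have "\<dots> \<le> 1/2 * (1 * exp (- sign.rate * idist i j) + sign.tail_const * exp (- sign.rate * idist i j))"
    by (intro mult_left_mono add_mono decaysD[OF sign.kseries_decays] decaysD[OF decays_id]) simp
  also have "\<dots> \<le> (1 + sign.tail_const) * exp (- sign.rate * idist i j)"
  proof -
    have "0 \<le> (1 + sign.tail_const) * exp (- sign.rate * idist i j)"
      using sign.tail_const_nonneg by simp
    moreover have "1/2 * (1 * e + x * e) \<le> (1 + x) * e" if "0 \<le> (1 + x) * e" for e x :: real
      using that by (simp add: algebra_simps)
    ultimately show ?thesis by blast
  qed
  finally show "cmod (proj i j) \<le> (1 + sign.tail_const) * exp (- sign.rate * idist i j)" .
qed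

lemma proj_l2: "f \<in> l2 \<Longrightarrow> kapply proj f \<in> l2"
  by (rule decays_l2[OF proj_decays sign.rate_pos])

lemma kapply_proj:
  assumes f: "f \<in> l2"
  shows "kapply proj f = (\<lambda>i. 1/2 * (f i - kapply (kseries H (gap_series sgn_coeff lam M)) f i))"
proof
  fix i
  let ?S = "kseries H (gap_series sgn_coeff lam M)"
  have s: "(\<lambda>j. (if i = j then 1 else 0) * f j) summable_on UNIV" "(\<lambda>j. ?S i j * f j) summable_on UNIV"
    by (rule decays_summable_l2[OF decays_id zero_less_one f], rule decays_summable_l2[OF sign.kseries_decays sign.rate_pos f])
  have "kapply proj f i = infsum (\<lambda>j. 1/2 * ((if i = j then 1 else 0) * f j + - (?S i j * f j))) UNIV"
    unfolding kapply_def proj_def by (simp only: mult.assoc distrib_right mult_minus_left diff_conv_add_uminus)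
  also have "\<dots> = 1/2 * (infsum (\<lambda>j. (if i = j then 1 else 0) * f j) UNIV + infsum (\<lambda>j. - (?S i j * f j)) UNIV)"
    unfolding infsum_cmult_right' by (subst infsum_add[OF s(1)]) (use s(2) in \<open>simp_all add: summable_on_uminus\<close>)
  also have "infsum (\<lambda>j. (if i = j then 1 else 0) * f j) UNIV = f i"
    using fun_cong[OF kapply_id[of f], of i] by (simp only: kapply_def)
  finally show "kapply proj f i = 1/2 * (f i - kapply ?S f i)"
    by (simp only: infsum_uminus diff_conv_add_uminus kapply_def[of ?S])
qed

lemma proj_poly_real: "real_coeffs (proj_poly n)"
  unfolding proj_poly_def using sign.partial_real by (intro real_coeffs_ops) auto

lemma proj_approx_eq:
  assumes f: "f \<in> l2"
  shows "l2norm (\<lambda>i. kapply proj f i - op_poly (kapply H) (proj_poly n) f i)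
    = 1/2 * l2norm (\<lambda>i. kapply (kseries H (gap_series sgn_coeff lam M)) f i - op_poly (kapply H) (sign.partial n) f i)"
proof -
  let ?S = "kapply (kseries H (gap_series sgn_coeff lam M)) f" and ?T = "op_poly (kapply H) (sign.partial n) f"
  have "(\<lambda>i. kapply proj f i - op_poly (kapply H) (proj_poly n) f i) = (\<lambda>i. - 1/2 * (?S i - ?T i))"
    unfolding kapply_proj[OF f] proj_poly_def op_poly_diff op_poly_smult op_poly_const[OF f]
    by (simp add: algebra_simps)
  then show ?thesis using l2norm_scale[OF l2_diff[OF sign.kseries_l2[OF f] op_poly_l2[OF f]], of "-1/2" "sign.partial n"]
    by (simp only:) (simp add: norm_divide)
qed

lemma proj_approx_tendsto:
  assumes f: "f \<in> l2"
  shows "(\<lambda>n. l2norm (\<lambda>i. kapply proj f i - op_poly (kapply H) (proj_poly n) f i)) \<longlonglongrightarrow> 0"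
  unfolding proj_approx_eq[OF f] by (rule tendsto_mult_right_zero[OF sign.kseries_approx_tendsto[OF f]])

lemma proj_poly_error:
  assumes t: "t \<in> spectral_set"
  shows "cmod (poly (proj_poly n) (complex_of_real t) - (if t < lam then 1 else 0)) \<le> proj_error n"
proof -
  have tl: "t \<noteq> lam" using gap t by blast
  have "poly (proj_poly n) (complex_of_real t) - (if t < lam then 1 else 0)
    = - 1/2 * (poly (sign.partial n) (complex_of_real t) - complex_of_real (sgn (t - lam)))"
    using tl by (auto simp: proj_poly_def sgn_if algebra_simps)
  then have eq: "cmod (poly (proj_poly n) (complex_of_real t) - (if t < lam then 1 else 0))
    = 1/2 * cmod (poly (sign.partial n) (complex_of_real t) - complex_of_real (sgn (t - lam)))"
    by (simp only: norm_mult) (simp add: norm_divide)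
  show ?thesis unfolding eq proj_error_def using mult_left_mono[OF sign_error[OF t, of n], of "1/2"] by (simp add: mult.commute)
qed

lemma proj_error_tendsto: "proj_error \<longlonglongrightarrow> 0"
proof -
  have "(\<lambda>n. gap_ratio ^ n * (1 / (1 - gap_ratio) / 2)) \<longlonglongrightarrow> 0"
    by (rule tendsto_mult_left_zero[OF gap_ratio_power_tendsto])
  then show ?thesis by (simp add: proj_error_def[abs_def])
qed

lemma proj_error_bounds: "0 \<le> proj_error n" "proj_error n \<le> proj_error 0"
proof -
  have "gap_ratio ^ n \<le> 1" using gap_ratio by (intro power_le_one) auto
  then show "0 \<le> proj_error n" "proj_error n \<le> proj_error 0"
    using gap_ratio by (auto simp: proj_error_def divide_right_mono)
qed

lemma is_indicator_calc_proj: "is_indicator_calc H lam proj"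
  unfolding is_indicator_calc_def
proof (intro conjI allI impI)
  show "bounded_kernel proj" by (rule decays_bounded_kernel[OF proj_decays sign.rate_pos])
  fix \<epsilon> :: real assume e: "0 < \<epsilon>"
  define Z where "Z = 1/2 * (sign.tail_const * exp_sum sign.rate (undefined :: 'd idx))"
  have "(\<lambda>n. Z * sqrt gap_ratio ^ n) \<longlonglongrightarrow> 0"
    using sign.sqrt_q by (intro tendsto_mult_right_zero LIMSEQ_realpow_zero) auto
  then have "\<forall>\<^sub>F n in sequentially. Z * sqrt gap_ratio ^ n < \<epsilon>" using e by (rule order_tendstoD)
  moreover have "\<forall>\<^sub>F n in sequentially. proj_error n < \<epsilon>" using proj_error_tendsto e by (rule order_tendstoD)
  ultimately have "\<forall>\<^sub>F n in sequentially. Z * sqrt gap_ratio ^ n < \<epsilon> \<and> proj_error n < \<epsilon>" by (rule eventually_conj)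
  then obtain n where n: "Z * sqrt gap_ratio ^ n < \<epsilon>" "proj_error n < \<epsilon>"
    using eventually_happens'[OF sequentially_bot] by blast
  define p where "p = proj_poly n"
  define a where "a k = Re (coeff p k)" for k
  have a: "complex_of_real (a k) = coeff p k" for k
    using proj_poly_real[of n] by (simp add: a_def p_def real_coeffs_def)
  show "\<exists>(n::nat) (c::nat \<Rightarrow> real).
      (\<forall>t. complex_of_real t \<in> spec H \<longrightarrow> \<bar>(\<Sum>k\<le>n. c k * t ^ k) - (if t < lam then 1 else 0)\<bar> \<le> \<epsilon>) \<and>
      (\<forall>f\<in>l2. l2norm (\<lambda>i. kapply proj f i - (\<Sum>k\<le>n. complex_of_real (c k) * ((kapply H ^^ k) f) i)) \<le> \<epsilon> * l2norm f)"
  proof (rule exI[of _ "degree p"], rule exI[of _ a], intro conjI allI impI ballI)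
    fix t assume "complex_of_real t \<in> spec H"
    then have t: "t \<in> spectral_set" by (simp add: spec_iff)
    have "complex_of_real ((\<Sum>k\<le>degree p. a k * t ^ k) - (if t < lam then 1 else 0))
        = poly p (complex_of_real t) - (if t < lam then 1 else 0)"
      by (simp add: poly_altdef a)
    then show "\<bar>(\<Sum>k\<le>degree p. a k * t ^ k) - (if t < lam then 1 else 0)\<bar> \<le> \<epsilon>"
      using proj_poly_error[OF t, of n] n(2) unfolding p_def[symmetric]
      by (metis norm_of_real order_trans less_imp_le)
  next
    fix f :: "'d idx \<Rightarrow> complex" assume f: "f \<in> l2"
    have "l2norm (\<lambda>i. kapply proj f i - op_poly (kapply H) p f i) \<le> Z * sqrt gap_ratio ^ n * l2norm f"
      unfolding p_def proj_approx_eq[OF f] using sign.kseries_approx[OF f, of n] by (simp add: Z_def mult_ac)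
    also have "\<dots> \<le> \<epsilon> * l2norm f" using n(1) by (intro mult_right_mono) auto
    finally show "l2norm (\<lambda>i. kapply proj f i - (\<Sum>k\<le>degree p. complex_of_real (a k) * ((kapply H ^^ k) f) i)) \<le> \<epsilon> * l2norm f"
      by (simp only: op_poly_def a)
  qed
qed

lemma spec_proj_eq: "spec_proj H lam = proj"
  unfolding spec_proj_def
  by (rule the_equality, rule is_indicator_calc_proj, erule is_indicator_calc_unique[OF _ is_indicator_calc_proj])

text \<open>Both sides are limits of the squared approximants applied to \<open>f\<close>: the left
  one because the approximants are uniformly bounded on the spectrum, the right one because their
  values there approach 0 or 1, so that squaring changes little.\<close>

lemma kapply_proj_idem:
  assumes f: "f \<in> l2" shows "kapply proj (kapply proj f) = kapply proj f"
proof (rule l2norm_limit_unique[OF proj_l2[OF proj_l2[OF f]] proj_l2[OF f]])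
  define g where "g = kapply proj f"
  \<comment> \<open>A bound on the spectrum for all approximants at once: the indicator is at most 1
    and \<open>proj_error\<close> is largest at 0.\<close>
  define B where "B = 1 + proj_error 0"
  have g: "g \<in> l2" unfolding g_def by (rule proj_l2[OF f])
  let ?p = "\<lambda>n. op_poly (kapply H) (proj_poly n)"
  show "op_poly (kapply H) (proj_poly n * proj_poly n) f \<in> l2" for n by (rule op_poly_l2[OF f])
  have pB: "cmod (poly (proj_poly n) (complex_of_real t)) \<le> B" if t: "t \<in> spectral_set" for n t
    using norm_triangle_ineq4[of "poly (proj_poly n) (complex_of_real t) - (if t < lam then 1 else 0)" "- (if t < lam then 1 else 0)"]
      proj_poly_error[OF t, of n] proj_error_bounds(2)[of n] by (auto simp: B_def split: if_splits)
  have lim: "(\<lambda>n. l2norm (\<lambda>i. g i - ?p n f i)) \<longlonglongrightarrow> 0" "(\<lambda>n. l2norm (\<lambda>i. kapply proj g i - ?p n g i)) \<longlonglongrightarrow> 0"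
    using proj_approx_tendsto[OF f] proj_approx_tendsto[OF g] by (simp_all add: g_def)
  show "(\<lambda>n. l2norm (\<lambda>i. kapply proj (kapply proj f) i - op_poly (kapply H) (proj_poly n * proj_poly n) f i)) \<longlonglongrightarrow> 0"
  proof (rule tendsto_sandwich[OF _ _ tendsto_const])
    show "(\<lambda>n. l2norm (\<lambda>i. kapply proj g i - ?p n g i) + B * l2norm (\<lambda>i. g i - ?p n f i)) \<longlonglongrightarrow> 0"
      by (rule tendsto_add_zero[OF lim(2) tendsto_mult_right_zero[OF lim(1)]])
    have "l2norm (\<lambda>i. kapply proj g i - ?p n (?p n f) i)
      \<le> l2norm (\<lambda>i. kapply proj g i - ?p n g i) + B * l2norm (\<lambda>i. g i - ?p n f i)" for n
    proof -
      have "l2norm (\<lambda>i. ?p n g i - ?p n (?p n f) i) \<le> B * l2norm (\<lambda>i. g i - ?p n f i)"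
        unfolding op_poly_vec_diff[OF g op_poly_l2[OF f], symmetric]
        by (rule spectral_bound[OF proj_poly_real pB l2_diff[OF g op_poly_l2[OF f]]])
      then show ?thesis
        using l2norm_triangle_3[OF proj_l2[OF g] op_poly_l2[OF g] op_poly_l2[OF op_poly_l2[OF f]],
            of "proj_poly n" "proj_poly n" "proj_poly n"] by linarith
    qed
    then show "\<forall>\<^sub>F n in sequentially. l2norm (\<lambda>i. kapply proj (kapply proj f) i - op_poly (kapply H) (proj_poly n * proj_poly n) f i)
      \<le> l2norm (\<lambda>i. kapply proj g i - ?p n g i) + B * l2norm (\<lambda>i. g i - ?p n f i)"
      by (simp add: op_poly_mult[OF f] g_def)
  qed simp
  show "(\<lambda>n. l2norm (\<lambda>i. kapply proj f i - op_poly (kapply H) (proj_poly n * proj_poly n) f i)) \<longlonglongrightarrow> 0"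
  proof (rule tendsto_sandwich[OF _ _ tendsto_const])
    show "(\<lambda>n. l2norm (\<lambda>i. g i - ?p n f i) + proj_error n * (2 + B) * l2norm f) \<longlonglongrightarrow> 0"
      by (intro tendsto_add_zero lim(1) tendsto_mult_left_zero proj_error_tendsto)
    have "l2norm (\<lambda>i. g i - op_poly (kapply H) (proj_poly n * proj_poly n) f i)
      \<le> l2norm (\<lambda>i. g i - ?p n f i) + proj_error n * (2 + B) * l2norm f" for n
    proof -
      have "l2norm (op_poly (kapply H) (proj_poly n - proj_poly n * proj_poly n) f) \<le> proj_error n * (2 + B) * l2norm f"
      proof (rule spectral_bound[OF _ _ f])
        show "real_coeffs (proj_poly n - proj_poly n * proj_poly n)" by (intro real_coeffs_ops proj_poly_real)
        fix t assume t: "t \<in> spectral_set"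
        define x y :: complex where "x = poly (proj_poly n) (complex_of_real t)" and "y = (if t < lam then 1 else 0)"
        have y: "y * y = y" "cmod y \<le> 1" by (auto simp: y_def)
        \<comment> \<open>Subtracting y - y^2 = 0 exposes the small factor x - y.\<close>
        have "x - x * x = (x - y) * (1 - (x + y))" using y(1) by (simp add: algebra_simps)
        moreover have "cmod (x - y) \<le> proj_error n" using proj_poly_error[OF t] by (simp add: x_def y_def)
        moreover have "cmod (1 - (x + y)) \<le> 2 + B"
          using norm_triangle_ineq4[of 1 "x + y"] norm_triangle_ineq[of x y] pB[OF t, of n] y(2)
          by (simp add: x_def)
        ultimately show "cmod (poly (proj_poly n - proj_poly n * proj_poly n) (complex_of_real t)) \<le> proj_error n * (2 + B)"
          using proj_error_bounds(1)[of n] by (simp add: x_def[symmetric] norm_mult mult_mono)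
      qed
      then show ?thesis
        using l2norm_triangle_3[OF g op_poly_l2[OF f] op_poly_l2[OF f], of "proj_poly n * proj_poly n" "proj_poly n"]
          l2norm_minus_commute[of "op_poly (kapply H) (proj_poly n) f"]
        by (simp add: op_poly_diff)
    qed
    then show "\<forall>\<^sub>F n in sequentially. l2norm (\<lambda>i. kapply proj f i - op_poly (kapply H) (proj_poly n * proj_poly n) f i)
      \<le> l2norm (\<lambda>i. g i - ?p n f i) + proj_error n * (2 + B) * l2norm f"
      by (simp add: g_def)
  qed simp
qed

lemma proj_idem: "kcomp proj proj = proj"
proof (intro ext)
  fix i j
  have "kcomp proj proj i j = kapply proj (kapply proj (unit_fn j)) i"
    using kapply_kcomp[OF proj_decays sign.rate_pos proj_decays sign.rate_pos unit_fn_l2] kapply_unit_fn by metis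
  also have "\<dots> = proj i j" by (simp only: kapply_proj_idem[OF unit_fn_l2] kapply_unit_fn)
  finally show "kcomp proj proj i j = proj i j" .
qed

end

text \<open>No spectral point lies between two points of the interval \<open>G\<close>, so both
  thresholds cut the spectrum alike. This makes the \<open>SOME\<close> in
  \<open>conductance_on\<close> harmless.\<close>

lemma is_indicator_calc_gap_const:
  assumes "is_interval G" "\<forall>l\<in>G. complex_of_real l \<notin> spec H" "lam \<in> G" "lam' \<in> G"
  shows "is_indicator_calc H lam = is_indicator_calc H lam'"
proof -
  have "t < lam \<longleftrightarrow> t < lam'" if "complex_of_real t \<in> spec H" for t
  proof -
    have "t \<notin> G" using assms(2) that by blast
    then show ?thesis using assms(1,3,4) by (meson is_interval_1 linorder_not_less less_imp_le)
  qed
  then show ?thesis unfolding is_indicator_calc_def by (intro ext) (simp cong: conj_cong)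
qed

lemma conductance_on_eq:
  assumes "is_interval G" "\<forall>l\<in>G. complex_of_real l \<notin> spec H" "lam \<in> G"
  shows "conductance_on H G = conductance H lam"
proof -
  have "(SOME l. l \<in> G) \<in> G" using assms(3) by (rule someI)
  then show ?thesis
    using is_indicator_calc_gap_const[OF assms(1,2) _ assms(3)]
    by (simp add: conductance_on_def conductance_def spec_proj_def)
qed

section \<open>The conductance as a sum over triangles\<close>

text \<open>Half planes with a movable edge, so that \<open>half1 n\<close> and
  \<open>half2 m\<close> have their corner at (n, m); the case 0 gives \<open>Lambda1\<close> and
  \<open>Lambda2\<close>.\<close>

definition half1 :: "int \<Rightarrow> 'd idx \<Rightarrow> complex" where
  "half1 n i = (if n \<le> fst (fst i) then 1 else 0)"

definition half2 :: "int \<Rightarrow> 'd idx \<Rightarrow> complex" where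
  "half2 n i = (if n \<le> snd (fst i) then 1 else 0)"

text \<open>\<open>area a b x y z\<close> is twice the oriented area of the image of the triangle \<open>x y z\<close> under \<open>(a, b)\<close>.\<close>

definition area :: "('i \<Rightarrow> complex) \<Rightarrow> ('i \<Rightarrow> complex) \<Rightarrow> 'i \<Rightarrow> 'i \<Rightarrow> 'i \<Rightarrow> complex" where
  "area a b x y z = (a z - a y) * (b x - b z) - (b z - b y) * (a x - a z)"

definition tri :: "('i \<Rightarrow> 'i \<Rightarrow> complex) \<Rightarrow> 'i \<Rightarrow> 'i \<Rightarrow> 'i \<Rightarrow> complex" where
  "tri P x y z = P x y * P y z * P z x"

definition tri_sum :: "('i \<Rightarrow> 'i \<Rightarrow> complex) \<Rightarrow> ('i \<Rightarrow> complex) \<Rightarrow> ('i \<Rightarrow> complex) \<Rightarrow> complex" where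
  "tri_sum P a b = infsum (\<lambda>(x, y, z). tri P x y z * area a b x y z) UNIV"

lemma area_swap: "area b a x y z = - area a b x y z"
  by (simp add: area_def algebra_simps)

lemma area_diff_left: "area (\<lambda>i. a i - a' i) b x y z = area a b x y z - area a' b x y z"
  by (simp add: area_def algebra_simps)

lemma area_cyclic: "area a b x y z = a x * (b y - b z) + a y * (b z - b x) + a z * (b x - b y)"
  by (simp add: area_def algebra_simps)

lemma tri_sum_swap: "tri_sum P b a = - tri_sum P a b"
proof -
  have "tri_sum P b a = infsum (\<lambda>t. - (case t of (x, y, z) \<Rightarrow> tri P x y z * area a b x y z)) UNIV"
    unfolding tri_sum_def by (intro infsum_cong) (auto simp: area_swap[of b a])
  then show ?thesis by (simp only: infsum_uminus tri_sum_def)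
qed

text \<open>Common summable majorant of the triangle sums: \<open>x\<close> is tied to the origin,
  and \<open>y\<close> and \<open>z\<close> are tied to \<open>x\<close>.\<close>

definition tri_weight :: "real \<Rightarrow> 'd idx \<Rightarrow> 'd idx \<Rightarrow> 'd idx \<Rightarrow> real" where
  "tri_weight c x y z = exp (- c * idist ((0,0), undefined) x) * (exp (- c * idist x y) * exp (- c * idist x z))"

lemma infsum_triple:
  fixes f :: "'a \<times> 'b \<times> 'c \<Rightarrow> 'e::banach"
  assumes "f summable_on UNIV"
  shows "infsum f UNIV = infsum (\<lambda>x. infsum (\<lambda>y. infsum (\<lambda>z. f (x, y, z)) UNIV) UNIV) UNIV"
proof -
  have s: "f summable_on (UNIV \<times> UNIV)" using assms by simp
  have "infsum f UNIV = infsum (\<lambda>x. infsum (\<lambda>p. f (x, p)) UNIV) UNIV"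
    using infsum_Sigma_banach[OF s] by simp
  also have "\<dots> = infsum (\<lambda>x. infsum (\<lambda>y. infsum (\<lambda>z. f (x, y, z)) UNIV) UNIV) UNIV"
  proof (rule infsum_cong)
    fix x :: 'a
    have "f summable_on range (Pair x)" by (rule summable_on_subset_banach[OF assms]) simp
    then have "(\<lambda>p. f (x, p)) summable_on UNIV"
      by (subst (asm) summable_on_reindex) (simp_all add: o_def inj_def)
    then have "(\<lambda>p. f (x, p)) summable_on (UNIV \<times> UNIV)" by simp
    then show "infsum (\<lambda>p. f (x, p)) UNIV = infsum (\<lambda>y. infsum (\<lambda>z. f (x, y, z)) UNIV) UNIV"
      using infsum_Sigma_banach[of "\<lambda>p. f (x, p)" UNIV "\<lambda>_. UNIV"] by simp
  qed
  finally show ?thesis .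
qed

lemma tri_weight_summable:
  assumes c: "c > 0"
  shows "(\<lambda>(x, y, z). tri_weight c x y z) summable_on (UNIV :: ('d::finite idx \<times> 'd idx \<times> 'd idx) set)"
proof -
  let ?o = "((0, 0), undefined) :: 'd idx"
  define Z where "Z = exp_sum c ?o"
  have es: "infsum (\<lambda>z. exp (- c * idist x z)) UNIV = Z" for x :: "'d idx"
    unfolding Z_def by (rule infsum_exp_idist[OF c])
  have s: "(\<lambda>z. exp (- c * idist x z)) summable_on UNIV" for x :: "'d idx" by (rule summable_exp_idist[OF c])
  have yz: "(\<lambda>(y, z). exp (- c * idist x y) * exp (- c * idist x z)) summable_on UNIV \<times> UNIV"
    and yz_le: "infsum (\<lambda>y. infsum (\<lambda>z. exp (- c * idist x y) * exp (- c * idist x z)) UNIV) UNIV \<le> Z * Z" for x :: "'d idx"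
  proof -
    have g: "(\<lambda>y. exp (- c * idist x y) * Z) summable_on UNIV" by (rule summable_on_cmult_left[OF s])
    have 1: "infsum (\<lambda>z. exp (- c * idist x y) * exp (- c * idist x z)) UNIV \<le> exp (- c * idist x y) * Z" for y
      by (simp only: infsum_cmult_right' es order_refl)
    show "(\<lambda>(y, z). exp (- c * idist x y) * exp (- c * idist x z)) summable_on UNIV \<times> UNIV"
      by (rule nonneg_double_summable(1)[OF _ _ 1 g]) (simp, intro summable_on_cmult_right s)
    show "infsum (\<lambda>y. infsum (\<lambda>z. exp (- c * idist x y) * exp (- c * idist x z)) UNIV) UNIV \<le> Z * Z"
      by (simp only: infsum_cmult_right' infsum_cmult_left' es order_refl)
  qed
  have yzs: "infsum (\<lambda>p. exp (- c * idist x (fst p)) * exp (- c * idist x (snd p))) UNIV \<le> Z * Z" for x :: "'d idx"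
    using infsum_Sigma'_banach[OF yz[of x]] yz_le[of x] by (simp only: split_def UNIV_Times_UNIV)
  have "(\<lambda>(x, p). exp (- c * idist ?o x) * (exp (- c * idist x (fst p)) * exp (- c * idist x (snd p)))) summable_on UNIV \<times> UNIV"
  proof (rule nonneg_double_summable(1))
    show "(\<lambda>p. exp (- c * idist ?o x) * (exp (- c * idist x (fst p)) * exp (- c * idist x (snd p)))) summable_on UNIV" for x
      using yz[of x] by (intro summable_on_cmult_right) (simp only: split_def UNIV_Times_UNIV)
    show "infsum (\<lambda>p. exp (- c * idist ?o x) * (exp (- c * idist x (fst p)) * exp (- c * idist x (snd p)))) UNIV
        \<le> exp (- c * idist ?o x) * (Z * Z)" for x
      unfolding infsum_cmult_right' by (rule mult_left_mono[OF yzs]) simp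
    show "(\<lambda>x. exp (- c * idist ?o x) * (Z * Z)) summable_on UNIV" by (rule summable_on_cmult_left[OF s])
  qed simp
  then show ?thesis unfolding tri_weight_def by (simp only: split_def UNIV_Times_UNIV)
qed

text \<open>The support condition says that a triangle far from the origin must be large, up to the
  slack \<open>L\<close>. It trades decay of \<open>P\<close> in the size of the triangle for decay
  away from the origin.\<close>

definition localized :: "real \<Rightarrow> real \<Rightarrow> ('d idx \<Rightarrow> 'd idx \<Rightarrow> 'd idx \<Rightarrow> complex) \<Rightarrow> bool" where
  "localized B L W \<longleftrightarrow> 0 \<le> B \<and> (\<forall>x y z. cmod (W x y z) \<le> B
     \<and> (W x y z \<noteq> 0 \<longrightarrow> idist ((0,0), undefined) x \<le> L + idist x y + idist x z))"

text \<open>The factor \<open>P y z\<close> is merely bounded by \<open>C\<close>. Of the rate c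
  along the two sides at \<open>x\<close>, one half pays for the distance of \<open>x\<close> to the
  origin and the other half is kept for the sums over \<open>y\<close> and \<open>z\<close>.\<close>

lemma tri_localized_le:
  assumes P: "decays c C P" and c: "c > 0" and W: "localized B L W"
  shows "cmod (tri P x y z * W x y z) \<le> C ^ 3 * B * exp (c / 2 * L) * tri_weight (c / 2) x y z"
proof (cases "W x y z = 0")
  case True
  then show ?thesis using decays_const_nonneg[OF P] W by (simp add: localized_def tri_weight_def)
next
  case False
  define s where "s = idist x y + idist x z"
  have C: "0 \<le> C" by (rule decays_const_nonneg[OF P])
  have B: "0 \<le> B" "cmod (W x y z) \<le> B" and L: "idist ((0,0), undefined) x \<le> L + s"
    using W False by (auto simp: localized_def s_def add.assoc)
  have "cmod (P x y) * cmod (P y z) * cmod (P z x) \<le> (C * exp (- c * idist x y)) * C * (C * exp (- c * idist x z))"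
    using c C decaysD[OF P, of x y] decaysD[OF P, of z x] decays_bounded[OF P, of y z]
    by (intro mult_mono) (simp_all add: idist_commute[of z x])
  also have "\<dots> = C ^ 3 * exp (- c * s)"
    by (simp add: s_def power3_eq_cube exp_add[symmetric] algebra_simps flip: exp_add)
  finally have "cmod (tri P x y z * W x y z) \<le> C ^ 3 * exp (- c * s) * B"
    using B C by (simp add: tri_def norm_mult mult_mono)
  also have "\<dots> \<le> C ^ 3 * exp (c / 2 * L - c / 2 * (idist ((0,0), undefined) x + s)) * B"
  proof -
    have "c / 2 * idist ((0,0), undefined) x \<le> c / 2 * (L + s)" using L c by (intro mult_left_mono) auto
    then have "- c * s \<le> c / 2 * L - c / 2 * (idist ((0,0), undefined) x + s)" by (simp add: algebra_simps)
    then show ?thesis using B C by (intro mult_right_mono mult_left_mono) auto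
  qed
  also have "exp (c / 2 * L - c / 2 * (idist ((0,0), undefined) x + s)) = exp (c / 2 * L) * tri_weight (c / 2) x y z"
    unfolding tri_weight_def s_def exp_add[symmetric] by (rule arg_cong[of _ _ exp]) (simp add: algebra_simps)
  finally show ?thesis by (simp only: mult_ac)
qed

lemma tri_localized_summable:
  assumes "decays c C (P :: 'd::finite kernel)" "c > 0" "localized B L W"
  shows "(\<lambda>(x, y, z). tri P x y z * W x y z) summable_on UNIV"
proof (rule abs_summable_summable, rule Infinite_Sum.abs_summable_on_comparison_test')
  show "(\<lambda>t. C ^ 3 * B * exp (c / 2 * L) * (case t of (x, y, z) \<Rightarrow> tri_weight (c / 2) x y z))
      summable_on (UNIV :: ('d idx \<times> 'd idx \<times> 'd idx) set)"
    using assms(2) by (intro summable_on_cmult_right tri_weight_summable) simp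
  fix t :: "'d idx \<times> 'd idx \<times> 'd idx"
  obtain x y z where t: "t = (x, y, z)" by (rule prod_cases3)
  show "norm (case t of (x, y, z) \<Rightarrow> tri P x y z * W x y z)
      \<le> C ^ 3 * B * exp (c / 2 * L) * (case t of (x, y, z) \<Rightarrow> tri_weight (c / 2) x y z)"
    using tri_localized_le[OF assms, of x y z] by (simp only: t prod.case)
qed

text \<open>If an indicator differs between \<open>x\<close> and one of the other points, its edge
  passes between them, so the matching coordinate of \<open>x\<close> is at most the offset of the
  edge plus coordinate distances to \<open>y\<close> and \<open>z\<close>. The area vanishes unless
  this happens for both indicators; in the first two pieces, one coordinate of \<open>x\<close> is
  instead confined to the strip between the old edge and the new one.\<close>

lemma localized_piece:
  "localized 1 (real_of_int (\<bar>n\<bar> + \<bar>m\<bar>))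
    (\<lambda>x y z :: 'd idx. (half1 n x - half1 0 x) * (half2 m y - half2 m z))"
  "localized 1 (real_of_int (\<bar>n\<bar> + \<bar>m\<bar>))
    (\<lambda>x y z :: 'd idx. (half2 n x - half2 0 x) * (half1 m y - half1 m z))"
  "localized 2 (real_of_int (\<bar>n\<bar> + \<bar>m\<bar>)) (area (half1 n) (half2 m :: 'd idx \<Rightarrow> complex))"
  "localized 2 (real_of_int (\<bar>n\<bar> + \<bar>m\<bar>)) (area (half2 n) (half1 m :: 'd idx \<Rightarrow> complex))"
proof -
  have fs: "idist ((0,0), undefined) x \<le> real_of_int (\<bar>n\<bar> + \<bar>m\<bar>) + idist x y + idist x z"
    if "\<bar>fst (fst x)\<bar> \<le> \<bar>k\<bar> + \<bar>fst (fst x) - fst (fst y)\<bar> + \<bar>fst (fst x) - fst (fst z)\<bar>"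
      "\<bar>snd (fst x)\<bar> \<le> \<bar>l\<bar> + \<bar>snd (fst x) - snd (fst y)\<bar> + \<bar>snd (fst x) - snd (fst z)\<bar>"
      "\<bar>k\<bar> + \<bar>l\<bar> = \<bar>n\<bar> + \<bar>m\<bar>"
    for x y z :: "'d idx" and k l
  proof -
    have "\<bar>fst (fst x)\<bar> + \<bar>snd (fst x)\<bar> \<le> (\<bar>k\<bar> + \<bar>l\<bar>)
        + (\<bar>fst (fst x) - fst (fst y)\<bar> + \<bar>snd (fst x) - snd (fst y)\<bar>)
        + (\<bar>fst (fst x) - fst (fst z)\<bar> + \<bar>snd (fst x) - snd (fst z)\<bar>)"
      using add_mono[OF that(1,2)] by (simp only: add_ac)
    then show ?thesis
      unfolding that(3) idist_def l1_def of_int_add[symmetric] of_int_le_iff by simp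
  qed
  have n1: "\<bar>fst (fst x)\<bar> \<le> \<bar>k\<bar> + \<bar>fst (fst x) - fst (fst y)\<bar> + \<bar>fst (fst x) - fst (fst z)\<bar>"
    if "half1 k x \<noteq> half1 k y \<or> half1 k x \<noteq> half1 k z" for x y z :: "'d idx" and k
    using that by (auto simp: half1_def split: if_splits)
  have n2: "\<bar>snd (fst x)\<bar> \<le> \<bar>k\<bar> + \<bar>snd (fst x) - snd (fst y)\<bar> + \<bar>snd (fst x) - snd (fst z)\<bar>"
    if "half2 k x \<noteq> half2 k y \<or> half2 k x \<noteq> half2 k z" for x y z :: "'d idx" and k
    using that by (auto simp: half2_def split: if_splits)
  have w1: "\<bar>fst (fst x)\<bar> \<le> \<bar>k\<bar> + \<bar>fst (fst x) - fst (fst y)\<bar> + \<bar>fst (fst x) - fst (fst z)\<bar>"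
    if "half1 k x \<noteq> half1 0 x" for x y z :: "'d idx" and k
    using that by (auto simp: half1_def split: if_splits)
  have w2: "\<bar>snd (fst x)\<bar> \<le> \<bar>k\<bar> + \<bar>snd (fst x) - snd (fst y)\<bar> + \<bar>snd (fst x) - snd (fst z)\<bar>"
    if "half2 k x \<noteq> half2 0 x" for x y z :: "'d idx" and k
    using that by (auto simp: half2_def split: if_splits)
  have a: "(u x \<noteq> u y \<or> u x \<noteq> u z) \<and> (v x \<noteq> v y \<or> v x \<noteq> v z)" if "area u v x y z \<noteq> 0"
    for u v :: "'d idx \<Rightarrow> complex" and x y z
    using that by (auto simp: area_def)
  show "localized 1 (real_of_int (\<bar>n\<bar> + \<bar>m\<bar>)) (\<lambda>x y z :: 'd idx. (half1 n x - half1 0 x) * (half2 m y - half2 m z))"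
    unfolding localized_def
  proof (intro conjI allI impI)
    fix x y z :: "'d idx"
    show "cmod ((half1 n x - half1 0 x) * (half2 m y - half2 m z)) \<le> 1"
      by (simp add: half1_def half2_def)
    assume "(half1 n x - half1 0 x) * (half2 m y - half2 m z) \<noteq> 0"
    then have "half1 n x \<noteq> half1 0 x" "half2 m x \<noteq> half2 m y \<or> half2 m x \<noteq> half2 m z" by auto
    then show "idist ((0,0), undefined) x \<le> real_of_int (\<bar>n\<bar> + \<bar>m\<bar>) + idist x y + idist x z"
      by (intro fs[OF w1 n2 refl])
  qed simp
  show "localized 1 (real_of_int (\<bar>n\<bar> + \<bar>m\<bar>)) (\<lambda>x y z :: 'd idx. (half2 n x - half2 0 x) * (half1 m y - half1 m z))"
    unfolding localized_def
  proof (intro conjI allI impI)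
    fix x y z :: "'d idx"
    show "cmod ((half2 n x - half2 0 x) * (half1 m y - half1 m z)) \<le> 1"
      by (simp add: half1_def half2_def)
    assume "(half2 n x - half2 0 x) * (half1 m y - half1 m z) \<noteq> 0"
    then have "half2 n x \<noteq> half2 0 x" "half1 m x \<noteq> half1 m y \<or> half1 m x \<noteq> half1 m z" by auto
    then show "idist ((0,0), undefined) x \<le> real_of_int (\<bar>n\<bar> + \<bar>m\<bar>) + idist x y + idist x z"
      by (intro fs[OF n1 w2 add.commute])
  qed simp
  show "localized 2 (real_of_int (\<bar>n\<bar> + \<bar>m\<bar>)) (area (half1 n) (half2 m :: 'd idx \<Rightarrow> complex))"
    unfolding localized_def
  proof (intro conjI allI impI)
    fix x y z :: "'d idx"
    show "cmod (area (half1 n) (half2 m) x y z) \<le> 2" by (simp add: area_def half1_def half2_def)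
    assume "area (half1 n) (half2 m) x y z \<noteq> 0"
    from a[OF this] show "idist ((0,0), undefined) x \<le> real_of_int (\<bar>n\<bar> + \<bar>m\<bar>) + idist x y + idist x z"
      by (intro fs[OF n1 n2 refl]) auto
  qed simp
  show "localized 2 (real_of_int (\<bar>n\<bar> + \<bar>m\<bar>)) (area (half2 n) (half1 m :: 'd idx \<Rightarrow> complex))"
    unfolding localized_def
  proof (intro conjI allI impI)
    fix x y z :: "'d idx"
    show "cmod (area (half2 n) (half1 m) x y z) \<le> 2" by (simp add: area_def half1_def half2_def)
    assume "area (half2 n) (half1 m) x y z \<noteq> 0"
    from a[OF this] show "idist ((0,0), undefined) x \<le> real_of_int (\<bar>n\<bar> + \<bar>m\<bar>) + idist x y + idist x z"
      by (intro fs[OF n1 n2 add.commute]) auto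
  qed simp
qed

section \<open>The trace formula and its invariance under moving the corner\<close>

lemma kcomp_diag:
  "kcomp P (\<lambda>i j. if i = j \<and> Q i then 1 else 0) = (\<lambda>i j. P i j * (if Q j then 1 else 0))"
  "kcomp (\<lambda>i j. if i = j \<and> Q i then 1 else 0) P = (\<lambda>i j. (if Q i then 1 else 0) * P i j)"
proof -
  show "kcomp P (\<lambda>i j. if i = j \<and> Q i then 1 else 0) = (\<lambda>i j. P i j * (if Q j then 1 else 0))"
  proof (intro ext)
    fix i j
    have "infsum (\<lambda>k. P i k * (if k = j \<and> Q k then 1 else 0)) UNIV = infsum (\<lambda>k. P i k * (if k = j \<and> Q k then 1 else 0)) {j}"
      by (rule infsum_cong_neutral) auto
    then show "kcomp P (\<lambda>i j. if i = j \<and> Q i then 1 else 0) i j = P i j * (if Q j then 1 else 0)"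
      by (simp add: kcomp_def)
  qed
  show "kcomp (\<lambda>i j. if i = j \<and> Q i then 1 else 0) P = (\<lambda>i j. (if Q i then 1 else 0) * P i j)"
  proof (intro ext)
    fix i j
    have "infsum (\<lambda>k. (if i = k \<and> Q i then 1 else 0) * P k j) UNIV = infsum (\<lambda>k. (if i = k \<and> Q i then 1 else 0) * P k j) {i}"
      by (rule infsum_cong_neutral) auto
    then show "kcomp (\<lambda>i j. if i = j \<and> Q i then 1 else 0) P i j = (if Q i then 1 else 0) * P i j"
      by (simp add: kcomp_def)
  qed
qed

lemma kcommut_Lambda:
  "kcommut P Lambda1 = (\<lambda>i j. P i j * (half1 0 j - half1 0 i))"
  "kcommut P Lambda2 = (\<lambda>i j. P i j * (half2 0 j - half2 0 i))"
  unfolding kcommut_def Lambda1_def Lambda2_def kcomp_diag half1_def half2_def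
  by (auto simp: algebra_simps)

lemma half_norm: "cmod (half1 n i) \<le> 1" "cmod (half2 n i) \<le> 1"
  by (simp_all add: half1_def half2_def)

lemma half_le: "cmod (half1 n i - half1 n j) \<le> 1" "cmod (half2 n i - half2 n j) \<le> 1"
  by (simp_all add: half1_def half2_def)

lemma decays_kcomp_summable:
  assumes "decays c C (P :: 'd::finite kernel)" "decays c C' Q" "c > 0"
  shows "(\<lambda>l. P i l * Q l j) summable_on UNIV"
  by (rule abs_summable_summable)
    (rule decays_kcomp(2)[where c = "c/2", OF _ decays_mono[OF assms(2)]], use assms in auto)

lemma decays_mult_bounded:
  assumes "decays c C P" "\<And>i j. cmod (h i j) \<le> 1" shows "decays c C (\<lambda>i j. P i j * h i j)"
  unfolding decays_def
proof (intro allI)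
  fix i j
  have "cmod (P i j * h i j) \<le> cmod (P i j) * 1" unfolding norm_mult by (intro mult_left_mono assms) auto
  then show "cmod (P i j * h i j) \<le> C * exp (- c * idist i j)" using decaysD[OF assms(1), of i j] by simp
qed

text \<open>Expanding the commutators gives the triangle summand with \<open>x\<close> as trace
  index; the real content is the summability that lets the iterated sums be collected into one sum
  over triples.\<close>

lemma ktrace_eq_tri_sum:
  assumes P: "decays c C (P :: 'd::finite kernel)" and c: "c > 0"
  shows "ktrace (kcomp P (kcommut (kcommut P Lambda1) (kcommut P Lambda2))) = tri_sum P (half1 0) (half2 0)"
proof -
  let ?a = "half1 0 :: 'd idx \<Rightarrow> complex" and ?b = "half2 0 :: 'd idx \<Rightarrow> complex"
  have d: "decays c C (\<lambda>i j. P i j * (?a j - ?a i))" "decays c C (\<lambda>i j. P i j * (?b j - ?b i))"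
    by (rule decays_mult_bounded[OF P half_le(1)], rule decays_mult_bounded[OF P half_le(2)])
  have K: "kcommut (kcommut P Lambda1) (kcommut P Lambda2) y x
      = infsum (\<lambda>z. P y z * P z x * area ?a ?b x y z) UNIV" for x y
  proof -
    have "kcommut (kcommut P Lambda1) (kcommut P Lambda2) y x
      = infsum (\<lambda>z. P y z * (?a z - ?a y) * (P z x * (?b x - ?b z))) UNIV
        + - infsum (\<lambda>z. P y z * (?b z - ?b y) * (P z x * (?a x - ?a z))) UNIV"
      unfolding kcommut_Lambda unfolding kcommut_def kcomp_def by simp
    also have "\<dots> = infsum (\<lambda>z. P y z * (?a z - ?a y) * (P z x * (?b x - ?b z))
        + - (P y z * (?b z - ?b y) * (P z x * (?a x - ?a z)))) UNIV"
      unfolding infsum_uminus[symmetric]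
      by (intro infsum_add[symmetric] summable_on_uminus[THEN iffD2] decays_kcomp_summable[OF d c] decays_kcomp_summable[OF d(2,1) c])
    also have "\<dots> = infsum (\<lambda>z. P y z * P z x * area ?a ?b x y z) UNIV"
      by (simp only: area_def) (simp add: algebra_simps)
    finally show ?thesis .
  qed
  have s: "(\<lambda>(x, y, z). tri P x y z * area ?a ?b x y z) summable_on UNIV"
    by (rule tri_localized_summable[OF P c localized_piece(3)])
  have "tri_sum P ?a ?b = infsum (\<lambda>x. infsum (\<lambda>y. infsum (\<lambda>z. P x y * (P y z * P z x * area ?a ?b x y z)) UNIV) UNIV) UNIV"
    unfolding tri_sum_def infsum_triple[OF s] by (simp only: prod.case tri_def mult.assoc)
  also have "\<dots> = ktrace (kcomp P (kcommut (kcommut P Lambda1) (kcommut P Lambda2)))"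
    unfolding ktrace_def kcomp_def[of P "kcommut _ _"] K infsum_cmult_right' ..
  finally show ?thesis ..
qed

text \<open>For fixed \<open>x\<close>, the \<open>b y\<close> term is summed over \<open>z\<close>
  first and the \<open>b z\<close> term over \<open>y\<close> first. By idempotence both collapse to
  the diagonal entry of P b P at \<open>x\<close>, so they cancel.\<close>

lemma tri_sum_zero_piece:
  assumes P: "decays c C (P :: 'd::finite kernel)" and c: "c > 0" and idem: "kcomp P P = P"
    and b: "\<And>i. cmod (b i) \<le> 1"
    and s: "(\<lambda>(x, y, z). tri P x y z * (w x * (b y - b z))) summable_on UNIV"
  shows "infsum (\<lambda>(x, y, z). tri P x y z * (w x * (b y - b z))) UNIV = 0"
proof -
  have id: "infsum (\<lambda>k. P i k * P k j) UNIV = P i j" for i j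
    using fun_cong[OF fun_cong[OF idem, of i], of j] by (simp only: kcomp_def)
  have Pb: "decays c C (\<lambda>i j. P i j * b j)" "decays c C (\<lambda>i j. b i * P i j)"
    using decays_mult_bounded[OF P, of "\<lambda>i j. b j"] decays_mult_bounded[OF P, of "\<lambda>i j. b i"] b
    by (simp_all add: mult.commute)
  have P2: "decays (2 * (c/2)) C P" "decays (c/2) C P" using P decays_mono[OF P, of "c/2" C] c by simp_all
  have inner: "infsum (\<lambda>y. infsum (\<lambda>z. P x y * P y z * P z x * (b y - b z)) UNIV) UNIV = 0" for x
  proof -
    have i1: "infsum (\<lambda>z. P x y * P y z * P z x * (b y - b z)) UNIV
        = P x y * b y * P y x - infsum (\<lambda>z. P x y * (P y z * (b z * P z x))) UNIV" for y
    proof -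
      have "infsum (\<lambda>z. P x y * P y z * P z x * (b y - b z)) UNIV
        = infsum (\<lambda>z. P x y * b y * (P y z * P z x) + - (P x y * (P y z * (b z * P z x)))) UNIV"
        by (simp add: algebra_simps)
      also have "\<dots> = infsum (\<lambda>z. P x y * b y * (P y z * P z x)) UNIV + infsum (\<lambda>z. - (P x y * (P y z * (b z * P z x)))) UNIV"
        by (intro infsum_add summable_on_uminus[THEN iffD2] summable_on_cmult_right decays_kcomp_summable[OF P P c]
            decays_kcomp_summable[OF P Pb(2) c])
      finally show ?thesis by (simp add: infsum_cmult_right' id infsum_uminus)
    qed
    have s1: "(\<lambda>y. P x y * b y * P y x) summable_on UNIV"
      by (rule decays_kcomp_summable[OF Pb(1) P c])
    have bd: "cmod (P x y * (P y z * (b z * P z x))) \<le> cmod (P x y) * (C * cmod (P z x))" for y z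
    proof -
      have "cmod (P y z) * (cmod (b z) * cmod (P z x)) \<le> C * (1 * cmod (P z x))"
        using c by (intro mult_mono decays_bounded[OF P] b) (auto simp: decays_const_nonneg[OF P])
      then show ?thesis by (simp add: norm_mult mult_left_mono)
    qed
    have col: "(\<lambda>z. cmod (P z x)) summable_on UNIV" "infsum (\<lambda>z. cmod (P z x)) UNIV \<le> C * exp_sum c x"
      using decays_row_summable[OF decays_swap[OF P] c, of x] by auto
    have colC: "infsum (\<lambda>z. cmod (P x y) * (C * cmod (P z x))) UNIV \<le> cmod (P x y) * (C * (C * exp_sum c x))" for y
      unfolding infsum_cmult_right' using col(2) decays_const_nonneg[OF P] by (intro mult_left_mono) auto
    have colS: "(\<lambda>z. cmod (P x y) * (C * cmod (P z x))) summable_on UNIV" for y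
      by (intro summable_on_cmult_right col(1))
    have rowS: "(\<lambda>y. cmod (P x y) * (C * (C * exp_sum c x))) summable_on UNIV"
      by (intro summable_on_cmult_left decays_row_summable(1)[OF P c])
    have "infsum (\<lambda>y. infsum (\<lambda>z. P x y * (P y z * (b z * P z x))) UNIV) UNIV
        = infsum (\<lambda>z. infsum (\<lambda>y. P x y * (P y z * (b z * P z x))) UNIV) UNIV"
      by (rule infsum_swap_dominated[OF bd colS colC rowS])
    also have "\<dots> = infsum (\<lambda>z. P x z * b z * P z x) UNIV"
      using id by (simp only: mult.assoc[symmetric] infsum_cmult_left')
    finally have sw: "infsum (\<lambda>y. infsum (\<lambda>z. P x y * (P y z * (b z * P z x))) UNIV) UNIV = infsum (\<lambda>z. P x z * b z * P z x) UNIV" .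
    have s2: "(\<lambda>y. infsum (\<lambda>z. P x y * (P y z * (b z * P z x))) UNIV) summable_on UNIV"
    proof -
      have "decays (c/2) (C * C * exp_sum (c/2) x) (kcomp P (\<lambda>i j. b i * P i j))"
        by (rule decays_kcomp(1)[OF P2(1) decays_mono[OF Pb(2)]]) (use c in auto)
      from decays_kcomp_summable[OF P2(2) this, of x x] c
      show ?thesis by (simp add: kcomp_def infsum_cmult_right')
    qed
    have "infsum (\<lambda>y. infsum (\<lambda>z. P x y * P y z * P z x * (b y - b z)) UNIV) UNIV
        = infsum (\<lambda>y. P x y * b y * P y x + - infsum (\<lambda>z. P x y * (P y z * (b z * P z x))) UNIV) UNIV"
      unfolding i1 by simp
    also have "\<dots> = infsum (\<lambda>y. P x y * b y * P y x) UNIV + infsum (\<lambda>y. - infsum (\<lambda>z. P x y * (P y z * (b z * P z x))) UNIV) UNIV"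
      by (intro infsum_add s1 summable_on_uminus[THEN iffD2] s2)
    also have "\<dots> = 0" by (simp only: infsum_uminus sw) simp
    finally show ?thesis .
  qed
  have "infsum (\<lambda>(x, y, z). tri P x y z * (w x * (b y - b z))) UNIV
    = infsum (\<lambda>x. w x * infsum (\<lambda>y. infsum (\<lambda>z. P x y * P y z * P z x * (b y - b z)) UNIV) UNIV) UNIV"
    by (subst infsum_triple[OF s]) (simp only: infsum_cmult_right'[symmetric] prod.case tri_def mult_ac)
  then show ?thesis by (simp add: inner)
qed

text \<open>Splitting \<open>area w b\<close> into three terms that are cyclic permutations of each other reduces
  the shift invariance to \<open>P b P\<^sup>2 = P\<^sup>2 b P\<close> on the diagonal.\<close>

lemma tri_sum_zero:
  assumes P: "decays c C (P :: 'd::finite kernel)" and c: "c > 0" and idem: "kcomp P P = P"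
    and b: "\<And>i. cmod (b i) \<le> 1"
    and s: "(\<lambda>(x, y, z). tri P x y z * (w x * (b y - b z))) summable_on UNIV"
  shows "tri_sum P w b = 0"
proof -
  let ?f = "\<lambda>(x, y, z). tri P x y z * (w x * (b y - b z))"
  define r :: "'d idx \<times> 'd idx \<times> 'd idx \<Rightarrow> 'd idx \<times> 'd idx \<times> 'd idx" where "r = (\<lambda>(x, y, z). (y, z, x))"
  have r: "bij_betw r UNIV UNIV"
    by (rule bij_betw_byWitness[where f' = "\<lambda>(x, y, z). (z, x, y)"]) (simp_all add: r_def split_def)
  have z: "infsum ?f UNIV = 0" by (rule tri_sum_zero_piece[OF assms])
  have s1: "(\<lambda>t. ?f (r t)) summable_on UNIV" "infsum (\<lambda>t. ?f (r t)) UNIV = 0"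
    using summable_on_reindex_bij_betw[OF r, of ?f] infsum_reindex_bij_betw[OF r, of ?f] s z by simp_all
  have s2: "(\<lambda>t. ?f (r (r t))) summable_on UNIV" "infsum (\<lambda>t. ?f (r (r t))) UNIV = 0"
    using summable_on_reindex_bij_betw[OF r, of "\<lambda>t. ?f (r t)"] infsum_reindex_bij_betw[OF r, of "\<lambda>t. ?f (r t)"] s1 by simp_all
  \<comment> \<open>The product \<open>tri\<close> is invariant under the rotation \<open>r\<close>,
    and the three rotated weights add up to \<open>area_cyclic\<close>.\<close>
  have "(\<lambda>(x, y, z). tri P x y z * area w b x y z) = (\<lambda>t. ?f t + ?f (r t) + ?f (r (r t)))"
    unfolding r_def split_def fst_conv snd_conv area_cyclic by (rule ext) (simp add: tri_def algebra_simps)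
  then have "tri_sum P w b = infsum (\<lambda>t. ?f t + ?f (r t) + ?f (r (r t))) UNIV"
    unfolding tri_sum_def by (simp only:)
  also have "\<dots> = infsum (\<lambda>t. ?f t + ?f (r t)) UNIV + infsum (\<lambda>t. ?f (r (r t))) UNIV"
    by (rule infsum_add[OF summable_on_add[OF s s1(1)] s2(1)])
  also have "infsum (\<lambda>t. ?f t + ?f (r t)) UNIV = infsum ?f UNIV + infsum (\<lambda>t. ?f (r t)) UNIV"
    by (rule infsum_add[OF s s1(1)])
  finally show ?thesis by (simp only: z s1 s2 add_0)
qed

lemma tri_sum_diff_left:
  assumes "(\<lambda>(x, y, z). tri P x y z * area a b x y z) summable_on UNIV"
    "(\<lambda>(x, y, z). tri P x y z * area a' b x y z) summable_on UNIV"
  shows "tri_sum P (\<lambda>i. a i - a' i) b = tri_sum P a b - tri_sum P a' b"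
proof -
  have "tri_sum P (\<lambda>i. a i - a' i) b = infsum (\<lambda>t. (case t of (x, y, z) \<Rightarrow> tri P x y z * area a b x y z)
      + - (case t of (x, y, z) \<Rightarrow> tri P x y z * area a' b x y z)) UNIV"
    unfolding tri_sum_def area_diff_left split_def by (simp add: algebra_simps)
  also have "\<dots> = tri_sum P a b + - tri_sum P a' b"
    unfolding tri_sum_def infsum_uminus[symmetric]
    by (intro infsum_add summable_on_uminus[THEN iffD2] assms)
  finally show ?thesis by simp
qed

text \<open>The edges are moved one at a time. Moving one changes its indicator by a function
  \<open>w\<close> supported in a strip, which localizes the pieces that \<open>tri_sum_zero\<close>
  sums separately. Antisymmetry of the area brings the second edge into first position.\<close>

lemma tri_sum_shift:
  assumes P: "decays c C (P :: 'd::finite kernel)" and c: "c > 0" and idem: "kcomp P P = P"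
  shows "tri_sum P (half1 n) (half2 m) = tri_sum P (half1 0) (half2 0)"
proof -
  have 1: "tri_sum P (half1 n) (half2 m) = tri_sum P (half1 0) (half2 m)"
    using tri_sum_zero[OF P c idem half_norm(2) tri_localized_summable[OF P c localized_piece(1)[of n m]]]
      tri_sum_diff_left[OF tri_localized_summable[OF P c localized_piece(3)[of n m]]
        tri_localized_summable[OF P c localized_piece(3)[of 0 m]]]
    by simp
  have 2: "tri_sum P (half2 m) (half1 0) = tri_sum P (half2 0) (half1 0)"
    using tri_sum_zero[OF P c idem half_norm(1) tri_localized_summable[OF P c localized_piece(2)[of m 0]]]
      tri_sum_diff_left[OF tri_localized_summable[OF P c localized_piece(4)[of m 0]]
        tri_localized_summable[OF P c localized_piece(4)[of 0 0]]]
    by simp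
  show ?thesis using 1 2 tri_sum_swap[of P "half2 m" "half1 0"] tri_sum_swap[of P "half2 0" "half1 0"] by simp
qed

section \<open>Locality of the conductance\<close>

definition shift_idx :: "site \<Rightarrow> 'd idx \<Rightarrow> 'd idx" where
  "shift_idx s i = ((fst (fst i) + fst s, snd (fst i) + snd s), snd i)"

lemma idist_shift_idx [simp]: "idist (shift_idx s i) (shift_idx s j) = idist i j"
  by (simp add: idist_def l1_def shift_idx_def)

lemma bij_shift_idx: "bij_betw (shift_idx s) UNIV UNIV"
  by (rule bij_betw_byWitness[where f' = "shift_idx (- fst s, - snd s)"]) (simp_all add: shift_idx_def)

lemma decays_shift: "decays c C K \<Longrightarrow> cmod (K (shift_idx s i) (shift_idx s j)) \<le> C * exp (- c * idist i j)"
  using decaysD[of c C K "shift_idx s i" "shift_idx s j"] by simp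

lemma kcomp_shift_idx:
  "kcomp K L (shift_idx s i) (shift_idx s j) = infsum (\<lambda>l. K (shift_idx s i) (shift_idx s l) * L (shift_idx s l) (shift_idx s j)) UNIV"
  unfolding kcomp_def by (rule infsum_reindex_bij_betw[OF bij_shift_idx, symmetric])

text \<open>Entrywise convergence in coordinates centred at \<open>s r\<close>, with no rate and no
  uniformity; majorants independent of r supply what is missing.\<close>

definition close_along :: "(nat \<Rightarrow> site) \<Rightarrow> 'd kernel \<Rightarrow> 'd kernel \<Rightarrow> bool" where
  "close_along s K L \<longleftrightarrow> (\<forall>i j. (\<lambda>r. K (shift_idx (s r) i) (shift_idx (s r) j)
      - L (shift_idx (s r) i) (shift_idx (s r) j)) \<longlonglongrightarrow> 0)"

lemma tendsto_bounded_mult_0: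
  fixes f g :: "nat \<Rightarrow> complex"
  assumes "\<And>r. cmod (f r) \<le> B" "g \<longlonglongrightarrow> 0"
  shows "(\<lambda>r. f r * g r) \<longlonglongrightarrow> 0"
proof (rule tendsto_0_le[OF assms(2)])
  show "\<forall>\<^sub>F r in sequentially. norm (f r * g r) \<le> norm (g r) * B"
    by (intro always_eventually allI) (simp add: norm_mult mult.commute[of _ B] mult_right_mono assms(1))
qed

text \<open>The constants \<open>c\<close> and \<open>A\<close> are common to both operators and
  translation preserves distances, so one majorant serves all translated products.\<close>

lemma close_along_kpow:
  fixes H1 H2 :: "'d::finite kernel"
  assumes H1: "decaying_selfadjoint H1 c A" and H2: "decaying_selfadjoint H2 c A"
    and close: "close_along s H1 H2"
  shows "close_along s (kpow H1 k) (kpow H2 k)"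
proof -
  interpret H1: decaying_selfadjoint H1 c A by fact
  interpret H2: decaying_selfadjoint H2 c A by fact
  define g where "g = H1.growth"
  have A0: "0 \<le> A" by (rule H1.A_nonneg)
  have b1: "cmod (kpow H1 k (shift_idx u i) (shift_idx u j)) \<le> g ^ k"
    and b2: "cmod (kpow H2 k (shift_idx u i) (shift_idx u j)) \<le> g ^ k" for k i j u
    using decays_bounded[OF H1.kpow_decays, of k] decays_bounded[OF H2.kpow_decays, of k] H1.c_pos by (auto simp: g_def)
  have h1: "cmod (H1 (shift_idx u i) (shift_idx u j)) \<le> A * exp (- c * idist i j)"
    and h2: "cmod (H2 (shift_idx u i) (shift_idx u j)) \<le> A * exp (- c * idist i j)" for i j u
    by (rule decays_shift[OF H1.H_decays'], rule decays_shift[OF H2.H_decays'])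
  show ?thesis
  proof (induction k)
    case 0
    have "shift_idx u i = shift_idx u j \<longleftrightarrow> i = j" for u and i j :: "'d idx"
      by (simp add: shift_idx_def prod_eq_iff)
    then show ?case by (simp add: close_along_def)
  next
    case (Suc k)
    show ?case unfolding close_along_def
    proof (intro allI)
      fix i j :: "'d idx"
      let ?H1 = "\<lambda>r l. H1 (shift_idx (s r) i) (shift_idx (s r) l)"
      let ?H2 = "\<lambda>r l. H2 (shift_idx (s r) i) (shift_idx (s r) l)"
      let ?K1 = "\<lambda>r l. kpow H1 k (shift_idx (s r) l) (shift_idx (s r) j)"
      let ?K2 = "\<lambda>r l. kpow H2 k (shift_idx (s r) l) (shift_idx (s r) j)"
      define e where "e l = A * exp (- c * idist i l) * g ^ k" for l
      have es: "e summable_on UNIV" unfolding e_def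
        by (intro summable_on_cmult_left summable_on_cmult_right summable_exp_idist H1.c_pos)
      have le: "cmod (?H1 r l * ?K1 r l) \<le> e l" "cmod (?H2 r l * ?K2 r l) \<le> e l" for r l
        unfolding e_def norm_mult by (intro mult_mono h1 h2 b1 b2; simp add: A0)+
      have sm: "(\<lambda>l. ?H1 r l * ?K1 r l) summable_on UNIV" "(\<lambda>l. ?H2 r l * ?K2 r l) summable_on UNIV" for r
        using Infinite_Sum.abs_summable_on_comparison_test'[OF es le(1)]
          Infinite_Sum.abs_summable_on_comparison_test'[OF es le(2)] by (auto intro: abs_summable_summable)
      have "(\<lambda>r. infsum (\<lambda>l. ?H1 r l * ?K1 r l - ?H2 r l * ?K2 r l) UNIV) \<longlonglongrightarrow> 0"
      proof (rule infsum_dominated_tendsto_0)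
        show "(\<lambda>l. e l + e l) summable_on UNIV" by (intro summable_on_add es)
        show "norm (?H1 r l * ?K1 r l - ?H2 r l * ?K2 r l) \<le> e l + e l" for r l
          by (rule order_trans[OF norm_triangle_ineq4 add_mono[OF le]])
        fix l
        \<comment> \<open>The difference of products is telescoped into terms with one bounded
          factor and one that tends to 0.\<close>
        have "(\<lambda>r. ?H1 r l * (?K1 r l - ?K2 r l)) \<longlonglongrightarrow> 0"
          by (rule tendsto_bounded_mult_0[OF h1]) (use Suc in \<open>simp only: close_along_def\<close>)
        moreover have "(\<lambda>r. ?K2 r l * (?H1 r l - ?H2 r l)) \<longlonglongrightarrow> 0"
          by (rule tendsto_bounded_mult_0[OF b2]) (use close in \<open>simp only: close_along_def\<close>)
        ultimately have "(\<lambda>r. ?H1 r l * (?K1 r l - ?K2 r l) + ?K2 r l * (?H1 r l - ?H2 r l)) \<longlonglongrightarrow> 0"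
          by (rule tendsto_add_zero)
        then show "(\<lambda>r. ?H1 r l * ?K1 r l - ?H2 r l * ?K2 r l) \<longlonglongrightarrow> 0"
          by (simp add: algebra_simps)
      qed
      moreover have "infsum (\<lambda>l. ?H1 r l * ?K1 r l - ?H2 r l * ?K2 r l) UNIV
          = kpow H1 (Suc k) (shift_idx (s r) i) (shift_idx (s r) j) - kpow H2 (Suc k) (shift_idx (s r) i) (shift_idx (s r) j)" for r
        unfolding kpow.simps kcomp_shift_idx diff_conv_add_uminus infsum_uminus[symmetric]
        by (rule infsum_add[OF sm(1)]) (use sm(2) in \<open>simp add: summable_on_uminus\<close>)
      ultimately show "(\<lambda>r. kpow H1 (Suc k) (shift_idx (s r) i) (shift_idx (s r) j)
          - kpow H2 (Suc k) (shift_idx (s r) i) (shift_idx (s r) j)) \<longlonglongrightarrow> 0" by simp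
    qed
  qed
qed

lemma close_along_kpoly:
  assumes "\<And>k. close_along s (kpow H1 k) (kpow H2 k)"
  shows "close_along s (kpoly H1 p) (kpoly H2 p)"
  unfolding close_along_def
proof (intro allI)
  fix i j :: "'a idx"
  have "(\<lambda>r. \<Sum>k\<le>degree p. coeff p k * (kpow H1 k (shift_idx (s r) i) (shift_idx (s r) j)
      - kpow H2 k (shift_idx (s r) i) (shift_idx (s r) j))) \<longlonglongrightarrow> 0"
    by (intro tendsto_null_sum tendsto_mult_right_zero) (use assms in \<open>simp only: close_along_def\<close>)
  then show "(\<lambda>r. kpoly H1 p (shift_idx (s r) i) (shift_idx (s r) j)
      - kpoly H2 p (shift_idx (s r) i) (shift_idx (s r) j)) \<longlonglongrightarrow> 0"
    by (simp only: kpoly_def right_diff_distrib sum_subtractf)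
qed

text \<open>Both series have the same terms \<open>u k\<close>. The spectral ratios
  \<open>q1\<close> and \<open>q2\<close> may differ, so the majorant adds the two geometric
  bounds.\<close>

lemma close_along_kseries:
  assumes H1: "spectral_series H1 c A u D q1 b" and H2: "spectral_series H2 c A u D q2 b"
    and close: "\<And>p. close_along s (kpoly H1 p) (kpoly H2 p)"
  shows "close_along s (kseries H1 u) (kseries H2 u)"
  unfolding close_along_def
proof (intro allI)
  fix i j :: "'a idx"
  interpret H1: spectral_series H1 c A u D q1 b by fact
  interpret H2: spectral_series H2 c A u D q2 b by fact
  let ?f1 = "\<lambda>r k. kpoly H1 (u k) (shift_idx (s r) i) (shift_idx (s r) j)"
  let ?f2 = "\<lambda>r k. kpoly H2 (u k) (shift_idx (s r) i) (shift_idx (s r) j)"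
  have UN: "{0::nat..} = UNIV" by auto
  have gs: "(\<lambda>k. D * sqrt q1 ^ k + D * sqrt q2 ^ k) summable_on UNIV"
    using has_sum_imp_summable[OF H1.geometric_tail[of 0]] has_sum_imp_summable[OF H2.geometric_tail[of 0]]
    unfolding UN by (intro summable_on_add summable_on_cmult_right)
  have "(\<lambda>r. infsum (\<lambda>k. ?f1 r k - ?f2 r k) UNIV) \<longlonglongrightarrow> 0"
  proof (rule infsum_dominated_tendsto_0[OF gs])
    show "norm (?f1 r k - ?f2 r k) \<le> D * sqrt q1 ^ k + D * sqrt q2 ^ k" for r k
      by (rule order_trans[OF norm_triangle_ineq4 add_mono[OF
          decays_bounded[OF H1.term_decays less_imp_le[OF H1.rate_pos]]
          decays_bounded[OF H2.term_decays less_imp_le[OF H2.rate_pos]]]])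
    show "(\<lambda>r. ?f1 r k - ?f2 r k) \<longlonglongrightarrow> 0" for k using close by (simp only: close_along_def)
  qed
  moreover have "infsum (\<lambda>k. ?f1 r k - ?f2 r k) UNIV
    = kseries H1 u (shift_idx (s r) i) (shift_idx (s r) j) - kseries H2 u (shift_idx (s r) i) (shift_idx (s r) j)" for r
    unfolding kseries_def diff_conv_add_uminus infsum_uminus[symmetric]
    by (intro infsum_add summable_on_uminus[THEN iffD2])
      (rule abs_summable_summable[OF H1.term_summable], rule abs_summable_summable[OF H2.term_summable])
  ultimately show "(\<lambda>r. kseries H1 u (shift_idx (s r) i) (shift_idx (s r) j)
      - kseries H2 u (shift_idx (s r) i) (shift_idx (s r) j)) \<longlonglongrightarrow> 0" by simp
qed

text \<open>Relabelling all three points by a translation brings the corner back to the origin and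
  translates the kernel instead.\<close>

lemma tri_sum_shift_idx:
  fixes P :: "'d kernel"
  shows "tri_sum P (half1 (fst s)) (half2 (snd s))
    = tri_sum (\<lambda>i j. P (shift_idx s i) (shift_idx s j)) (half1 0) (half2 0)"
proof -
  let ?g = "\<lambda>t :: 'd idx \<times> 'd idx \<times> 'd idx. (shift_idx s (fst t), shift_idx s (fst (snd t)), shift_idx s (snd (snd t)))"
  let ?h = "\<lambda>t :: 'd idx \<times> 'd idx \<times> 'd idx. (shift_idx (- fst s, - snd s) (fst t),
    shift_idx (- fst s, - snd s) (fst (snd t)), shift_idx (- fst s, - snd s) (snd (snd t)))"
  have g: "bij_betw ?g UNIV UNIV"
    by (rule bij_betw_byWitness[where f' = ?h]) (simp_all add: shift_idx_def)
  have "half1 (fst s) (shift_idx s i) = half1 0 i" "half2 (snd s) (shift_idx s i) = half2 0 i" for i :: "'d idx"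
    by (simp_all add: half1_def half2_def shift_idx_def)
  then show ?thesis unfolding tri_sum_def
    by (subst infsum_reindex_bij_betw[OF g, symmetric]) (simp add: split_def tri_def area_def)
qed

text \<open>Letting the corner follow \<open>s r\<close> changes neither sum, so the difference of
  the sums for the translated kernels is constant in r. By dominated convergence it also tends to
  0.\<close>

lemma tri_sum_eq_of_close:
  fixes P1 P2 :: "'d::finite kernel"
  assumes P1: "decays c1 C1 P1" "c1 > 0" "kcomp P1 P1 = P1"
    and P2: "decays c2 C2 P2" "c2 > 0" "kcomp P2 P2 = P2"
    and close: "close_along s P1 P2"
  shows "tri_sum P1 (half1 0) (half2 0) = tri_sum P2 (half1 0) (half2 0)"
proof -
  let ?a = "area (half1 0) (half2 0 :: 'd idx \<Rightarrow> complex)"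
  define Q1 Q2 where "Q1 r = (\<lambda>i j. P1 (shift_idx (s r) i) (shift_idx (s r) j))"
    and "Q2 r = (\<lambda>i j. P2 (shift_idx (s r) i) (shift_idx (s r) j))" for r
  have Q: "decays c1 C1 (Q1 r)" "decays c2 C2 (Q2 r)" for r
    unfolding Q1_def Q2_def by (subst decays_def, intro allI, rule decays_shift[OF P1(1)])
      (subst decays_def, intro allI, rule decays_shift[OF P2(1)])
  have e: "tri_sum P1 (half1 0) (half2 0) = tri_sum (Q1 r) (half1 0) (half2 0)"
    "tri_sum P2 (half1 0) (half2 0) = tri_sum (Q2 r) (half1 0) (half2 0)" for r
    unfolding Q1_def Q2_def
    by (rule trans[OF tri_sum_shift[OF P1, symmetric, of "fst (s r)" "snd (s r)"] tri_sum_shift_idx],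
        rule trans[OF tri_sum_shift[OF P2, symmetric, of "fst (s r)" "snd (s r)"] tri_sum_shift_idx])
  have loc: "localized 2 0 ?a" using localized_piece(3)[of 0 0] by simp
  have sm: "(\<lambda>(x, y, z). tri (Q1 r) x y z * ?a x y z) summable_on UNIV"
    "(\<lambda>(x, y, z). tri (Q2 r) x y z * ?a x y z) summable_on UNIV" for r
    by (rule tri_localized_summable[OF Q(1) P1(2) loc], rule tri_localized_summable[OF Q(2) P2(2) loc])
  define w where "w = (\<lambda>(x, y, z). C1 ^ 3 * 2 * tri_weight (c1 / 2) x y z + C2 ^ 3 * 2 * tri_weight (c2 / 2) x (y :: 'd idx) z)"
  have ws: "w summable_on UNIV" unfolding w_def split_def
    using tri_weight_summable[of "c1/2", where ?'d = 'd] tri_weight_summable[of "c2/2", where ?'d = 'd] P1(2) P2(2)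
    unfolding split_def by (intro summable_on_add summable_on_cmult_right) auto
  have qd: "(\<lambda>r. Q1 r i j - Q2 r i j) \<longlonglongrightarrow> 0" for i j
    using close by (simp only: close_along_def Q1_def Q2_def)
  have qb: "cmod (Q1 r i j) \<le> C1" "cmod (Q2 r i j) \<le> C2" for r i j
    by (rule decays_bounded[OF Q(1) less_imp_le[OF P1(2)]], rule decays_bounded[OF Q(2) less_imp_le[OF P2(2)]])
  have "(\<lambda>r. infsum (\<lambda>t. (case t of (x, y, z) \<Rightarrow> tri (Q1 r) x y z * ?a x y z)
      - (case t of (x, y, z) \<Rightarrow> tri (Q2 r) x y z * ?a x y z)) UNIV) \<longlonglongrightarrow> 0"
  proof (rule infsum_dominated_tendsto_0[OF ws])
    fix r and t :: "'d idx \<times> 'd idx \<times> 'd idx"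
    obtain x y z where t: "t = (x, y, z)" by (rule prod_cases3)
    have "cmod (tri (Q1 r) x y z * ?a x y z - tri (Q2 r) x y z * ?a x y z)
      \<le> C1 ^ 3 * 2 * exp (c1 / 2 * 0) * tri_weight (c1 / 2) x y z + C2 ^ 3 * 2 * exp (c2 / 2 * 0) * tri_weight (c2 / 2) x y z"
      by (rule order_trans[OF norm_triangle_ineq4 add_mono[OF tri_localized_le[OF Q(1) P1(2) loc] tri_localized_le[OF Q(2) P2(2) loc]]])
    then show "norm ((case t of (x, y, z) \<Rightarrow> tri (Q1 r) x y z * ?a x y z)
      - (case t of (x, y, z) \<Rightarrow> tri (Q2 r) x y z * ?a x y z)) \<le> w t" by (simp add: w_def t)
  next
    fix t :: "'d idx \<times> 'd idx \<times> 'd idx"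
    obtain x y z where t: "t = (x, y, z)" by (rule prod_cases3)
    \<comment> \<open>The three factors of \<open>tri\<close> are exchanged one at a time.\<close>
    have 1: "(\<lambda>r. Q1 r x y * Q1 r y z * (Q1 r z x - Q2 r z x)) \<longlonglongrightarrow> 0"
    proof (rule tendsto_bounded_mult_0[OF _ qd])
      show "cmod (Q1 r x y * Q1 r y z) \<le> C1 * C1" for r
        unfolding norm_mult by (intro mult_mono qb) (use decays_const_nonneg[OF P1(1)] in auto)
    qed
    have 2: "(\<lambda>r. Q1 r x y * Q2 r z x * (Q1 r y z - Q2 r y z)) \<longlonglongrightarrow> 0"
    proof (rule tendsto_bounded_mult_0[OF _ qd])
      show "cmod (Q1 r x y * Q2 r z x) \<le> C1 * C2" for r
        unfolding norm_mult by (intro mult_mono qb) (use decays_const_nonneg[OF P1(1)] in auto)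
    qed
    have 3: "(\<lambda>r. Q2 r y z * Q2 r z x * (Q1 r x y - Q2 r x y)) \<longlonglongrightarrow> 0"
    proof (rule tendsto_bounded_mult_0[OF _ qd])
      show "cmod (Q2 r y z * Q2 r z x) \<le> C2 * C2" for r
        unfolding norm_mult by (intro mult_mono qb) (use decays_const_nonneg[OF P2(1)] in auto)
    qed
    have "(\<lambda>r. (Q1 r x y * Q1 r y z * (Q1 r z x - Q2 r z x) + Q1 r x y * Q2 r z x * (Q1 r y z - Q2 r y z)
        + Q2 r y z * Q2 r z x * (Q1 r x y - Q2 r x y)) * ?a x y z) \<longlonglongrightarrow> 0"
      by (intro tendsto_mult_left_zero tendsto_add_zero 1 2 3)
    then show "(\<lambda>r. (case t of (x, y, z) \<Rightarrow> tri (Q1 r) x y z * ?a x y z)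
      - (case t of (x, y, z) \<Rightarrow> tri (Q2 r) x y z * ?a x y z)) \<longlonglongrightarrow> 0"
      by (simp add: t tri_def algebra_simps)
  qed
  moreover have "infsum (\<lambda>t. (case t of (x, y, z) \<Rightarrow> tri (Q1 r) x y z * ?a x y z)
      - (case t of (x, y, z) \<Rightarrow> tri (Q2 r) x y z * ?a x y z)) UNIV
    = tri_sum P1 (half1 0) (half2 0) - tri_sum P2 (half1 0) (half2 0)" for r
  proof -
    have "infsum (\<lambda>t. (case t of (x, y, z) \<Rightarrow> tri (Q1 r) x y z * ?a x y z)
        + - (case t of (x, y, z) \<Rightarrow> tri (Q2 r) x y z * ?a x y z)) UNIV
      = tri_sum (Q1 r) (half1 0) (half2 0) + - tri_sum (Q2 r) (half1 0) (half2 0)"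
      unfolding tri_sum_def infsum_uminus[symmetric]
      by (intro infsum_add summable_on_uminus[THEN iffD2] sm)
    then show ?thesis by (simp only: e[symmetric] diff_conv_add_uminus)
  qed
  ultimately show ?thesis by (simp add: LIMSEQ_const_iff)
qed

section \<open>From short-range Hamiltonians to equal conductances\<close>

lemma cmod_le_mat_norm: "cmod (K i j) \<le> mat_norm (block K (fst i) (fst j))"
proof -
  let ?A = "block K (fst i) (fst j)"
  have "K i j = (?A *v axis (snd j) 1) $ snd i"
    by (simp add: block_def matrix_vector_mult_def axis_def if_distrib[of "times _"] sum.delta cong: if_cong)
  also have "cmod \<dots> \<le> norm (?A *v axis (snd j) 1)" by (rule Finite_Cartesian_Product.norm_nth_le)
  also have "\<dots> \<le> mat_norm ?A * norm (axis (snd j) (1::complex) :: complex^'a)"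
    unfolding mat_norm_def by (rule onorm) (rule matrix_vector_mul_bounded_linear)
  also have "norm (axis (snd j) (1::complex) :: complex^'a) = 1" 
    by (simp add: norm_vec_def axis_def L2_set_def if_distrib[of norm] if_distrib[of "\<lambda>t. t\<^sup>2"] cong: if_cong)
  finally show ?thesis by simp
qed

lemma short_range_decaying:
  assumes "short_range \<nu> (H :: 'd::finite kernel)" "0 < \<nu>"
  shows "decaying_selfadjoint H \<nu> (1 / \<nu>)"
proof
  show "decays (2 * \<nu>) (1 / \<nu>) H" unfolding decays_def
  proof (intro allI)
    fix i j
    have "cmod (H i j) \<le> exp (- 2 * \<nu> * real_of_int (l1 (fst i) (fst j))) / \<nu>"
      by (rule order_trans[OF cmod_le_mat_norm]) (use assms(1) in \<open>simp only: short_range_def\<close>)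
    then show "cmod (H i j) \<le> 1 / \<nu> * exp (- (2 * \<nu>) * idist i j)" by (simp add: idist_def)
  qed
  show "H j i = cnj (H i j)" for i j using assms(1) unfolding short_range_def selfadjoint_kernel_def by blast
qed (fact assms(2))

lemma conductance_eq_of_close:
  fixes H1 H2 :: "'d::finite kernel"
  assumes nu: "0 < \<nu>" and H1: "short_range \<nu> H1" and H2: "short_range \<nu> H2"
    and gap: "complex_of_real lam \<notin> spec H1" "complex_of_real lam \<notin> spec H2"
    and close: "close_along s H1 H2"
  shows "conductance H1 lam = conductance H2 lam"
proof -
  interpret D1: decaying_selfadjoint H1 \<nu> "1 / \<nu>" by (rule short_range_decaying[OF H1 nu])
  interpret D2: decaying_selfadjoint H2 \<nu> "1 / \<nu>" by (rule short_range_decaying[OF H2 nu])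
  \<comment> \<open>As \<open>growth\<close> depends only on the rate and constant of decay, it is
    the same number for both operators; a common \<open>M\<close> then yields both projections from
    one series.\<close>
  define M where "M = D1.growth + \<bar>lam\<bar> + 1"
  have M: "D1.growth + \<bar>lam\<bar> \<le> M" "D2.growth + \<bar>lam\<bar> \<le> M" "0 < M"
    using D1.growth_nonneg by (simp_all add: M_def)
  interpret G1: spectral_gap H1 \<nu> "1 / \<nu>" lam M
    by (rule D1.spectral_gapI[OF D1.not_in_spectral_set[OF gap(1)] M(1,3)])
  interpret G2: spectral_gap H2 \<nu> "1 / \<nu>" lam M
    by (rule D2.spectral_gapI[OF D2.not_in_spectral_set[OF gap(2)] M(2,3)])
  have cp: "close_along s (kpoly H1 p) (kpoly H2 p)" for p
    by (rule close_along_kpoly[OF close_along_kpow[OF D1.decaying_selfadjoint_axioms D2.decaying_selfadjoint_axioms close]])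
  have "close_along s (kseries H1 (gap_series sgn_coeff lam M)) (kseries H2 (gap_series sgn_coeff lam M))"
    by (rule close_along_kseries[OF G1.sign.spectral_series_axioms G2.sign.spectral_series_axioms cp])
  have cP: "close_along s G1.proj G2.proj"
    unfolding close_along_def
  proof (intro allI)
    fix i j
    have "(\<lambda>r. - 1/2 * (kseries H1 (gap_series sgn_coeff lam M) (shift_idx (s r) i) (shift_idx (s r) j)
      - kseries H2 (gap_series sgn_coeff lam M) (shift_idx (s r) i) (shift_idx (s r) j))) \<longlonglongrightarrow> 0"
      by (rule tendsto_mult_right_zero) (use \<open>close_along s (kseries H1 _) _\<close> in \<open>simp only: close_along_def\<close>)
    then show "(\<lambda>r. G1.proj (shift_idx (s r) i) (shift_idx (s r) j) - G2.proj (shift_idx (s r) i) (shift_idx (s r) j)) \<longlonglongrightarrow> 0"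
      by (simp add: G1.proj_def G2.proj_def algebra_simps)
  qed
  have "tri_sum G1.proj (half1 0) (half2 0) = tri_sum G2.proj (half1 0) (half2 0)"
    by (rule tri_sum_eq_of_close[OF G1.proj_decays G1.sign.rate_pos G1.proj_idem
          G2.proj_decays G2.sign.rate_pos G2.proj_idem cP])
  then show ?thesis
    unfolding conductance_def Let_def G1.spec_proj_eq G2.spec_proj_eq
      ktrace_eq_tri_sum[OF G1.proj_decays G1.sign.rate_pos] ktrace_eq_tri_sum[OF G2.proj_decays G2.sign.rate_pos]
    by simp
qed

section \<open>Large balls away from the interface\<close>

lemma filling_radius_infinite:
  assumes "filling_radius \<Omega> = \<infinity>" shows "\<exists>x. lball x (real n) \<subseteq> \<Omega>"
proof -
  have "ereal (real n) < Sup {ereal r | r. \<exists>x. lball x r \<subseteq> \<Omega>}"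
    using assms by (simp add: filling_radius_def)
  then obtain r x where "real n < r" "lball x r \<subseteq> \<Omega>" unfolding less_Sup_iff by auto
  then show ?thesis by (intro exI[of _ x]) (auto simp: lball_def)
qed

lemma bdry_compl: "bdry (- \<Omega>) = bdry \<Omega>"
  by (auto simp: bdry_def)

text \<open>With an empty boundary the set would be closed under unit steps, and a horizontal walk
  followed by a vertical one reaches every site.\<close>

lemma bdry_nonempty:
  assumes x: "x \<in> \<Omega>" and y: "y \<notin> \<Omega>" shows "bdry \<Omega> \<noteq> {}"
proof
  assume e: "bdry \<Omega> = {}"
  have step: "q \<in> \<Omega>" if "p \<in> \<Omega>" "l1 q p \<le> 1" for p q
  proof -
    have "lball p 1 \<subseteq> \<Omega>" using e that(1) by (auto simp: bdry_def)
    then show ?thesis using that(2) by (auto simp: lball_def)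
  qed
  have 1: "(m, snd x) \<in> \<Omega>" for m
  proof (induction m rule: int_induct[where k = "fst x"])
    case base show ?case using x by simp
  next
    case (step1 i) show ?case by (rule step[OF step1(2)]) (simp add: l1_def)
  next
    case (step2 i) show ?case by (rule step[OF step2(2)]) (simp add: l1_def)
  qed
  have "(m, n) \<in> \<Omega>" for m n
  proof (induction n rule: int_induct[where k = "snd x"])
    case base show ?case by (rule 1)
  next
    case (step1 i) show ?case by (rule step[OF step1(2)]) (simp add: l1_def)
  next
    case (step2 i) show ?case by (rule step[OF step2(2)]) (simp add: l1_def)
  qed
  from this[of "fst y" "snd y"] y show False by simp
qed

text \<open>Nonemptiness of the boundary matters: \<open>bdist\<close> would otherwise be an infimum over the empty set.\<close>

lemma bdist_ge:
  assumes ball: "lball x r \<subseteq> \<Omega>" and ne: "bdry \<Omega> \<noteq> {}"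
  shows "r - 1 - real_of_int (l1 p x) \<le> bdist \<Omega> p"
  unfolding bdist_def
proof (rule cInf_greatest)
  show "(\<lambda>y. real_of_int (l1 p y)) ` bdry \<Omega> \<noteq> {}" using ne by simp
  fix t assume "t \<in> (\<lambda>y. real_of_int (l1 p y)) ` bdry \<Omega>"
  then obtain y where y: "y \<in> bdry \<Omega>" "t = real_of_int (l1 p y)" by auto
  have tr: "l1 a c \<le> l1 a b + l1 b c" for a b c unfolding l1_def by linarith
  \<comment> \<open>The 1 is the reach of \<open>bdry\<close>: a point nearer than r - 1 to the
    centre has its whole unit ball inside the large ball, so it is not a boundary point.\<close>
  have "r - 1 \<le> real_of_int (l1 y x)"
  proof (rule ccontr)
    assume "\<not> r - 1 \<le> real_of_int (l1 y x)"
    then have lt: "real_of_int (l1 y x) < r - 1" by simp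
    have "lball y 1 \<subseteq> \<Omega>"
    proof (rule subset_trans[OF _ ball], rule subsetI)
      fix z assume "z \<in> lball y 1"
      then have "real_of_int (l1 z y) \<le> 1" by (simp add: lball_def)
      moreover have "real_of_int (l1 z x) \<le> real_of_int (l1 z y) + real_of_int (l1 y x)"
        using tr[of z x y] by linarith
      ultimately show "z \<in> lball x r" using lt by (simp add: lball_def)
    qed
    moreover have "y \<in> \<Omega>" using lt ball by (auto simp: lball_def)
    ultimately show False using y(1) by (auto simp: bdry_def)
  qed
  moreover have "l1 y x \<le> l1 p y + l1 p x"
    using tr[of y x p] by (simp add: l1_def abs_minus_commute)
  ultimately show "r - 1 - real_of_int (l1 p x) \<le> t" using y(2) by linarith
qed

text \<open>The translates of fixed \<open>i\<close> and \<open>j\<close> stay at fixed distance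
  from the centre, so they eventually lie in the ball, where the perturbation is just
  \<open>He\<close> minus \<open>Hp\<close>. The lower bound on their distance to the boundary grows
  like r.\<close>

lemma close_along_edge:
  fixes Hp Hm He :: "'d::finite kernel"
  assumes nu: "0 < \<nu>"
    and edge: "\<And>x y. mat_norm (block (edge_pert He Hp Hm \<Omega>) x y) \<le> exp (- 2 * \<nu> * bdist \<Omega> x) / \<nu>"
    and ne: "bdry \<Omega> \<noteq> {}" and ball: "\<And>r. lball (s r) (real r) \<subseteq> \<Omega>"
  shows "close_along s He Hp"
  unfolding close_along_def
proof (intro allI)
  fix i j :: "'d idx"
  define n m where "n = \<bar>fst (fst i)\<bar> + \<bar>snd (fst i)\<bar>" and "m = \<bar>fst (fst j)\<bar> + \<bar>snd (fst j)\<bar>"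
  have l: "l1 (fst (shift_idx (s r) i)) (s r) = n" "l1 (fst (shift_idx (s r) j)) (s r) = m" for r
    by (simp_all add: l1_def shift_idx_def n_def m_def)
  define e where "e r = exp (- 2 * \<nu> * (real r - 1 - real_of_int n)) / \<nu>" for r
  have "e r = exp (2 * \<nu> * (1 + real_of_int n)) / \<nu> * exp (- 2 * \<nu>) ^ r" for r
    unfolding e_def exp_of_nat_mult[symmetric] times_divide_eq_left exp_add[symmetric]
    by (simp add: algebra_simps)
  moreover have "(\<lambda>r. exp (2 * \<nu> * (1 + real_of_int n)) / \<nu> * exp (- 2 * \<nu>) ^ r) \<longlonglongrightarrow> 0"
    using nu by (intro tendsto_mult_right_zero LIMSEQ_realpow_zero) auto
  ultimately have e0: "e \<longlonglongrightarrow> 0" by presburger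
  show "(\<lambda>r. He (shift_idx (s r) i) (shift_idx (s r) j) - Hp (shift_idx (s r) i) (shift_idx (s r) j)) \<longlonglongrightarrow> 0"
  proof (rule Lim_null_comparison[OF _ e0])
    show "\<forall>\<^sub>F r in sequentially. norm (He (shift_idx (s r) i) (shift_idx (s r) j) - Hp (shift_idx (s r) i) (shift_idx (s r) j)) \<le> e r"
      unfolding eventually_sequentially
    proof (intro exI[of _ "nat (n + m)"] allI impI)
      fix r assume r: "nat (n + m) \<le> r"
      have nm: "n \<le> int r" "m \<le> int r" using r by (auto simp: n_def m_def)
      have "fst (shift_idx (s r) i) \<in> lball (s r) (real r)" "fst (shift_idx (s r) j) \<in> lball (s r) (real r)"
        using nm unfolding lball_def mem_Collect_eq l by linarith+
      then have O: "fst (shift_idx (s r) i) \<in> \<Omega>" "fst (shift_idx (s r) j) \<in> \<Omega>" using ball by blast+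
      have "cmod (edge_pert He Hp Hm \<Omega> (shift_idx (s r) i) (shift_idx (s r) j)) \<le> exp (- 2 * \<nu> * bdist \<Omega> (fst (shift_idx (s r) i))) / \<nu>"
        by (rule order_trans[OF cmod_le_mat_norm edge])
      also have "\<dots> \<le> e r"
        using bdist_ge[OF ball[of r] ne, of "fst (shift_idx (s r) i)"] nu unfolding l e_def by (simp add: divide_right_mono)
      finally show "norm (He (shift_idx (s r) i) (shift_idx (s r) j) - Hp (shift_idx (s r) i) (shift_idx (s r) j)) \<le> e r"
        using O by (simp add: edge_pert_def)
    qed
  qed
qed

text \<open>Exchanging the two phases and complementing the region is a symmetry, so the argument in
  \<open>\<Omega>\<close> also serves its complement.\<close>

lemma edge_pert_compl: "edge_pert He Hm Hp (- \<Omega>) = edge_pert He Hp Hm \<Omega>"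
  by (simp add: edge_pert_def fun_eq_iff)

theorem theorem1:
  fixes \<nu> :: real
    and Hp Hm He :: "'d::finite kernel"
    and G :: "real set"
    and \<Omega> :: "site set"
  assumes nu: "0 < \<nu>" "\<nu> \<le> 1"
    and A1_short: "short_range \<nu> Hp" "short_range \<nu> Hm"
    and A1_gap: "is_interval G" "\<forall>lam\<in>G. complex_of_real lam \<notin> spec Hp \<and> complex_of_real lam \<notin> spec Hm"
    and A1_top: "conductance_on Hp G \<noteq> conductance_on Hm G"
    and A2_short: "short_range \<nu> He"
    and A2_edge: "\<forall>x y. mat_norm (block (edge_pert He Hp Hm \<Omega>) x y) \<le> exp (- 2 * \<nu> * bdist \<Omega> x) / \<nu>"
    and Fr: "filling_radius \<Omega> = \<infinity>" "filling_radius (- \<Omega>) = \<infinity>"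
  shows "complex_of_real ` G \<subseteq> spec He"
proof (rule ccontr)
  assume "\<not> complex_of_real ` G \<subseteq> spec He"
  then obtain lam where lam: "lam \<in> G" "complex_of_real lam \<notin> spec He" by blast
  obtain sp where sp: "\<And>r. lball (sp r) (real r) \<subseteq> \<Omega>" using filling_radius_infinite[OF Fr(1)] by metis
  obtain sm where sm: "\<And>r. lball (sm r) (real r) \<subseteq> - \<Omega>" using filling_radius_infinite[OF Fr(2)] by metis
  \<comment> \<open>Balls of radius 0 provide one site on each side of the interface, which rules
    out an empty boundary.\<close>
  have "x \<in> lball x 0" for x by (simp add: lball_def l1_def)
  then have "sp 0 \<in> \<Omega>" "sm 0 \<notin> \<Omega>" using sp[of 0] sm[of 0] unfolding of_nat_0 by blast+
  then have ne: "bdry \<Omega> \<noteq> {}" by (rule bdry_nonempty)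
  have "close_along sp He Hp" by (rule close_along_edge[OF nu(1) _ ne sp]) (use A2_edge in blast)
  moreover have "close_along sm He Hm"
  proof (rule close_along_edge[OF nu(1) _ _ sm])
    show "mat_norm (block (edge_pert He Hm Hp (- \<Omega>)) x y) \<le> exp (- 2 * \<nu> * bdist (- \<Omega>) x) / \<nu>" for x y
      using A2_edge by (simp only: edge_pert_compl bdist_def bdry_compl)
    show "bdry (- \<Omega>) \<noteq> {}" using ne by (simp add: bdry_compl)
  qed
  ultimately have "conductance Hp lam = conductance Hm lam"
    using conductance_eq_of_close[OF nu(1) A2_short A1_short(1) lam(2)]
      conductance_eq_of_close[OF nu(1) A2_short A1_short(2) lam(2)] A1_gap(2) lam(1) by metis
  \<comment> \<open>The energy at which \<open>conductance_on\<close> evaluates is unspecified;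
    constancy in the gap moves it to \<open>lam\<close>, the point outside the spectrum of
    \<open>He\<close>.\<close>
  moreover have "conductance_on Hp G = conductance Hp lam" "conductance_on Hm G = conductance Hm lam"
    using A1_gap lam(1) by (auto intro: conductance_on_eq)
  ultimately show False using A1_top by simp
qed

end
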